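(* Let $\alpha>0$ and $\psi\in L^1(\mathbb R)$. The map $$S:(AP(\mathbb R),\|\cdot\|_{AP})\to(AP(\mathbb Z),\|\cdot\|_{AP(\mathbb Z)}),\qquad f\mapsto\big(\langle f,T_{k\alpha}\psi\rangle\big)_{k\in\mathbb Z},$$ is continuous if and only if $$\sup_{\lambda\in\mathbb R}\sum_{k\in\mathbb Z}\Big|\widehat\psi\big(\lambda+2\pi\tfrac k\alpha\big)\Big|^2<\infty.$$ In particular, this is the case when $\psi\in W$ or $\psi\in L^1(\mathbb R)\cap\widehat W$.
   Context: $AP(\mathbb R)$ is the space of Bohr almost periodic functions: continuous $f:\mathbb R\to\mathbb C$ such that for every $\epsilon>0$ there is $L>0$ such that every interval of length greater than $L$ contains $\tau$ with $\sup_t|f(t+\tau)-f(t)|\le\epsilon$. It carries the inner product $(f,g)_{AP}=\lim_{T\to\infty}\frac1{2T}\int_{-T}^Tf(t)\overline{g(t)}\,dt$, with norm $\|\cdot\|_{AP}$. $AP(\mathbb Z)$ is the space of almost periodic sequences: complex sequences $(a_n)_{n\in\mathbb Z}$ such that for every $\epsilon>0$ there is $N\in\mathbb N$ such that any $N$ consecutive integers contain an integer $p$ with $\sup_n|a_{n+p}-a_n|\le\epsilon$. It carries the inner product $(a,b)_{AP(\mathbb Z)}=\lim_{p\to\infty}\frac1{2p}\sum_{n=-p}^pa_n\overline{b_n}$, with norm $\|\cdot\|_{AP(\mathbb Z)}$. $\langle f,g\rangle=\int_{\mathbb R}f(t)\overline{g(t)}\,dt$, $T_x\psi(t)=\psi(t-x)$,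 and $\widehat\psi(\lambda)=\int_{\mathbb R}\psi(t)e^{-i\lambda t}\,dt$ for $\psi\in L^1(\mathbb R)$. For $f\in AP(\mathbb R)$ and $\psi\in L^1(\mathbb R)$ the sequence $(\langle f,T_{k\alpha}\psi\rangle)_k$ is in $AP(\mathbb Z)$. $W$ is the Wiener space of $\psi\in L^\infty(\mathbb R)$ with $\|\psi\|_W=\sum_{k\in\mathbb Z}\operatorname{ess\,sup}_{x\in[0,1]}|\psi(x-k)|<\infty$. $\widehat W$ is the set of Fourier transforms of elements of $W$, i.e. of functions whose Fourier transform lies in $W$. *)

theory Defs
  imports "HOL-Analysis.Analysis" "HOL-Probability.Essential_Supremum"
begin

text \<open>The interval condition is stated for open intervals; every interval of length greater
  than \<open>L\<close> contains an open one.  The bound on the supremum is written out pointwise.\<close>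

definition AP_R :: "(real \<Rightarrow> complex) set" where
  "AP_R = {f. continuous_on UNIV f \<and>
     (\<forall>\<epsilon>>0. \<exists>L>0. \<forall>a b. b - a > L \<longrightarrow>
        (\<exists>\<tau>\<in>{a<..<b}. \<forall>t. cmod (f (t + \<tau>) - f t) \<le> \<epsilon>))}"

definition AP_R_inner :: "(real \<Rightarrow> complex) \<Rightarrow> (real \<Rightarrow> complex) \<Rightarrow> complex" where
  "AP_R_inner f g =
     Lim at_top (\<lambda>T::real. of_real (1 / (2 * T)) * (LINT t:{-T..T}|lebesgue. f t * cnj (g t)))"

text \<open>On \<open>AP_R\<close> the number \<open>AP_R_inner f f\<close> is real and nonnegative, so the modulus below is
  harmless.  It makes the total function \<open>AP_R_norm\<close> nonnegative everywhere, as the locale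
  \<open>Metric_space\<close> requires of a distance even outside the carrier.  The same applies to
  \<open>AP_Z_norm\<close>.\<close>

definition AP_R_norm :: "(real \<Rightarrow> complex) \<Rightarrow> real" where
  "AP_R_norm f = sqrt (cmod (AP_R_inner f f))"

definition AP_Z :: "(int \<Rightarrow> complex) set" where
  "AP_Z = {a. \<forall>\<epsilon>>0. \<exists>N::nat. \<forall>m::int.
        \<exists>p\<in>{m..<m + int N}. \<forall>n. cmod (a (n + p) - a n) \<le> \<epsilon>}"

definition AP_Z_inner :: "(int \<Rightarrow> complex) \<Rightarrow> (int \<Rightarrow> complex) \<Rightarrow> complex" where
  "AP_Z_inner a b =
     lim (\<lambda>p::nat. of_real (1 / (2 * real p)) * (\<Sum>n = - int p..int p. a n * cnj (b n)))"

definition AP_Z_norm :: "(int \<Rightarrow> complex) \<Rightarrow> real" where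
  "AP_Z_norm a = sqrt (cmod (AP_Z_inner a a))"

definition AP_R_topology :: "(real \<Rightarrow> complex) topology" where
  "AP_R_topology = Metric_space.mtopology AP_R (\<lambda>f g. AP_R_norm (\<lambda>t. f t - g t))"

definition AP_Z_topology :: "(int \<Rightarrow> complex) topology" where
  "AP_Z_topology = Metric_space.mtopology AP_Z (\<lambda>a b. AP_Z_norm (\<lambda>n. a n - b n))"

definition L1 :: "(real \<Rightarrow> complex) set" where
  "L1 = {\<psi>. integrable lebesgue \<psi>}"

definition pairing :: "(real \<Rightarrow> complex) \<Rightarrow> (real \<Rightarrow> complex) \<Rightarrow> complex" where
  "pairing f g = (LINT t|lebesgue. f t * cnj (g t))"

definition translate :: "real \<Rightarrow> (real \<Rightarrow> complex) \<Rightarrow> real \<Rightarrow> complex" where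
  "translate x \<psi> = (\<lambda>t. \<psi> (t - x))"

definition fourier :: "(real \<Rightarrow> complex) \<Rightarrow> real \<Rightarrow> complex" where
  "fourier \<psi> \<omega> = (LINT t|lebesgue. \<psi> t * exp (- (\<i> * of_real \<omega> * of_real t)))"

definition Linf :: "(real \<Rightarrow> complex) set" where
  "Linf = {\<psi>. \<psi> \<in> borel_measurable lebesgue \<and> esssup lebesgue (\<lambda>x. ennreal (cmod (\<psi> x))) < \<infinity>}"

definition wiener_norm :: "(real \<Rightarrow> complex) \<Rightarrow> ennreal" where
  "wiener_norm \<psi> =
     (\<Sum>\<^sub>\<infinity>k::int. esssup (lebesgue_on {0..1}) (\<lambda>x. ennreal (cmod (\<psi> (x - of_int k)))))"

definition Wiener :: "(real \<Rightarrow> complex) set" where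
  "Wiener = {\<psi> \<in> Linf. wiener_norm \<psi> < \<infinity>}"

text \<open>Functions are representatives of almost-everywhere classes, hence the almost-everywhere
  equality.\<close>

definition Wiener_hat :: "(real \<Rightarrow> complex) set" where
  "Wiener_hat = {\<psi>. \<exists>\<phi>\<in>Wiener. AE x in lebesgue. \<psi> x = fourier \<phi> x}"

definition sampling_map :: "real \<Rightarrow> (real \<Rightarrow> complex) \<Rightarrow> (real \<Rightarrow> complex) \<Rightarrow> int \<Rightarrow> complex" where
  "sampling_map \<alpha> \<psi> f = (\<lambda>k. pairing f (translate (of_int k * \<alpha>) \<psi>))"

end

theory Submission
  imports Defs "HOL-Real_Asymp.Real_Asymp" "HOL-Library.Real_Mod" "HOL-Probability.Characteristic_Functions"
begin

text \<open>The map \<open>S\<close> is linear, so its continuity is the inequality \<open>\<parallel>S f\<parallel>\<^sup>2 \<le> C \<parallel>f\<parallel>\<^sup>2\<close>.  It acts on exponentials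
  by \<open>S (cis (\<omega> t)) = cnj (fourier \<psi> \<omega>) cis (\<omega> \<alpha> k)\<close>.  Exponentials are orthonormal for the mean, and two
  of them have the same samples up to a factor exactly when their frequencies differ by a multiple of
  \<open>2 \<pi> / \<alpha>\<close>.  So on each class \<open>\<omega> + (2 \<pi> / \<alpha>) \<int>\<close> the map is the linear functional with coefficients
  \<open>cnj (fourier \<psi> (\<omega> + 2 \<pi> k / \<alpha>))\<close>, and the operator norm squared is the supremum over the classes of the
  sums of squares of these coefficients.

  The lower bound tests \<open>S\<close> on one class, with the coefficients of the functional itself
  (\<open>bessel_bound_if_bounded\<close>).

  The upper bound has to pass from trigonometric polynomials to all of \<open>AP_R\<close>.  This is done by
  periodisation on long windows.  For trigonometric polynomials of period
  \<open>N \<alpha>\<close> the inequality is exact finite Fourier analysis on \<open>\<int> / N\<close> (\<open>sampling_trig_poly\<close>).  An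
  arbitrary bounded continuous \<open>f\<close>, cut off on the window \<open>{0..N \<alpha>}\<close>, is a uniform limit there of such
  polynomials, and because \<open>\<psi>\<close> is integrable the samples away from the ends of the window hardly notice
  the difference (\<open>sampling_window\<close>).  Letting the window grow gives the inequality for the means
  (\<open>AP_Z_norm_sampling_le\<close>).

  That both spaces are metric spaces, and that \<open>S\<close> maps one into the other, rests on Bohr's lemma on
  common almost periods; it is derived from a pigeonhole statement about relatively dense sets of
  reals (\<open>relatively_dense_common_differences\<close>) that covers functions, sequences and samples alike.

  For \<open>\<psi>\<close> in the Wiener space, the lower-bound test function paired with \<open>\<psi>\<close> is estimated interval by
  interval (\<open>bessel_bound_Wiener\<close>).  If \<open>\<psi>\<close> is the Fourier transform of such a \<open>\<phi>\<close>, a Gaussian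
  regularisation of Fourier inversion bounds \<open>fourier \<psi> \<omega>\<close> by \<open>2 \<pi>\<close> times the essential supremum of
  \<open>\<bar>\<phi>\<bar>\<close> near \<open>-\<omega>\<close> (\<open>fourier_transform_bound\<close>), and the local suprema of \<open>\<phi>\<close> are summable.\<close>

section \<open>Relatively dense sets and almost periods\<close>

definition relatively_dense :: "real set \<Rightarrow> bool" where
  "relatively_dense P \<longleftrightarrow> (\<exists>L>0. \<forall>a. \<exists>\<tau>\<in>P. a < \<tau> \<and> \<tau> < a + L)"

lemma relatively_dense_mono: "relatively_dense P \<Longrightarrow> P \<subseteq> Q \<Longrightarrow> relatively_dense Q"
  unfolding relatively_dense_def by (meson subsetD)

lemma relatively_dense_gaps:
  assumes "relatively_dense P"
  obtains L where "L > 0" "\<And>a l. l \<ge> L \<Longrightarrow> \<exists>\<tau>\<in>P. a < \<tau> \<and> \<tau> < a + l"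
proof -
  obtain L where L: "L > 0" "\<And>a. \<exists>\<tau>\<in>P. a < \<tau> \<and> \<tau> < a + L"
    using assms unfolding relatively_dense_def by blast
  show thesis
  proof (rule that[OF L(1)])
    fix a l :: real assume "l \<ge> L"
    then show "\<exists>\<tau>\<in>P. a < \<tau> \<and> \<tau> < a + l" using L(2)[of a] by force
  qed
qed

text \<open>Pigeonhole: choosing one point of \<open>P\<close> and one of \<open>Q\<close> in each cell of a grid, the offset
  between the two takes finitely many values up to \<open>\<delta>\<close>.  Subtracting a fixed representative of each
  value moves every pair by a bounded amount and makes the two displacements agree up to \<open>\<delta>\<close>.\<close>

lemma relatively_dense_common_differences:
  assumes P: "relatively_dense P" and Q: "relatively_dense Q" and \<delta>: "\<delta> > 0"
  shows "relatively_dense {p - p' |p p'. p \<in> P \<and> p' \<in> P \<and>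
           (\<exists>q\<in>Q. \<exists>q'\<in>Q. \<bar>(p - p') - (q - q')\<bar> < \<delta>)}" (is "relatively_dense ?D")
proof -
  obtain L1 where L1: "L1 > 0" "\<And>a l. l \<ge> L1 \<Longrightarrow> \<exists>\<tau>\<in>P. a < \<tau> \<and> \<tau> < a + l"
    using relatively_dense_gaps[OF P] by blast
  obtain L2 where L2: "L2 > 0" "\<And>a l. l \<ge> L2 \<Longrightarrow> \<exists>\<tau>\<in>Q. a < \<tau> \<and> \<tau> < a + l"
    using relatively_dense_gaps[OF Q] by blast
  define L where "L = max L1 L2"
  have L: "L > 0" using L1 by (simp add: L_def)
  have "\<forall>n::int. \<exists>\<tau>. \<tau> \<in> P \<and> n * L < \<tau> \<and> \<tau> < n * L + L"
    using L1(2)[of L] by (fastforce simp: L_def)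
  then obtain p where p: "\<And>n::int. p n \<in> P" "\<And>n. n * L < p n" "\<And>n. p n < n * L + L"
    by metis
  have "\<forall>n::int. \<exists>\<tau>. \<tau> \<in> Q \<and> n * L < \<tau> \<and> \<tau> < n * L + L"
    using L2(2)[of L] by (fastforce simp: L_def)
  then obtain q where q: "\<And>n::int. q n \<in> Q" "\<And>n. n * L < q n" "\<And>n. q n < n * L + L"
    by metis
  define key where "key n = \<lfloor>(p n - q n) / \<delta>\<rfloor>" for n
  have fin: "finite (range key)"
  proof (rule finite_subset)
    show "range key \<subseteq> {\<lfloor>-L / \<delta>\<rfloor>..\<lfloor>L / \<delta>\<rfloor>}"
    proof clarify
      fix n
      have "-L \<le> p n - q n" "p n - q n \<le> L" using p(2,3)[of n] q(2,3)[of n] by linarith+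
      then have "-L / \<delta> \<le> (p n - q n) / \<delta>" "(p n - q n) / \<delta> \<le> L / \<delta>"
        using \<delta> by (intro divide_right_mono; simp)+
      then show "key n \<in> {\<lfloor>-L / \<delta>\<rfloor>..\<lfloor>L / \<delta>\<rfloor>}"
        unfolding key_def by (auto intro: floor_mono)
    qed
  qed simp
  define rep where "rep v = (SOME n. key n = v)" for v
  have rep: "key (rep (key n)) = key n" for n
    unfolding rep_def by (rule someI[of _ n]) simp
  obtain m :: int where m: "\<And>n. \<bar>rep (key n)\<bar> \<le> m"
  proof
    fix n
    show "\<bar>rep (key n)\<bar> \<le> Max ((\<lambda>v. \<bar>rep v\<bar>) ` range key)"
      using fin by (intro Max_ge) auto
  qed
  have m0: "m \<ge> 0" using m[of 0] by linarith
  have D: "p n - p (rep (key n)) \<in> ?D" for n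
  proof -
    let ?r = "rep (key n)"
    have "\<bar>(p n - q n) / \<delta> - (p ?r - q ?r) / \<delta>\<bar> < 1"
      using rep[of n] unfolding key_def by linarith
    then have "\<bar>(p n - q n) - (p ?r - q ?r)\<bar> / \<delta> < 1"
      using \<delta> by (simp add: diff_divide_distrib[symmetric] abs_divide)
    then have "\<bar>(p n - p ?r) - (q n - q ?r)\<bar> < \<delta>"
      using \<delta> by (simp add: field_simps)
    then show ?thesis using p(1) q(1) by blast
  qed
  show ?thesis
    unfolding relatively_dense_def
  proof (intro exI[of _ "(2 * m + 3) * L"] conjI allI)
    show "real_of_int (2 * m + 3) * L > 0" using L m0 by simp
    fix a
    define n where "n = \<lceil>a / L\<rceil> + m + 1"
    let ?r = "rep (key n)"
    have n1: "a / L \<le> real_of_int n - m - 1" "real_of_int n - m - 1 < a / L + 1"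
      unfolding n_def by linarith+
    then have n2: "a \<le> real_of_int n * L - m * L - L" "real_of_int n * L - m * L - L < a + L"
      using L by (simp_all add: field_simps)
    have r: "real_of_int ?r * L \<le> m * L" "- real_of_int m * L \<le> ?r * L"
      using m[of n] L by (intro mult_right_mono; linarith)+
    have "a < p n - p ?r" using n2(1) r(1) p(2)[of n] p(3)[of ?r] by linarith
    moreover have "p n - p ?r < a + 3 * L + 2 * (m * L)"
      using n2(2) r(2) p(3)[of n] p(2)[of ?r] by linarith
    ultimately show "\<exists>\<tau>\<in>?D. a < \<tau> \<and> \<tau> < a + real_of_int (2 * m + 3) * L"
      by (intro bexI[OF _ D[of n]]) (simp add: algebra_simps)
  qed
qed

lemma relatively_dense_multiples:
  assumes "\<alpha> > 0"
  shows "relatively_dense (range (\<lambda>k::int. of_int k * \<alpha>))"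
  unfolding relatively_dense_def
proof (intro exI[of _ "2 * \<alpha>"] conjI allI)
  fix a
  have "a / \<alpha> < of_int (\<lfloor>a / \<alpha>\<rfloor> + 1)" "of_int (\<lfloor>a / \<alpha>\<rfloor> + 1) < a / \<alpha> + 2" by linarith+
  then show "\<exists>\<tau>\<in>range (\<lambda>k::int. of_int k * \<alpha>). a < \<tau> \<and> \<tau> < a + 2 * \<alpha>"
    using assms by (intro bexI[of _ "of_int (\<lfloor>a / \<alpha>\<rfloor> + 1) * \<alpha>"] rangeI) (auto simp: field_simps)
qed (use assms in simp)

definition almost_periods :: "(real \<Rightarrow> 'a::real_normed_vector) \<Rightarrow> real \<Rightarrow> real set" where
  "almost_periods f \<epsilon> = {\<tau>. \<forall>t. norm (f (t + \<tau>) - f t) \<le> \<epsilon>}"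

text \<open>Bohr's condition without continuity, so that it also covers the step functions by which
  sequences are turned into functions on the line.\<close>

definition bohr :: "(real \<Rightarrow> 'a::real_normed_vector) \<Rightarrow> bool" where
  "bohr f \<longleftrightarrow> (\<forall>\<epsilon>>0. relatively_dense (almost_periods f \<epsilon>))"

lemma AP_R_iff_bohr: "f \<in> AP_R \<longleftrightarrow> continuous_on UNIV f \<and> bohr f"
proof -
  have "(\<exists>L>0. \<forall>a b. b - a > L \<longrightarrow> (\<exists>\<tau>\<in>{a<..<b}. \<forall>t. cmod (f (t + \<tau>) - f t) \<le> \<epsilon>))
     \<longleftrightarrow> relatively_dense (almost_periods f \<epsilon>)" (is "?l \<longleftrightarrow> ?r") for \<epsilon>
  proof
    assume ?l
    then obtain L where L: "L > 0" "\<And>a b. b - a > L \<Longrightarrow> \<exists>\<tau>\<in>{a<..<b}. \<forall>t. cmod (f (t + \<tau>) - f t) \<le> \<epsilon>"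
      by blast
    show ?r unfolding relatively_dense_def
    proof (intro exI[of _ "2 * L"] conjI allI)
      fix a
      show "\<exists>\<tau>\<in>almost_periods f \<epsilon>. a < \<tau> \<and> \<tau> < a + 2 * L"
        using L(1) L(2)[where a = a and b = "a + 2 * L"] by (auto simp: almost_periods_def)
    qed (use L in simp)
  next
    assume ?r
    then obtain L where L: "L > 0" "\<And>a. \<exists>\<tau>\<in>almost_periods f \<epsilon>. a < \<tau> \<and> \<tau> < a + L"
      unfolding relatively_dense_def by blast
    show ?l
    proof (intro exI[of _ L] conjI allI impI L(1))
      fix a b :: real assume "b - a > L"
      then show "\<exists>\<tau>\<in>{a<..<b}. \<forall>t. cmod (f (t + \<tau>) - f t) \<le> \<epsilon>"
        using L(2)[of a] by (force simp: almost_periods_def)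
    qed
  qed
  then show ?thesis by (simp add: AP_R_def bohr_def)
qed

lemma almost_periods_diff:
  assumes "p \<in> almost_periods f \<epsilon>" "q \<in> almost_periods f \<epsilon>'"
  shows "p - q \<in> almost_periods f (\<epsilon> + \<epsilon>')"
proof -
  have "norm (f (t + (p - q)) - f t) \<le> \<epsilon> + \<epsilon>'" for t
  proof -
    have "norm (f ((t - q) + p) - f (t - q)) \<le> \<epsilon>"
      using assms(1) by (simp only: almost_periods_def mem_Collect_eq)
    moreover have "norm (f ((t - q) + q) - f (t - q)) \<le> \<epsilon>'"
      using assms(2) by (simp only: almost_periods_def mem_Collect_eq)
    ultimately show ?thesis
      using norm_triangle_ineq4[of "f (t - q + p) - f (t - q)" "f (t - q + q) - f (t - q)"]
      by (simp add: algebra_simps)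
  qed
  then show ?thesis by (simp add: almost_periods_def)
qed

text \<open>Some almost period carries any given point into one fixed compact interval, so boundedness there
  spreads to the whole line.  The same reason gives uniform continuity below.\<close>

lemma bohr_bounded:
  assumes f: "bohr f" and loc: "\<And>a b. bounded (f ` {a..b})"
  shows "bounded (range f)"
proof -
  have "relatively_dense (almost_periods f 1)" using f by (simp add: bohr_def)
  then obtain L where L: "L > 0" "\<And>a. \<exists>\<tau>\<in>almost_periods f 1. a < \<tau> \<and> \<tau> < a + L"
    unfolding relatively_dense_def by blast
  obtain B where B: "\<And>t. t \<in> {0..L} \<Longrightarrow> norm (f t) \<le> B"
    using loc[of 0 L] unfolding bounded_iff by blast
  show ?thesis unfolding bounded_iff
  proof (intro exI[of _ "B + 1"] ballI, elim rangeE)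
    fix y t assume y: "y = f t"
    obtain \<tau> where \<tau>: "\<tau> \<in> almost_periods f 1" "-t < \<tau>" "\<tau> < -t + L" using L(2) by blast
    then have "norm (f (t + \<tau>)) \<le> B" by (intro B) auto
    moreover have "norm (f (t + \<tau>) - f t) \<le> 1" using \<tau>(1) by (simp add: almost_periods_def)
    ultimately show "norm y \<le> B + 1"
      unfolding y using norm_triangle_ineq3[of "f (t + \<tau>)" "f t"] by linarith
  qed
qed

lemma AP_R_bounded: "f \<in> AP_R \<Longrightarrow> bounded (range f)"
  unfolding AP_R_iff_bohr
  by (intro bohr_bounded compact_imp_bounded compact_continuous_image)
     (auto intro: continuous_on_subset)

lemma bohr_continuous_imp_uniformly_continuous:
  fixes f :: "real \<Rightarrow> 'a::real_normed_vector"
  assumes f: "bohr f" and cont: "continuous_on UNIV f" and \<epsilon>: "\<epsilon> > 0"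
  obtains \<delta> where "\<delta> > 0" "\<And>s t. \<bar>s - t\<bar> < \<delta> \<Longrightarrow> norm (f s - f t) < \<epsilon>"
proof -
  have "relatively_dense (almost_periods f (\<epsilon> / 3))" using f \<epsilon> by (simp add: bohr_def)
  then obtain L where L: "L > 0" "\<And>a. \<exists>\<tau>\<in>almost_periods f (\<epsilon> / 3). a < \<tau> \<and> \<tau> < a + L"
    unfolding relatively_dense_def by blast
  have "uniformly_continuous_on {-1..L+1} f"
    using cont by (intro compact_uniformly_continuous) (auto intro: continuous_on_subset)
  then obtain d where d: "d > 0" "\<And>s t. s \<in> {-1..L+1} \<Longrightarrow> t \<in> {-1..L+1} \<Longrightarrow> \<bar>s - t\<bar> < d \<Longrightarrow>
      norm (f s - f t) < \<epsilon> / 3"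
    unfolding uniformly_continuous_on_def dist_norm
    by (metis \<epsilon> real_norm_def zero_less_divide_iff zero_less_numeral)
  show thesis
  proof (rule that[of "min d 1"])
    fix s t :: real assume st: "\<bar>s - t\<bar> < min d 1"
    obtain \<tau> where \<tau>: "\<tau> \<in> almost_periods f (\<epsilon> / 3)" "-t < \<tau>" "\<tau> < -t + L" using L(2) by blast
    have "norm (f (s + \<tau>) - f (t + \<tau>)) < \<epsilon> / 3"
      using \<tau> st by (intro d(2)) auto
    moreover have "norm (f (s + \<tau>) - f s) \<le> \<epsilon> / 3" "norm (f (t + \<tau>) - f t) \<le> \<epsilon> / 3"
      using \<tau>(1) by (simp_all add: almost_periods_def)
    ultimately have "norm ((f (s + \<tau>) - f (t + \<tau>)) - (f (s + \<tau>) - f s) + (f (t + \<tau>) - f t)) < \<epsilon>"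
      using norm_triangle_ineq[of "(f (s + \<tau>) - f (t + \<tau>)) - (f (s + \<tau>) - f s)" "f (t + \<tau>) - f t"]
        norm_triangle_ineq4[of "f (s + \<tau>) - f (t + \<tau>)" "f (s + \<tau>) - f s"] by linarith
    then show "norm (f s - f t) < \<epsilon>" by simp
  qed (use d in simp)
qed

text \<open>Almost periods of \<open>f\<close> may be moved onto any relatively dense set of the form \<open>Q - Q\<close>:
  uniform continuity pays for the displacement.\<close>

lemma bohr_common_almost_periods:
  fixes f :: "real \<Rightarrow> 'a::real_normed_vector"
  assumes f: "bohr f" and cont: "continuous_on UNIV f" and Q: "relatively_dense Q"
    and \<epsilon>: "\<epsilon> > 0"
  shows "relatively_dense {q - q' |q q'. q \<in> Q \<and> q' \<in> Q \<and> q - q' \<in> almost_periods f \<epsilon>}"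
proof -
  obtain \<delta> where \<delta>: "\<delta> > 0" "\<And>s t. \<bar>s - t\<bar> < \<delta> \<Longrightarrow> norm (f s - f t) < \<epsilon> / 3"
    using bohr_continuous_imp_uniformly_continuous[OF f cont, of "\<epsilon> / 3"] \<epsilon> by auto
  have P: "relatively_dense (almost_periods f (\<epsilon> / 3))" using f \<epsilon> by (simp add: bohr_def)
  show ?thesis
  proof (rule relatively_dense_mono[OF relatively_dense_common_differences[OF Q P \<delta>(1)]], clarify)
    fix q q' p p'
    assume *: "q \<in> Q" "q' \<in> Q" "p \<in> almost_periods f (\<epsilon> / 3)" "p' \<in> almost_periods f (\<epsilon> / 3)"
      "\<bar>q - q' - (p - p')\<bar> < \<delta>"
    have "norm (f (t + (q - q')) - f t) \<le> \<epsilon>" for t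
    proof -
      have "norm (f (t + (p - p')) - f t) \<le> \<epsilon> / 3 + \<epsilon> / 3"
        using almost_periods_diff[OF *(3,4)] by (simp add: almost_periods_def)
      moreover have "norm (f (t + (q - q')) - f (t + (p - p'))) < \<epsilon> / 3"
        using *(5) by (intro \<delta>(2)) simp
      ultimately show ?thesis
        using norm_triangle_ineq[of "f (t + (q - q')) - f (t + (p - p'))" "f (t + (p - p')) - f t"]
        by simp
    qed
    then show "\<exists>qa q'a. q - q' = qa - q'a \<and> qa \<in> Q \<and> q'a \<in> Q \<and> qa - q'a \<in> almost_periods f \<epsilon>"
      using *(1,2) unfolding almost_periods_def by blast
  qed
qed

text \<open>A common almost period of both summands is an almost period of the sum.\<close>

lemma AP_R_add:
  assumes "f \<in> AP_R" "g \<in> AP_R"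
  shows "(\<lambda>t. f t + g t) \<in> AP_R"
  unfolding AP_R_iff_bohr bohr_def
proof (intro conjI allI impI)
  show "continuous_on UNIV (\<lambda>t. f t + g t)"
    using assms by (auto simp: AP_R_iff_bohr intro: continuous_intros)
  fix \<epsilon> :: real assume \<epsilon>: "\<epsilon> > 0"
  have Q: "relatively_dense (almost_periods g (\<epsilon> / 4))" using assms \<epsilon> by (simp add: AP_R_iff_bohr bohr_def)
  have f: "bohr f" "continuous_on UNIV f" using assms by (simp_all add: AP_R_iff_bohr)
  have \<epsilon>2: "\<epsilon> / 2 > 0" using \<epsilon> by simp
  show "relatively_dense (almost_periods (\<lambda>t. f t + g t) \<epsilon>)"
  proof (rule relatively_dense_mono[OF bohr_common_almost_periods[OF f Q \<epsilon>2]], clarify)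
    fix q q' assume *: "q \<in> almost_periods g (\<epsilon> / 4)" "q' \<in> almost_periods g (\<epsilon> / 4)"
      "q - q' \<in> almost_periods f (\<epsilon> / 2)"
    have "norm (f (t + (q - q')) + g (t + (q - q')) - (f t + g t)) \<le> \<epsilon>" for t
    proof -
      have "norm (f (t + (q - q')) - f t) \<le> \<epsilon> / 2" using *(3) by (simp add: almost_periods_def)
      moreover have "norm (g (t + (q - q')) - g t) \<le> \<epsilon> / 2"
        using almost_periods_diff[OF *(1,2)] by (simp add: almost_periods_def)
      ultimately show ?thesis
        using norm_triangle_ineq[of "f (t + (q - q')) - f t" "g (t + (q - q')) - g t"]
        by (simp add: algebra_simps)
    qed
    then show "q - q' \<in> almost_periods (\<lambda>t. f t + g t) \<epsilon>" by (simp add: almost_periods_def)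
  qed
qed

lemma AP_R_cmult:
  assumes "f \<in> AP_R"
  shows "(\<lambda>t. c * f t) \<in> AP_R"
  unfolding AP_R_iff_bohr bohr_def
proof (intro conjI allI impI)
  show "continuous_on UNIV (\<lambda>t. c * f t)"
    using assms by (auto simp: AP_R_iff_bohr intro: continuous_intros)
  fix \<epsilon> :: real assume \<epsilon>: "\<epsilon> > 0"
  have c: "cmod c + 1 > 0" by (simp add: add_nonneg_pos)
  show "relatively_dense (almost_periods (\<lambda>t. c * f t) \<epsilon>)"
  proof (rule relatively_dense_mono)
    show "relatively_dense (almost_periods f (\<epsilon> / (cmod c + 1)))"
      using assms \<epsilon> c unfolding AP_R_iff_bohr bohr_def by (meson divide_pos_pos)
    show "almost_periods f (\<epsilon> / (cmod c + 1)) \<subseteq> almost_periods (\<lambda>t. c * f t) \<epsilon>"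
    proof
      fix \<tau> assume \<tau>: "\<tau> \<in> almost_periods f (\<epsilon> / (cmod c + 1))"
      have "cmod (c * f (t + \<tau>) - c * f t) \<le> \<epsilon>" for t
      proof -
        have "cmod (c * f (t + \<tau>) - c * f t) = cmod c * cmod (f (t + \<tau>) - f t)"
          by (simp add: norm_mult[symmetric] algebra_simps)
        also have "\<dots> \<le> (cmod c + 1) * (\<epsilon> / (cmod c + 1))"
          using \<tau> c by (intro mult_mono) (auto simp: almost_periods_def)
        finally show ?thesis using c by simp
      qed
      then show "\<tau> \<in> almost_periods (\<lambda>t. c * f t) \<epsilon>" by (simp add: almost_periods_def)
    qed
  qed
qed

lemma AP_R_diff: "f \<in> AP_R \<Longrightarrow> g \<in> AP_R \<Longrightarrow> (\<lambda>t. f t - g t) \<in> AP_R"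
  using AP_R_add[OF _ AP_R_cmult[of g "-1"], of f] by simp

lemma AP_R_const: "(\<lambda>t. c) \<in> AP_R"
proof -
  have "relatively_dense (range (\<lambda>k::int. of_int k * 1))" by (rule relatively_dense_multiples) simp
  then show ?thesis
    unfolding AP_R_iff_bohr bohr_def by (auto simp: almost_periods_def elim: relatively_dense_mono)
qed

lemma AP_R_sum: "finite I \<Longrightarrow> (\<And>i. i \<in> I \<Longrightarrow> f i \<in> AP_R) \<Longrightarrow> (\<lambda>t. \<Sum>i\<in>I. f i t) \<in> AP_R"
  by (induction I rule: finite_induct) (auto simp: AP_R_const intro: AP_R_add)

lemma AP_R_cis: "(\<lambda>t. cis (\<omega> * t)) \<in> AP_R"
  unfolding AP_R_iff_bohr bohr_def
proof (intro conjI allI impI)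
  show "continuous_on UNIV (\<lambda>t. cis (\<omega> * t))" by (intro continuous_intros)
  fix \<epsilon> :: real assume \<epsilon>: "\<epsilon> > 0"
  show "relatively_dense (almost_periods (\<lambda>t. cis (\<omega> * t)) \<epsilon>)"
  proof (cases "\<omega> = 0")
    case True
    have "relatively_dense (range (\<lambda>k::int. of_int k * 1))" by (rule relatively_dense_multiples) simp
    then show ?thesis by (rule relatively_dense_mono) (use True \<epsilon> in \<open>auto simp: almost_periods_def\<close>)
  next
    case False
    have "relatively_dense (range (\<lambda>k::int. of_int k * (2 * pi / \<bar>\<omega>\<bar>)))"
      using False by (intro relatively_dense_multiples) simp
    then show ?thesis
    proof (rule relatively_dense_mono, clarify)
      fix k :: int
      have "\<omega> * (of_int k * (2 * pi / \<bar>\<omega>\<bar>)) = 2 * pi * of_int (if \<omega> > 0 then k else -k)"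
        using False by (auto simp: field_simps)
      then have "cis (\<omega> * (t + of_int k * (2 * pi / \<bar>\<omega>\<bar>))) = cis (\<omega> * t)" for t
        by (simp only: distrib_left cis_mult[symmetric])
           (simp del: times_divide_eq_right of_int_minus)
      then show "of_int k * (2 * pi / \<bar>\<omega>\<bar>) \<in> almost_periods (\<lambda>t. cis (\<omega> * t)) \<epsilon>"
        using \<epsilon> by (simp add: almost_periods_def)
    qed
  qed
qed

lemma AP_Z_iff_relatively_dense:
  "a \<in> AP_Z \<longleftrightarrow> (\<forall>\<epsilon>>0. relatively_dense {real_of_int p |p. \<forall>n. cmod (a (n + p) - a n) \<le> \<epsilon>})"
proof -
  have "(\<exists>N::nat. \<forall>m::int. \<exists>p\<in>{m..<m + int N}. \<forall>n. cmod (a (n + p) - a n) \<le> \<epsilon>)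
     \<longleftrightarrow> relatively_dense {real_of_int p |p. \<forall>n. cmod (a (n + p) - a n) \<le> \<epsilon>}" (is "?l \<longleftrightarrow> ?r") for \<epsilon>
  proof
    assume ?l
    then obtain N :: nat where N: "\<And>m::int. \<exists>p\<in>{m..<m + int N}. \<forall>n. cmod (a (n + p) - a n) \<le> \<epsilon>"
      by blast
    show ?r unfolding relatively_dense_def
    proof (intro exI[of _ "real N + 1"] conjI allI)
      fix x :: real
      obtain p where p: "p \<in> {\<lfloor>x\<rfloor> + 1..<\<lfloor>x\<rfloor> + 1 + int N}" "\<forall>n. cmod (a (n + p) - a n) \<le> \<epsilon>"
        using N by blast
      then have "x < real_of_int p" "real_of_int p < x + (real N + 1)"
        by (auto; linarith)+
      with p show "\<exists>\<tau>\<in>{real_of_int p |p. \<forall>n. cmod (a (n + p) - a n) \<le> \<epsilon>}. x < \<tau> \<and> \<tau> < x + (real N + 1)"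
        by blast
    qed simp
  next
    assume ?r
    then obtain L where L: "L > 0"
      "\<And>x. \<exists>\<tau>\<in>{real_of_int p |p. \<forall>n. cmod (a (n + p) - a n) \<le> \<epsilon>}. x < \<tau> \<and> \<tau> < x + L"
      unfolding relatively_dense_def by blast
    show ?l
    proof (intro exI[of _ "nat \<lceil>L\<rceil>"] allI)
      fix m :: int
      obtain p where "\<forall>n. cmod (a (n + p) - a n) \<le> \<epsilon>" "real_of_int m - 1 < of_int p" "of_int p < real_of_int m - 1 + L"
        using L(2)[of "real_of_int m - 1"] by blast
      moreover from this have "p \<in> {m..<m + int (nat \<lceil>L\<rceil>)}" using L(1) by (simp; linarith)
      ultimately show "\<exists>p\<in>{m..<m + int (nat \<lceil>L\<rceil>)}. \<forall>n. cmod (a (n + p) - a n) \<le> \<epsilon>" by blast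
    qed
  qed
  then show ?thesis by (simp add: AP_Z_def)
qed

text \<open>For integers, agreement up to an error below \<open>1\<close> is equality.\<close>

lemma AP_Z_diff:
  assumes "a \<in> AP_Z" "b \<in> AP_Z"
  shows "(\<lambda>n. a n - b n) \<in> AP_Z"
  unfolding AP_Z_iff_relatively_dense
proof (intro allI impI)
  fix \<epsilon> :: real assume "\<epsilon> > 0"
  define P where "P c = {real_of_int p |p. \<forall>n. cmod (c (n + p) - c n) \<le> \<epsilon> / 4}" for c
  have diff: "cmod (c (n + (p - q)) - c n) \<le> \<epsilon> / 2"
    if "of_int p \<in> P c" "of_int q \<in> P c" for c n p q
  proof -
    have "\<forall>n. cmod (c (n + p) - c n) \<le> \<epsilon> / 4" "\<forall>n. cmod (c (n + q) - c n) \<le> \<epsilon> / 4"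
      using that unfolding P_def by auto
    then have "cmod (c ((n - q) + p) - c (n - q)) \<le> \<epsilon> / 4" "cmod (c ((n - q) + q) - c (n - q)) \<le> \<epsilon> / 4"
      by blast+
    then show ?thesis
      using norm_triangle_ineq4[of "c (n - q + p) - c (n - q)" "c (n - q + q) - c (n - q)"]
      by (simp add: algebra_simps)
  qed
  have "relatively_dense (P a)" "relatively_dense (P b)"
    using assms \<open>\<epsilon> > 0\<close> unfolding P_def AP_Z_iff_relatively_dense
    by (meson divide_pos_pos zero_less_numeral)+
  then have "relatively_dense {p - p' |p p'. p \<in> P a \<and> p' \<in> P a \<and>
           (\<exists>q\<in>P b. \<exists>q'\<in>P b. \<bar>(p - p') - (q - q')\<bar> < 1)}"
    by (rule relatively_dense_common_differences) simp
  then show "relatively_dense {real_of_int p |p. \<forall>n. cmod (a (n + p) - b (n + p) - (a n - b n)) \<le> \<epsilon>}"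
  proof (rule relatively_dense_mono, clarify)
    fix x x' y y' assume *: "x \<in> P a" "x' \<in> P a" "y \<in> P b" "y' \<in> P b" "\<bar>x - x' - (y - y')\<bar> < 1"
    then obtain p p' q q' where pq: "x = of_int p" "x' = of_int p'" "y = of_int q" "y' = of_int q'"
      unfolding P_def by blast
    have "p - p' = q - q'" using *(5) unfolding pq by linarith
    then have "cmod (a (n + (p - p')) - a n) \<le> \<epsilon> / 2" "cmod (b (n + (p - p')) - b n) \<le> \<epsilon> / 2" for n
      using diff[of p a p' n] diff[of q b q' n] * pq by simp_all
    then have "cmod (a (n + (p - p')) - b (n + (p - p')) - (a n - b n)) \<le> \<epsilon>" for n
      using norm_triangle_ineq4[of "a (n + (p - p')) - a n" "b (n + (p - p')) - b n"]
      by (simp add: algebra_simps) (smt (verit))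
    then show "\<exists>pa. x - x' = real_of_int pa \<and> (\<forall>n. cmod (a (n + pa) - b (n + pa) - (a n - b n)) \<le> \<epsilon>)"
      by (intro exI[of _ "p - p'"]) (simp add: pq)
  qed
qed

section \<open>Mean values\<close>

definition has_mean :: "(real \<Rightarrow> real) \<Rightarrow> real \<Rightarrow> bool" where
  "has_mean w m \<longleftrightarrow> ((\<lambda>T. 1 / (2 * T) * integral {-T..T} w) \<longlongrightarrow> m) at_top"

lemma integral_near_multiple:
  fixes w :: "real \<Rightarrow> real"
  assumes int: "\<And>a b. w integrable_on {a..b}" and T: "T \<ge> 0"
    and near: "\<And>a. \<bar>integral {a..a+T} w - I\<bar> \<le> e"
  shows "\<bar>integral {a..a + real n * T} w - real n * I\<bar> \<le> real n * e"
proof (induction n)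
  case (Suc n)
  have "integral {a..a + real (Suc n) * T} w
      = integral {a..a + real n * T} w + integral {a + real n * T..a + real n * T + T} w"
    using int T by (subst Henstock_Kurzweil_Integration.integral_combine) (auto simp: algebra_simps)
  then show ?case using Suc near[of "a + real n * T"] by (simp add: algebra_simps)
qed simp

lemma integral_abs_le:
  fixes w :: "real \<Rightarrow> real"
  assumes "\<And>a b. w integrable_on {a..b}" "\<And>t. \<bar>w t\<bar> \<le> B" "a \<le> b"
  shows "\<bar>integral {a..b} w\<bar> \<le> B * (b - a)"
proof -
  have "norm (integral {a..b} w) \<le> integral {a..b} (\<lambda>t. B)"
    using assms by (intro integral_norm_bound_integral) auto
  then show ?thesis using assms by (simp add: mult.commute)
qed

text \<open>An almost period \<open>\<tau>\<close> of \<open>w\<close> just beyond \<open>a\<close> carries \<open>{0..T}\<close> to \<open>{\<tau>..\<tau>+T}\<close>, which differs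
  from \<open>{a..a+T}\<close> only near the end points.\<close>

lemma bohr_integral_windows:
  fixes w :: "real \<Rightarrow> real"
  assumes w: "bohr w" and B: "\<And>t. \<bar>w t\<bar> \<le> B" and int: "\<And>a b. w integrable_on {a..b}"
    and \<epsilon>: "\<epsilon> > 0"
  obtains T where "T > 0" "\<And>a. \<bar>integral {a..a+T} w - integral {0..T} w\<bar> \<le> \<epsilon> * T"
proof -
  have B0: "B \<ge> 0" using B[of 0] by linarith
  have "relatively_dense (almost_periods w (\<epsilon> / 2))" using w \<epsilon> by (simp add: bohr_def)
  then obtain L where L: "L > 0" "\<And>a. \<exists>\<tau>\<in>almost_periods w (\<epsilon> / 2). a < \<tau> \<and> \<tau> < a + L"
    unfolding relatively_dense_def by blast
  define T where "T = max L (4 * B * L / \<epsilon>)"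
  have T: "T \<ge> L" "4 * B * L / \<epsilon> \<le> T" unfolding T_def by auto
  then have T2: "2 * B * L \<le> \<epsilon> / 2 * T" using \<epsilon> by (simp add: field_simps)
  show thesis
  proof (rule that[of T])
    show "T > 0" using L T by linarith
    fix a
    obtain \<tau> where \<tau>: "\<tau> \<in> almost_periods w (\<epsilon> / 2)" "a < \<tau>" "\<tau> < a + L" using L(2) by blast
    have "integral {a..\<tau>} w + integral {\<tau>..\<tau>+T} w = integral {a..\<tau>+T} w"
      using \<tau> L T by (intro Henstock_Kurzweil_Integration.integral_combine int) auto
    moreover have "integral {a..a+T} w + integral {a+T..\<tau>+T} w = integral {a..\<tau>+T} w"
      using \<tau> L T by (intro Henstock_Kurzweil_Integration.integral_combine int) auto
    moreover have "\<bar>integral {a..\<tau>} w\<bar> \<le> B * (\<tau> - a)"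
      using \<tau> by (intro integral_abs_le int B) simp
    moreover have "\<bar>integral {a+T..\<tau>+T} w\<bar> \<le> B * (\<tau> - a)"
      using integral_abs_le[OF int B, of "a + T" "\<tau> + T"] \<tau> by simp
    moreover have "B * (\<tau> - a) \<le> B * L" using \<tau> B0 by (intro mult_left_mono) auto
    ultimately have 1: "\<bar>integral {a..a+T} w - integral {\<tau>..\<tau>+T} w\<bar> \<le> 2 * B * L" by linarith
    have shift: "integral {\<tau>..\<tau>+T} w = integral {0..T} (\<lambda>t. w (t + \<tau>))"
      using integral_shift_real_ivl[of \<tau> \<tau> "\<tau> + T" w] by simp
    have int2: "(\<lambda>t. w (t + \<tau>)) integrable_on {0..T}"
      using integrable_shift_real_ivl[OF int[of \<tau> "\<tau> + T"], of \<tau>] by simp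
    have "\<bar>integral {0..T} (\<lambda>t. w (t + \<tau>) - w t)\<bar> \<le> integral {0..T} (\<lambda>t. \<epsilon> / 2)"
      unfolding real_norm_def[symmetric] using int int2 \<tau>(1)
      by (intro integral_norm_bound_integral integrable_diff) (auto simp: almost_periods_def)
    then have "\<bar>integral {\<tau>..\<tau>+T} w - integral {0..T} w\<bar> \<le> \<epsilon> / 2 * T"
      using L T int int2 by (simp add: shift integral_diff mult.commute)
    then show "\<bar>integral {a..a+T} w - integral {0..T} w\<bar> \<le> \<epsilon> * T" using 1 T2 by linarith
  qed
qed

lemma tendsto_if_eventually_near_constants:
  fixes A :: "real \<Rightarrow> real"
  assumes "\<And>e. e > 0 \<Longrightarrow> \<exists>c. \<forall>\<^sub>F x in at_top. \<bar>A x - c\<bar> \<le> e"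
  shows "\<exists>m. (A \<longlongrightarrow> m) at_top"
proof -
  have "Cauchy (\<lambda>n. A (real n))"
  proof (rule metric_CauchyI)
    fix e :: real assume "e > 0"
    then obtain c where "\<forall>\<^sub>F x in at_top. \<bar>A x - c\<bar> \<le> e / 3" using assms[of "e / 3"] by auto
    then have "\<forall>\<^sub>F n in sequentially. \<bar>A (real n) - c\<bar> \<le> e / 3"
      by (rule eventually_compose_filterlim) (rule filterlim_real_sequentially)
    then obtain N where N: "\<And>n. n \<ge> N \<Longrightarrow> \<bar>A (real n) - c\<bar> \<le> e / 3"
      unfolding eventually_sequentially by blast
    show "\<exists>M. \<forall>m\<ge>M. \<forall>n\<ge>M. dist (A (real m)) (A (real n)) < e"
    proof (intro exI[of _ N] allI impI)
      fix m n assume "m \<ge> N" "n \<ge> N"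
      then show "dist (A (real m)) (A (real n)) < e"
        using N[of m] N[of n] \<open>e > 0\<close> unfolding dist_real_def by linarith
    qed
  qed
  then obtain m where m: "(\<lambda>n. A (real n)) \<longlonglongrightarrow> m" by (metis Cauchy_convergent convergent_def)
  have "(A \<longlongrightarrow> m) at_top"
  proof (rule tendstoI)
    fix e :: real assume e: "e > 0"
    then obtain c where c: "\<forall>\<^sub>F x in at_top. \<bar>A x - c\<bar> \<le> e / 3" using assms[of "e / 3"] by auto
    then have "\<forall>\<^sub>F n in sequentially. \<bar>A (real n) - c\<bar> \<le> e / 3"
      by (rule eventually_compose_filterlim) (rule filterlim_real_sequentially)
    then have "\<bar>m - c\<bar> \<le> e / 3"
      by (rule tendsto_upperbound[OF tendsto_rabs[OF tendsto_diff[OF m tendsto_const]]]) simp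
    from c show "\<forall>\<^sub>F x in at_top. dist (A x) m < e"
    proof eventually_elim
      case (elim x)
      with \<open>\<bar>m - c\<bar> \<le> e / 3\<close> e show ?case unfolding dist_real_def by linarith
    qed
  qed
  then show ?thesis by blast
qed

text \<open>All windows of a suitable length \<open>T\<close> have nearly the same integral.  Cutting \<open>{-S..S}\<close> into such windows
  shows that the averages over \<open>{-S..S}\<close> are eventually close to the average over \<open>{0..T}\<close>.\<close>

theorem bohr_has_mean:
  fixes w :: "real \<Rightarrow> real"
  assumes w: "bohr w" and bdd: "bounded (range w)" and int: "\<And>a b. w integrable_on {a..b}"
  shows "\<exists>m. has_mean w m"
  unfolding has_mean_def
proof (rule tendsto_if_eventually_near_constants)
  fix e :: real assume e: "e > 0"
  obtain B where B: "\<And>t. \<bar>w t\<bar> \<le> B" using bdd unfolding bounded_iff by auto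
  obtain T where T: "T > 0" "\<And>a. \<bar>integral {a..a+T} w - integral {0..T} w\<bar> \<le> e / 2 * T"
    using bohr_integral_windows[OF w B int, of "e / 2"] e by auto
  define I where "I = integral {0..T} w"
  have I: "\<bar>I\<bar> \<le> B * T" unfolding I_def using integral_abs_le[OF int B, of 0 T] T(1) by simp
  have B0: "B \<ge> 0" using B[of 0] by linarith
  have "\<bar>1 / (2 * S) * integral {-S..S} w - I / T\<bar> \<le> e" if S: "S > 0" "S \<ge> 2 * B * T / e" for S
  proof -
    define n where "n = nat \<lfloor>2 * S / T\<rfloor>"
    have "real n = of_int \<lfloor>2 * S / T\<rfloor>" using S T(1) by (simp add: n_def)
    then have n0: "real n \<le> 2 * S / T" "2 * S / T < real n + 1" by linarith+
    then have n: "real n * T \<le> 2 * S" "2 * S < real n * T + T" using T(1) by (simp_all add: field_simps)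
    have "\<bar>integral {-S..-S + real n * T} w - real n * I\<bar> \<le> real n * (e / 2 * T)"
      using T by (intro integral_near_multiple int) (auto simp: I_def)
    also have "\<dots> \<le> S * e"
      using mult_right_mono[OF n(1), of "e / 2"] e by (simp add: field_simps)
    finally have 1: "\<bar>integral {-S..-S + real n * T} w - real n * I\<bar> \<le> S * e" .
    have 2: "integral {-S..-S + real n * T} w + integral {-S + real n * T..S} w = integral {-S..S} w"
      using n T by (intro Henstock_Kurzweil_Integration.integral_combine int) auto
    have "\<bar>integral {-S + real n * T..S} w\<bar> \<le> B * (S - (-S + real n * T))"
      using n by (intro integral_abs_le int B) auto
    also have "\<dots> \<le> B * T" using n B0 by (intro mult_left_mono) auto
    finally have 3: "\<bar>integral {-S + real n * T..S} w\<bar> \<le> B * T" .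
    have "\<bar>2 * S / T * I - real n * I\<bar> = \<bar>2 * S / T - real n\<bar> * \<bar>I\<bar>"
      by (simp add: abs_mult[symmetric] algebra_simps)
    also have "\<dots> \<le> 1 * \<bar>I\<bar>" using n0 by (intro mult_right_mono) auto
    finally have 4: "\<bar>2 * S / T * I - real n * I\<bar> \<le> B * T" using I by simp
    have "2 * (B * T) \<le> S * e" using S(2) e by (simp add: field_simps)
    then have "\<bar>integral {-S..S} w - 2 * S / T * I\<bar> \<le> S * e + S * e"
      using 1 2 3 4 by linarith
    also have "\<dots> = e * (2 * S)" by simp
    finally have "\<bar>integral {-S..S} w - 2 * S / T * I\<bar> \<le> e * (2 * S)" .
    then have "\<bar>integral {-S..S} w - 2 * S / T * I\<bar> / (2 * S) \<le> e"
      using S(1) by (simp add: pos_divide_le_eq)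
    moreover have "1 / (2 * S) * integral {-S..S} w - I / T = (integral {-S..S} w - 2 * S / T * I) / (2 * S)"
      using S(1) T(1) by (simp add: field_simps)
    ultimately show ?thesis using S(1) by (simp add: abs_divide del: divide_le_eq_numeral1)
  qed
  then show "\<exists>c. \<forall>\<^sub>F S in at_top. \<bar>1 / (2 * S) * integral {-S..S} w - c\<bar> \<le> e"
    by (intro exI[of _ "I / T"] eventually_mono[OF eventually_conj[OF
          eventually_gt_at_top[of 0] eventually_ge_at_top[of "2 * B * T / e"]]]) auto
qed

text \<open>Linearity and monotonicity of the mean in the combined form that the triangle inequality asks for.\<close>

lemma has_mean_le_combination:
  assumes "has_mean w m" "has_mean u x" "has_mean v y"
    and "\<And>a b. w integrable_on {a..b}" "\<And>a b. u integrable_on {a..b}" "\<And>a b. v integrable_on {a..b}"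
    and le: "\<And>t. w t \<le> p * u t + q * v t"
  shows "m \<le> p * x + q * y"
proof (rule tendsto_le)
  show "((\<lambda>T. 1 / (2 * T) * integral {-T..T} w) \<longlongrightarrow> m) at_top" using assms(1) by (simp add: has_mean_def)
  show "((\<lambda>T. p * (1 / (2 * T) * integral {-T..T} u) + q * (1 / (2 * T) * integral {-T..T} v))
      \<longlongrightarrow> p * x + q * y) at_top"
    using assms(2,3) unfolding has_mean_def by (intro tendsto_intros)
  show "\<forall>\<^sub>F T in at_top. 1 / (2 * T) * integral {-T..T} w
      \<le> p * (1 / (2 * T) * integral {-T..T} u) + q * (1 / (2 * T) * integral {-T..T} v)"
    using eventually_gt_at_top[of 0]
  proof eventually_elim
    case (elim T)
    have "integral {-T..T} w \<le> integral {-T..T} (\<lambda>t. p * u t + q * v t)"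
      using assms le by (intro integral_le) (auto intro!: integrable_add integrable_on_mult_right)
    also have "\<dots> = p * integral {-T..T} u + q * integral {-T..T} v"
      using assms by (subst integral_add) (auto intro: integrable_on_mult_right)
    finally have "1 / (2 * T) * integral {-T..T} w
        \<le> 1 / (2 * T) * (p * integral {-T..T} u + q * integral {-T..T} v)"
      using elim by (intro mult_left_mono) auto
    then show ?case by (simp add: algebra_simps)
  qed
qed simp

lemma has_mean_nonneg:
  assumes "has_mean w m" "\<And>t. w t \<ge> 0" "\<And>a b. w integrable_on {a..b}"
  shows "m \<ge> 0"
proof (rule tendsto_lowerbound)
  show "((\<lambda>T. 1 / (2 * T) * integral {-T..T} w) \<longlongrightarrow> m) at_top" using assms(1) by (simp add: has_mean_def)
  show "\<forall>\<^sub>F T in at_top. 0 \<le> 1 / (2 * T) * integral {-T..T} w"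
    using eventually_gt_at_top[of 0]
  proof eventually_elim
    case (elim T)
    have "integral {-T..T} w \<ge> 0" using assms(2,3) by (intro integral_nonneg) auto
    with elim show ?case by simp
  qed
qed simp

text \<open>A nonnegative \<open>w\<close> that is at least \<open>c\<close> on an interval is at least \<open>c / 2\<close> on a relatively
  dense family of translates of that interval.\<close>

lemma bohr_mean_pos:
  fixes w :: "real \<Rightarrow> real"
  assumes w: "bohr w" and int: "\<And>a b. w integrable_on {a..b}" and m: "has_mean w m"
    and nonneg: "\<And>t. w t \<ge> 0" and uv: "u < v" and c: "c > 0" "\<And>t. t \<in> {u..v} \<Longrightarrow> w t \<ge> c"
  shows "m > 0"
proof -
  have "relatively_dense (almost_periods w (c / 2))" using w c by (simp add: bohr_def)
  then obtain L where L: "L > 0" "\<And>a. \<exists>\<tau>\<in>almost_periods w (c / 2). a < \<tau> \<and> \<tau> < a + L"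
    unfolding relatively_dense_def by blast
  define K where "K = L + (v - u)"
  define \<kappa> where "\<kappa> = c / 2 * (v - u)"
  have K: "K > 0" and \<kappa>: "\<kappa> > 0" using L uv c by (simp_all add: K_def \<kappa>_def)
  have win: "integral {a..a+K} w \<ge> \<kappa>" for a
  proof -
    obtain \<tau> where \<tau>: "\<tau> \<in> almost_periods w (c / 2)" "a - u < \<tau>" "\<tau> < a - u + L" using L(2) by blast
    have "w t \<ge> c / 2" if "t \<in> {u+\<tau>..v+\<tau>}" for t
    proof -
      have "\<bar>w ((t - \<tau>) + \<tau>) - w (t - \<tau>)\<bar> \<le> c / 2"
        using \<tau>(1) unfolding almost_periods_def real_norm_def by blast
      then have "\<bar>w t - w (t - \<tau>)\<bar> \<le> c / 2" by simp
      moreover have "c \<le> w (t - \<tau>)" using that by (intro c(2)) auto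
      ultimately show ?thesis by linarith
    qed
    then have "integral {u+\<tau>..v+\<tau>} (\<lambda>t. c / 2) \<le> integral {u+\<tau>..v+\<tau>} w"
      using int by (intro integral_le) auto
    moreover have "integral {u+\<tau>..v+\<tau>} w \<le> integral {a..a+K} w"
      using \<tau> int nonneg by (intro integral_subset_le) (auto simp: K_def)
    ultimately show ?thesis using uv by (simp add: \<kappa>_def mult.commute)
  qed
  have blocks: "integral {a..a + real n * K} w \<ge> real n * \<kappa>" for a n
  proof (induction n)
    case (Suc n)
    have "integral {a..a + real (Suc n) * K} w
        = integral {a..a + real n * K} w + integral {a + real n * K..a + real n * K + K} w"
      using int K by (subst Henstock_Kurzweil_Integration.integral_combine) (auto simp: algebra_simps)
    then show ?case using Suc win[of "a + real n * K"] by (simp add: algebra_simps)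
  qed simp
  have lim: "(\<lambda>n. 1 / (2 * (real n * K)) * integral {-(real n * K)..real n * K} w) \<longlonglongrightarrow> m"
    using m unfolding has_mean_def
    by (rule filterlim_compose) (use K in \<open>real_asymp\<close>)
  have "\<kappa> / K \<le> m"
  proof (rule tendsto_lowerbound[OF lim])
    show "\<forall>\<^sub>F n in sequentially. \<kappa> / K \<le> 1 / (2 * (real n * K)) * integral {-(real n * K)..real n * K} w"
      using eventually_gt_at_top[of 0]
    proof eventually_elim
      case (elim n)
      have "2 * real n * \<kappa> \<le> integral {-(real n * K)..real n * K} w"
        using blocks[of "2 * n" "-(real n * K)"] by (simp add: mult.commute)
      then have "1 / (2 * (real n * K)) * (2 * real n * \<kappa>) \<le> 1 / (2 * (real n * K)) * integral {-(real n * K)..real n * K} w"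
        using elim K by (intro mult_left_mono) auto
      then show ?case using elim by simp
    qed
  qed simp
  then show ?thesis using \<kappa> K by (meson divide_pos_pos less_le_trans)
qed

subsection \<open>Quadratic means\<close>

text \<open>What an almost periodic function and the step function of an almost periodic sequence have in
  common; it is enough for quadratic means to exist.\<close>

definition bohr_regular :: "(real \<Rightarrow> complex) \<Rightarrow> bool" where
  "bohr_regular f \<longleftrightarrow> bohr f \<and> bounded (range f) \<and> f \<in> borel_measurable borel"

lemma AP_R_bohr_regular: "f \<in> AP_R \<Longrightarrow> bohr_regular f"
  using AP_R_bounded by (auto simp: bohr_regular_def AP_R_iff_bohr intro: borel_measurable_continuous_onI)

lemma set_integrable_bounded_measurable:
  fixes f :: "real \<Rightarrow> 'a::euclidean_space"
  assumes "bounded (range f)" "f \<in> borel_measurable borel"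
  shows "set_integrable lebesgue {a..b} f"
proof -
  obtain B where B: "\<And>t. norm (f t) \<le> B" using assms(1) unfolding bounded_iff by auto
  have "set_integrable lborel {a..b} f"
    unfolding set_integrable_def
  proof (rule Bochner_Integration.integrable_bound)
    have "integrable lborel (indicator {a..b} :: real \<Rightarrow> real)"
      by (intro integrable_real_indicator) (auto simp: emeasure_lborel_Icc_eq)
    then show "integrable lborel (\<lambda>t. indicator {a..b} t * B)" by simp
    show "(\<lambda>x. indicat_real {a..b} x *\<^sub>R f x) \<in> borel_measurable lborel" using assms(2) by measurable
    show "AE x in lborel. norm (indicat_real {a..b} x *\<^sub>R f x) \<le> norm (indicator {a..b} x * B)"
      using B by (intro AE_I2) (auto simp: indicator_def intro: order_trans[OF B])
  qed
  then show ?thesis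
    unfolding set_integrable_def by (subst integrable_completion) auto
qed

lemma bohr_regular_square:
  assumes "bohr_regular f"
  shows "bohr (\<lambda>t. (cmod (f t))\<^sup>2)" "bounded (range (\<lambda>t. (cmod (f t))\<^sup>2))"
    "set_integrable lebesgue {a..b} (\<lambda>t. (cmod (f t))\<^sup>2)" "(\<lambda>t. (cmod (f t))\<^sup>2) integrable_on {a..b}"
proof -
  obtain B0 where B0: "\<And>t. cmod (f t) \<le> B0" using assms unfolding bohr_regular_def bounded_iff by auto
  define B where "B = max B0 1"
  have B: "cmod (f t) \<le> B" "B > 0" for t using B0[of t] by (auto simp: B_def)
  show bdd: "bounded (range (\<lambda>t. (cmod (f t))\<^sup>2))"
    unfolding bounded_iff by (rule exI[of _ "B\<^sup>2"]) (use B in \<open>auto intro!: power_mono\<close>)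
  show *: "set_integrable lebesgue {a..b} (\<lambda>t. (cmod (f t))\<^sup>2)"
    using assms by (intro set_integrable_bounded_measurable bdd) (auto simp: bohr_regular_def)
  then show "(\<lambda>t. (cmod (f t))\<^sup>2) integrable_on {a..b}" by (rule set_lebesgue_integral_eq_integral)
  show "bohr (\<lambda>t. (cmod (f t))\<^sup>2)"
    unfolding bohr_def
  proof (intro allI impI)
    fix \<epsilon> :: real assume \<epsilon>: "\<epsilon> > 0"
    have "relatively_dense (almost_periods f (\<epsilon> / (2 * B)))"
      using assms \<epsilon> B by (simp add: bohr_regular_def bohr_def)
    then show "relatively_dense (almost_periods (\<lambda>t. (cmod (f t))\<^sup>2) \<epsilon>)"
    proof (rule relatively_dense_mono, intro subsetI)
      fix \<tau> assume \<tau>: "\<tau> \<in> almost_periods f (\<epsilon> / (2 * B))"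
      have "\<bar>(cmod (f (t + \<tau>)))\<^sup>2 - (cmod (f t))\<^sup>2\<bar> \<le> \<epsilon>" for t
      proof -
        have "\<bar>(cmod (f (t + \<tau>)))\<^sup>2 - (cmod (f t))\<^sup>2\<bar>
            = \<bar>cmod (f (t + \<tau>)) - cmod (f t)\<bar> * \<bar>cmod (f (t + \<tau>)) + cmod (f t)\<bar>"
          by (simp only: abs_mult[symmetric]) (simp add: power2_eq_square algebra_simps)
        also have "\<dots> \<le> \<epsilon> / (2 * B) * (2 * B)"
        proof (rule mult_mono)
          have "cmod (f (t + \<tau>) - f t) \<le> \<epsilon> / (2 * B)" using \<tau> by (simp add: almost_periods_def)
          then show "\<bar>cmod (f (t + \<tau>)) - cmod (f t)\<bar> \<le> \<epsilon> / (2 * B)"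
            using norm_triangle_ineq3[of "f (t + \<tau>)" "f t"] by linarith
          show "\<bar>cmod (f (t + \<tau>)) + cmod (f t)\<bar> \<le> 2 * B" using B(1)[of t] B(1)[of "t + \<tau>"] by simp
        qed (use \<epsilon> B in auto)
        finally show ?thesis using B by simp
      qed
      then show "\<tau> \<in> almost_periods (\<lambda>t. (cmod (f t))\<^sup>2) \<epsilon>" by (simp add: almost_periods_def)
    qed
  qed
qed

lemma AP_R_square_mean:
  assumes "f \<in> AP_R"
  shows "has_mean (\<lambda>t. (cmod (f t))\<^sup>2) ((AP_R_norm f)\<^sup>2)"
proof -
  note reg = bohr_regular_square[OF AP_R_bohr_regular[OF assms]]
  obtain m where m: "has_mean (\<lambda>t. (cmod (f t))\<^sup>2) m" using bohr_has_mean[OF reg(1,2,4)] by blast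
  have m0: "m \<ge> 0" using has_mean_nonneg[OF m _ reg(4)] by simp
  have eq: "of_real (1 / (2 * T)) * (LINT t:{-T..T}|lebesgue. f t * cnj (f t))
      = complex_of_real (1 / (2 * T) * integral {-T..T} (\<lambda>t. (cmod (f t))\<^sup>2))" for T
  proof -
    have "f t * cnj (f t) = complex_of_real ((cmod (f t))\<^sup>2)" for t
      using complex_norm_square[of "f t"] by (simp only: of_real_power)
    then have "(LINT t:{-T..T}|lebesgue. f t * cnj (f t)) = (LINT t:{-T..T}|lebesgue. complex_of_real ((cmod (f t))\<^sup>2))"
      by (simp only:)
    also have "\<dots> = of_real (LINT t:{-T..T}|lebesgue. (cmod (f t))\<^sup>2)"
      by (rule set_integral_complex_of_real)
    also have "(LINT t:{-T..T}|lebesgue. (cmod (f t))\<^sup>2) = integral {-T..T} (\<lambda>t. (cmod (f t))\<^sup>2)"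
      by (rule set_lebesgue_integral_eq_integral(2)[OF reg(3)])
    finally show ?thesis by (simp only: of_real_mult)
  qed
  have "((\<lambda>T. of_real (1 / (2 * T)) * (LINT t:{-T..T}|lebesgue. f t * cnj (f t))) \<longlongrightarrow> complex_of_real m) at_top"
    unfolding eq using m unfolding has_mean_def by (rule tendsto_of_real)
  then have "AP_R_inner f f = of_real m"
    unfolding AP_R_inner_def by (intro tendsto_Lim) simp_all
  then show ?thesis using m m0 by (simp add: AP_R_norm_def)
qed

text \<open>Quadratic means obey the triangle inequality because of the pointwise bound
  \<open>\<bar>f + g\<bar>\<^sup>2 \<le> (1 + s) \<bar>f\<bar>\<^sup>2 + (1 + 1 / s) \<bar>g\<bar>\<^sup>2\<close>; the optimal \<open>s\<close> is the quotient of the two norms.\<close>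

lemma norm_add_square_le:
  fixes a b :: "'a::real_normed_vector"
  assumes s: "s > 0"
  shows "(norm (a + b))\<^sup>2 \<le> (1 + s) * (norm a)\<^sup>2 + (1 + 1 / s) * (norm b)\<^sup>2"
proof -
  have "(norm (a + b))\<^sup>2 \<le> (norm a + norm b)\<^sup>2"
    by (intro power_mono norm_triangle_ineq) simp
  also have "\<dots> \<le> (1 + s) * (norm a)\<^sup>2 + (1 + 1 / s) * (norm b)\<^sup>2"
  proof -
    have "0 \<le> (s * norm a - norm b)\<^sup>2 / s" using s by simp
    also have "\<dots> = s * (norm a)\<^sup>2 - 2 * norm a * norm b + (norm b)\<^sup>2 / s"
      using s by (simp add: power2_diff power_mult_distrib add_divide_distrib diff_divide_distrib)
        (simp add: power2_eq_square)
    finally show ?thesis by (simp add: power2_eq_square algebra_simps)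
  qed
  finally show ?thesis .
qed

lemma le_add_if_weighted_squares:
  fixes x y z :: real
  assumes "x \<ge> 0" "y \<ge> 0" "\<And>s. s > 0 \<Longrightarrow> z\<^sup>2 \<le> (1 + s) * x\<^sup>2 + (1 + 1 / s) * y\<^sup>2"
  shows "z \<le> x + y"
proof (rule field_le_epsilon)
  fix e :: real assume e: "e > 0"
  \<comment> \<open>Enlarging \<open>x\<close> and \<open>y\<close> keeps the quotient defined when one of them vanishes.\<close>
  define x' where "x' = x + e / 2"
  define y' where "y' = y + e / 2"
  have p: "x' > 0" "y' > 0" "x\<^sup>2 \<le> x'\<^sup>2" "y\<^sup>2 \<le> y'\<^sup>2"
    using assms(1,2) e by (auto simp: x'_def y'_def intro!: power_mono)
  define s where "s = y' / x'"
  have s: "s > 0" "y' = s * x'" using p by (simp_all add: s_def)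
  have "z\<^sup>2 \<le> (1 + s) * x\<^sup>2 + (1 + 1 / s) * y\<^sup>2" by (rule assms(3)[OF s(1)])
  also have "\<dots> \<le> (1 + s) * x'\<^sup>2 + (1 + 1 / s) * y'\<^sup>2"
    using p s(1) by (intro add_mono mult_left_mono) auto
  also have "\<dots> = (x' + y')\<^sup>2"
    unfolding s(2) using s(1) by (simp add: power2_eq_square distrib_left distrib_right)
  finally have "z \<le> x' + y'" by (rule power2_le_imp_le) (use p in simp)
  then show "z \<le> x + y + e" by (simp add: x'_def y'_def)
qed

lemma has_mean_square_triangle:
  assumes "bohr_regular f" "bohr_regular g" "bohr_regular h" "\<And>t. h t = f t + g t"
    and "has_mean (\<lambda>t. (cmod (f t))\<^sup>2) (x\<^sup>2)" "has_mean (\<lambda>t. (cmod (g t))\<^sup>2) (y\<^sup>2)"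
      "has_mean (\<lambda>t. (cmod (h t))\<^sup>2) (z\<^sup>2)" and "x \<ge> 0" "y \<ge> 0"
  shows "z \<le> x + y"
proof (rule le_add_if_weighted_squares[OF assms(8,9)])
  fix s :: real assume "s > 0"
  then show "z\<^sup>2 \<le> (1 + s) * x\<^sup>2 + (1 + 1 / s) * y\<^sup>2"
    using assms(4) by (intro has_mean_le_combination[OF assms(7,5,6)] bohr_regular_square assms(1-3))
      (simp add: norm_add_square_le)
qed

lemma AP_R_norm_nonneg: "AP_R_norm f \<ge> 0"
  by (simp add: AP_R_norm_def)

lemma AP_R_norm_pos:
  assumes f: "f \<in> AP_R" and t: "f t0 \<noteq> 0"
  shows "AP_R_norm f > 0"
proof -
  define c where "c = (cmod (f t0))\<^sup>2 / 2"
  have c: "c > 0" using t by (simp add: c_def)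
  have "continuous_on UNIV (\<lambda>t. (cmod (f t))\<^sup>2)"
    using f by (auto simp: AP_R_iff_bohr intro: continuous_intros)
  then have "isCont (\<lambda>t. (cmod (f t))\<^sup>2) t0" by (simp add: continuous_on_eq_continuous_at)
  then obtain d where d: "d > 0" "\<And>t. \<bar>t - t0\<bar> < d \<Longrightarrow> \<bar>(cmod (f t))\<^sup>2 - (cmod (f t0))\<^sup>2\<bar> < c"
    using c unfolding continuous_at_eps_delta dist_real_def by blast
  have "(AP_R_norm f)\<^sup>2 > 0"
  proof (rule bohr_mean_pos[OF _ _ AP_R_square_mean[OF f], where c = c and u = t0 and v = "t0 + d / 2"])
    show "c \<le> (cmod (f t))\<^sup>2" if "t \<in> {t0..t0 + d / 2}" for t
    proof -
      have "\<bar>t - t0\<bar> < d" using that \<open>d > 0\<close> by auto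
      then show ?thesis using d(2)[of t] unfolding c_def by linarith
    qed
  qed (use c d bohr_regular_square[OF AP_R_bohr_regular[OF f]] in auto)
  then show ?thesis using AP_R_norm_nonneg[of f] by (simp add: less_le)
qed

theorem Metric_space_AP_R: "Metric_space AP_R (\<lambda>f g. AP_R_norm (\<lambda>t. f t - g t))"
proof
  fix f g h :: "real \<Rightarrow> complex"
  show "0 \<le> AP_R_norm (\<lambda>t. f t - g t)" by (rule AP_R_norm_nonneg)
  have "(f t - g t) * cnj (f t - g t) = (g t - f t) * cnj (g t - f t)" for t
    by (simp add: algebra_simps)
  then show "AP_R_norm (\<lambda>t. f t - g t) = AP_R_norm (\<lambda>t. g t - f t)"
    by (simp only: AP_R_norm_def AP_R_inner_def)
  { assume fg: "f \<in> AP_R" "g \<in> AP_R"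
    have "AP_R_norm (\<lambda>t. 0) = 0"
      by (simp add: AP_R_norm_def AP_R_inner_def tendsto_Lim)
    moreover have "f = g" if "AP_R_norm (\<lambda>t. f t - g t) = 0"
    proof (rule ext, rule ccontr)
      fix t assume "f t \<noteq> g t"
      then show False using AP_R_norm_pos[OF AP_R_diff[OF fg], of t] that by simp
    qed
    ultimately show "(AP_R_norm (\<lambda>t. f t - g t) = 0) = (f = g)" by auto }
  assume "f \<in> AP_R" "g \<in> AP_R" "h \<in> AP_R"
  then show "AP_R_norm (\<lambda>t. f t - h t) \<le> AP_R_norm (\<lambda>t. f t - g t) + AP_R_norm (\<lambda>t. g t - h t)"
    by (intro has_mean_square_triangle[of "\<lambda>t. f t - g t" "\<lambda>t. g t - h t" "\<lambda>t. f t - h t"]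
        AP_R_square_mean AP_R_bohr_regular AP_R_diff AP_R_norm_nonneg) auto
qed

subsection \<open>Sequences as step functions\<close>

text \<open>The step function of a sequence has the same quadratic mean, so that positivity and the triangle
  inequality for sequences are instances of those for functions.\<close>

definition step :: "(int \<Rightarrow> complex) \<Rightarrow> real \<Rightarrow> complex" where
  "step a t = a \<lfloor>t\<rfloor>"

lemma AP_Z_bohr_regular:
  assumes a: "a \<in> AP_Z"
  shows "bohr_regular (step a)"
  unfolding bohr_regular_def
proof (intro conjI)
  show bohr: "bohr (step a)"
    unfolding bohr_def
  proof (intro allI impI)
    fix \<epsilon> :: real assume "\<epsilon> > 0"
    then have "relatively_dense {real_of_int p |p. \<forall>n. cmod (a (n + p) - a n) \<le> \<epsilon>}"
      using a by (simp add: AP_Z_iff_relatively_dense)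
    then show "relatively_dense (almost_periods (step a) \<epsilon>)"
      by (rule relatively_dense_mono) (auto simp: almost_periods_def step_def)
  qed
  show "bounded (range (step a))"
  proof (rule bohr_bounded[OF bohr])
    fix x y :: real
    have "step a ` {x..y} \<subseteq> a ` {\<lfloor>x\<rfloor>..\<lfloor>y\<rfloor>}" by (auto simp: step_def intro!: imageI floor_mono)
    then show "bounded (step a ` {x..y})" by (rule bounded_subset[rotated]) (simp add: finite_imp_bounded)
  qed
  show "step a \<in> borel_measurable borel"
    unfolding step_def by measurable
qed

lemma has_integral_step:
  "((\<lambda>t. (cmod (step a t))\<^sup>2) has_integral (\<Sum>k<n. (cmod (a (m + int k)))\<^sup>2)) {of_int m..of_int m + real n}"
proof (induction n)
  case (Suc n)
  let ?x = "real_of_int m + real n"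
  have "((\<lambda>t. (cmod (a (m + int n)))\<^sup>2) has_integral (cmod (a (m + int n)))\<^sup>2) {?x..?x+1}"
    using has_integral_const_real[of "(cmod (a (m + int n)))\<^sup>2" ?x "?x + 1"] by simp
  then have "((\<lambda>t. (cmod (step a t))\<^sup>2) has_integral (cmod (a (m + int n)))\<^sup>2) {?x..?x+1}"
  proof (rule has_integral_spike_finite[of "{?x + 1}", rotated 2])
    fix t assume "t \<in> {?x..?x+1} - {?x + 1}"
    then have "\<lfloor>t\<rfloor> = m + int n" by (intro floor_unique) auto
    then show "(cmod (step a t))\<^sup>2 = (cmod (a (m + int n)))\<^sup>2" by (simp add: step_def)
  qed simp
  from has_integral_combine[OF _ _ Suc this] show ?case by (simp add: algebra_simps)
qed (simp add: has_integral_refl)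

text \<open>The sum over \<open>{-p..p}\<close> is the integral of the step function over \<open>{-p..p}\<close> plus one more term, which
  is bounded and disappears in the average.\<close>

lemma AP_Z_means:
  assumes a: "a \<in> AP_Z"
  shows "has_mean (\<lambda>t. (cmod (step a t))\<^sup>2) ((AP_Z_norm a)\<^sup>2)"
    and "(\<lambda>p. 1 / (2 * real p) * (\<Sum>n = - int p..int p. (cmod (a n))\<^sup>2)) \<longlonglongrightarrow> (AP_Z_norm a)\<^sup>2"
proof -
  note reg = bohr_regular_square[OF AP_Z_bohr_regular[OF a]]
  obtain m where m: "has_mean (\<lambda>t. (cmod (step a t))\<^sup>2) m" using bohr_has_mean[OF reg(1,2,4)] by blast
  have m0: "m \<ge> 0" using has_mean_nonneg[OF m _ reg(4)] by simp
  obtain B where B: "\<And>t. (cmod (step a t))\<^sup>2 \<le> B" using reg(2) unfolding bounded_iff by auto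
  have sum_eq: "integral {-real p..real p} (\<lambda>t. (cmod (step a t))\<^sup>2) = (\<Sum>n = - int p..<int p. (cmod (a n))\<^sup>2)" for p
  proof -
    have "(\<Sum>n = - int p..<int p. (cmod (a n))\<^sup>2) = (\<Sum>k<2 * p. (cmod (a (- int p + int k)))\<^sup>2)"
      by (rule sum.reindex_bij_witness[of _ "\<lambda>k. - int p + int k" "\<lambda>n. nat (n + int p)"]) auto
    moreover have "of_int (- int p) + real (2 * p) = real p" by simp
    ultimately show ?thesis
      using has_integral_step[of a "- int p" "2 * p"] by (simp add: integral_unique)
  qed
  have "(\<lambda>p. 1 / (2 * real p) * integral {-real p..real p} (\<lambda>t. (cmod (step a t))\<^sup>2)) \<longlonglongrightarrow> m"
    using m unfolding has_mean_def by (rule filterlim_compose) (rule filterlim_real_sequentially)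
  moreover have "(\<lambda>p. 1 / (2 * real p) * (cmod (a (int p)))\<^sup>2) \<longlonglongrightarrow> 0"
  proof (rule tendsto_sandwich[of "\<lambda>_. 0" _ _ "\<lambda>p. 1 / (2 * real p) * B"])
    show "(\<lambda>p. 1 / (2 * real p) * B) \<longlonglongrightarrow> 0" by real_asymp
    have "(cmod (a (int p)))\<^sup>2 \<le> B" for p using B[of "real p"] by (simp add: step_def)
    then show "\<forall>\<^sub>F p in sequentially. 1 / (2 * real p) * (cmod (a (int p)))\<^sup>2 \<le> 1 / (2 * real p) * B"
      by (intro always_eventually allI mult_left_mono) auto
  qed (auto intro: always_eventually)
  ultimately have "(\<lambda>p. 1 / (2 * real p) * (\<Sum>n = - int p..<int p. (cmod (a n))\<^sup>2)
      + 1 / (2 * real p) * (cmod (a (int p)))\<^sup>2) \<longlonglongrightarrow> m + 0"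
    unfolding sum_eq by (rule tendsto_add)
  moreover have "{- int p..int p} = insert (int p) {- int p..<int p}" for p by auto
  ultimately have lim: "(\<lambda>p. 1 / (2 * real p) * (\<Sum>n = - int p..int p. (cmod (a n))\<^sup>2)) \<longlonglongrightarrow> m"
    by (simp add: algebra_simps)
  have eq: "of_real (1 / (2 * real p)) * (\<Sum>n = - int p..int p. a n * cnj (a n))
      = complex_of_real (1 / (2 * real p) * (\<Sum>n = - int p..int p. (cmod (a n))\<^sup>2))" for p
    using complex_norm_square by (simp only: of_real_mult of_real_sum of_real_power)
  have "AP_Z_inner a a = of_real m"
    unfolding AP_Z_inner_def eq using tendsto_of_real[OF lim] by (rule limI)
  then have "(AP_Z_norm a)\<^sup>2 = m" using m0 by (simp add: AP_Z_norm_def)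
  with m lim show "has_mean (\<lambda>t. (cmod (step a t))\<^sup>2) ((AP_Z_norm a)\<^sup>2)"
    "(\<lambda>p. 1 / (2 * real p) * (\<Sum>n = - int p..int p. (cmod (a n))\<^sup>2)) \<longlonglongrightarrow> (AP_Z_norm a)\<^sup>2" by simp_all
qed

lemma AP_Z_norm_nonneg: "AP_Z_norm a \<ge> 0"
  by (simp add: AP_Z_norm_def)

lemma AP_Z_norm_pos:
  assumes a: "a \<in> AP_Z" and n: "a n \<noteq> 0"
  shows "AP_Z_norm a > 0"
proof -
  have "(AP_Z_norm a)\<^sup>2 > 0"
  proof (rule bohr_mean_pos[OF _ _ AP_Z_means(1)[OF a], where c = "(cmod (a n))\<^sup>2" and u = "of_int n" and v = "of_int n + 1 / 2"])
    fix t assume "t \<in> {of_int n..real_of_int n + 1 / 2}"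
    then have "\<lfloor>t\<rfloor> = n" by (intro floor_unique) auto
    then show "(cmod (a n))\<^sup>2 \<le> (cmod (step a t))\<^sup>2" by (simp add: step_def)
  qed (use n bohr_regular_square[OF AP_Z_bohr_regular[OF a]] in auto)
  then show ?thesis using AP_Z_norm_nonneg[of a] by (simp add: less_le)
qed

theorem Metric_space_AP_Z: "Metric_space AP_Z (\<lambda>a b. AP_Z_norm (\<lambda>n. a n - b n))"
proof
  fix a b c :: "int \<Rightarrow> complex"
  show "0 \<le> AP_Z_norm (\<lambda>t. a t - b t)" by (rule AP_Z_norm_nonneg)
  have "(a t - b t) * cnj (a t - b t) = (b t - a t) * cnj (b t - a t)" for t
    by (simp add: algebra_simps)
  then show "AP_Z_norm (\<lambda>t. a t - b t) = AP_Z_norm (\<lambda>t. b t - a t)"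
    by (simp only: AP_Z_norm_def AP_Z_inner_def)
  { assume ab: "a \<in> AP_Z" "b \<in> AP_Z"
    have "AP_Z_norm (\<lambda>t. 0) = 0"
      by (simp add: AP_Z_norm_def AP_Z_inner_def)
    moreover have "a = b" if "AP_Z_norm (\<lambda>t. a t - b t) = 0"
    proof (rule ext, rule ccontr)
      fix t assume "a t \<noteq> b t"
      then show False using AP_Z_norm_pos[OF AP_Z_diff[OF ab], of t] that by simp
    qed
    ultimately show "(AP_Z_norm (\<lambda>t. a t - b t) = 0) = (a = b)" by auto }
  assume "a \<in> AP_Z" "b \<in> AP_Z" "c \<in> AP_Z"
  then show "AP_Z_norm (\<lambda>t. a t - c t) \<le> AP_Z_norm (\<lambda>t. a t - b t) + AP_Z_norm (\<lambda>t. b t - c t)"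
    by (intro has_mean_square_triangle[of "step (\<lambda>t. a t - b t)" "step (\<lambda>t. b t - c t)" "step (\<lambda>t. a t - c t)"]
        AP_Z_means AP_Z_bohr_regular AP_Z_diff AP_Z_norm_nonneg) (auto simp: step_def)
qed

section \<open>Orthogonality of exponentials\<close>

lemma has_integral_cis_period:
  assumes P: "P > 0" and \<mu>: "\<mu> * P = 2 * pi * of_int m"
  shows "((\<lambda>t. cis (\<mu> * t)) has_integral (if \<mu> = 0 then of_real P else 0)) {a..a+P}"
proof (cases "\<mu> = 0")
  case True
  then show ?thesis using has_integral_const_real[of "1::complex" a "a + P"] P by (simp add: scaleR_conv_of_real)
next
  case False
  have "((\<lambda>t. cis (\<mu> * t)) has_integral cis (\<mu> * (a + P)) / (\<i> * \<mu>) - cis (\<mu> * a) / (\<i> * \<mu>)) {a..a+P}"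
  proof (rule fundamental_theorem_of_calculus)
    fix t assume "t \<in> {a..a+P}"
    have "((\<lambda>t. cis (\<mu> * t)) has_vector_derivative \<i> * of_real \<mu> * cis (\<mu> * t)) (at t within {a..a + P})"
      unfolding has_vector_derivative_def
      by (auto intro!: derivative_eq_intros simp: scaleR_conv_of_real mult_ac)
    from has_vector_derivative_divide[OF this, of "\<i> * of_real \<mu>"]
    show "((\<lambda>t. cis (\<mu> * t) / (\<i> * complex_of_real \<mu>)) has_vector_derivative cis (\<mu> * t)) (at t within {a..a + P})"
      using False by simp
  qed (use P in simp)
  moreover have "cis (\<mu> * (a + P)) = cis (\<mu> * a)"
    by (simp only: distrib_left \<mu> cis_mult[symmetric]) simp
  ultimately show ?thesis using False by simp
qed

lemma cmod_sum_square:
  "complex_of_real ((cmod (\<Sum>x\<in>A. f x))\<^sup>2) = (\<Sum>x\<in>A. \<Sum>y\<in>A. f x * cnj (f y))"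
  using complex_norm_square[of "\<Sum>x\<in>A. f x"] by (simp add: sum_product)

lemma exponential_product:
  "(a * cis x) * cnj (b * cis y) = (a * cnj b) * cis (x - y)"
  by (simp add: cis_mult cis_cnj)

text \<open>Here \<open>P\<close> is a period of the quotients of the exponentials, so that the frequencies can be taken from a
  coset such as \<open>\<omega> + (2 \<pi> / P) \<int>\<close>.\<close>

lemma parseval_exponentials:
  fixes w :: "'i \<Rightarrow> real"
  assumes fin: "finite A" and inj: "inj_on w A" and P: "P > 0"
    and w: "\<And>x y. x \<in> A \<Longrightarrow> y \<in> A \<Longrightarrow> \<exists>m::int. (w x - w y) * P = 2 * pi * of_int m"
  shows "((\<lambda>t. (cmod (\<Sum>x\<in>A. c x * cis (w x * t)))\<^sup>2) has_integral P * (\<Sum>x\<in>A. (cmod (c x))\<^sup>2)) {a..a+P}"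
proof -
  have "((\<lambda>t. \<Sum>x\<in>A. \<Sum>y\<in>A. (c x * cnj (c y)) * cis ((w x - w y) * t)) has_integral
      (\<Sum>x\<in>A. \<Sum>y\<in>A. (c x * cnj (c y)) * (if w x - w y = 0 then of_real P else 0))) {a..a+P}"
  proof (intro has_integral_sum fin has_integral_mult_right)
    fix x y assume "x \<in> A" "y \<in> A"
    then obtain m :: int where "(w x - w y) * P = 2 * pi * of_int m" using w by blast
    then show "((\<lambda>t. cis ((w x - w y) * t)) has_integral (if w x - w y = 0 then of_real P else 0)) {a..a+P}"
      by (rule has_integral_cis_period[OF P])
  qed
  moreover have "(\<Sum>x\<in>A. \<Sum>y\<in>A. (c x * cnj (c y)) * cis ((w x - w y) * t))
      = complex_of_real ((cmod (\<Sum>x\<in>A. c x * cis (w x * t)))\<^sup>2)" for t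
    unfolding cmod_sum_square exponential_product by (simp add: algebra_simps)
  moreover have "(\<Sum>x\<in>A. \<Sum>y\<in>A. (c x * cnj (c y)) * (if w x - w y = 0 then of_real P else 0))
      = complex_of_real (P * (\<Sum>x\<in>A. (cmod (c x))\<^sup>2))"
  proof -
    have "(\<Sum>y\<in>A. (c x * cnj (c y)) * (if w x - w y = 0 then of_real P else 0)) = complex_of_real (P * (cmod (c x))\<^sup>2)"
      if "x \<in> A" for x
    proof -
      have "(\<Sum>y\<in>A. (c x * cnj (c y)) * (if w x - w y = 0 then of_real P else 0))
          = (\<Sum>y\<in>A. if x = y then (c x * cnj (c y)) * of_real P else 0)"
        using that inj by (intro sum.cong) (auto simp: inj_on_def)
      then show ?thesis using that fin by (simp add: complex_norm_square[symmetric])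
    qed
    then show ?thesis by (simp add: sum_distrib_left)
  qed
  ultimately have "((\<lambda>t. complex_of_real ((cmod (\<Sum>x\<in>A. c x * cis (w x * t)))\<^sup>2)) has_integral
      complex_of_real (P * (\<Sum>x\<in>A. (cmod (c x))\<^sup>2))) {a..a+P}" by simp
  from has_integral_Re[OF this] show ?thesis by simp
qed

lemma parseval_dft:
  fixes N :: nat
  assumes N: "N > 0"
  shows "(\<Sum>k<N. (cmod (\<Sum>r\<in>{0..<int N}. b r * cis (2 * pi * of_int r * real k / real N)))\<^sup>2)
       = real N * (\<Sum>r\<in>{0..<int N}. (cmod (b r))\<^sup>2)"
proof -
  have geo: "(\<Sum>k<N. cis (2 * pi * of_int r * real k / real N - 2 * pi * of_int s * real k / real N))
      = (if r = s then of_nat N else 0)" if rs: "r \<in> {0..<int N}" "s \<in> {0..<int N}" for r s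
  proof (cases "r = s")
    case False
    define z where "z = cis (2 * pi * of_int (r - s) / real N)"
    have "z \<noteq> 1"
    proof
      assume "z = 1"
      then obtain n :: int where "2 * pi * of_int (r - s) / real N = of_int n * (2 * pi)"
        unfolding z_def cis_eq_1_iff by blast
      then have "2 * pi * (of_int (r - s) / real N) = 2 * pi * of_int n" by simp
      then have "of_int (r - s) / real N = of_int n" by (simp only: mult_cancel_left) simp
      then have "real_of_int (r - s) = of_int (n * int N)" using N by (simp add: field_simps)
      then have "r - s = n * int N" by (simp only: of_int_eq_iff)
      then have "int N dvd r - s" by simp
      moreover have "\<bar>r - s\<bar> < int N" using rs by auto
      ultimately show False using False by (metis dvd_imp_le_int eq_iff_diff_eq_0 not_less abs_of_nat)
    qed
    moreover have "z ^ N = 1"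
      unfolding z_def Complex.DeMoivre using N by simp
    ultimately have "(\<Sum>k<N. z ^ k) = 0" by (simp add: sum_gp_strict)
    moreover have "cis (2 * pi * of_int r * real k / real N - 2 * pi * of_int s * real k / real N) = z ^ k" for k
      unfolding z_def Complex.DeMoivre by (simp add: right_diff_distrib diff_divide_distrib mult_ac)
    ultimately show ?thesis using False by simp
  qed simp
  have "complex_of_real (\<Sum>k<N. (cmod (\<Sum>r\<in>{0..<int N}. b r * cis (2 * pi * of_int r * real k / real N)))\<^sup>2)
     = (\<Sum>k<N. \<Sum>r\<in>{0..<int N}. \<Sum>s\<in>{0..<int N}. (b r * cnj (b s)) *
          cis (2 * pi * of_int r * real k / real N - 2 * pi * of_int s * real k / real N))"
    unfolding of_real_sum cmod_sum_square exponential_product by simp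
  also have "\<dots> = (\<Sum>r\<in>{0..<int N}. \<Sum>s\<in>{0..<int N}. (b r * cnj (b s)) *
      (\<Sum>k<N. cis (2 * pi * of_int r * real k / real N - 2 * pi * of_int s * real k / real N)))"
    by (subst sum.swap, intro sum.cong refl, subst sum.swap) (simp add: sum_distrib_left)
  also have "\<dots> = (\<Sum>r\<in>{0..<int N}. \<Sum>s\<in>{0..<int N}. if r = s then (b r * cnj (b s)) * of_nat N else 0)"
    by (intro sum.cong refl) (subst geo, auto)
  also have "\<dots> = (\<Sum>r\<in>{0..<int N}. b r * cnj (b r) * of_nat N)"
    by (intro sum.cong refl) simp
  also have "\<dots> = complex_of_real (real N * (\<Sum>r\<in>{0..<int N}. (cmod (b r))\<^sup>2))"
    by (simp add: complex_norm_square[symmetric] sum_distrib_left mult.commute)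
  finally show ?thesis by (simp only: of_real_eq_iff)
qed

section \<open>The sampling map\<close>

lemma L1_translate:
  assumes "\<psi> \<in> L1"
  shows "integrable lebesgue (\<lambda>t. \<psi> (t - x))" "(LINT t|lebesgue. cmod (\<psi> (t - x))) = (LINT t|lebesgue. cmod (\<psi> t))"
proof -
  show "integrable lebesgue (\<lambda>t. \<psi> (t - x))"
    using lebesgue_integrable_real_affine[of \<psi> 1 "-x"] assms by (simp add: L1_def)
  show "(LINT t|lebesgue. cmod (\<psi> (t - x))) = (LINT t|lebesgue. cmod (\<psi> t))"
    using lebesgue_integral_real_affine[of 1 "\<lambda>t. cmod (\<psi> t)" "-x"] by simp
qed

lemma integrable_bounded_mult_L1:
  fixes g :: "real \<Rightarrow> complex"
  assumes f: "f \<in> borel_measurable borel" "bounded (range f)" and g: "integrable lebesgue g"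
  shows "integrable lebesgue (\<lambda>t. f t * g t)"
proof -
  obtain B where B: "\<And>t. cmod (f t) \<le> B" using f(2) unfolding bounded_iff by auto
  have [measurable]: "f \<in> borel_measurable lebesgue" "g \<in> borel_measurable lebesgue"
    using f(1) g by (auto intro: measurable_completion)
  show ?thesis
  proof (rule Bochner_Integration.integrable_bound)
    show "integrable lebesgue (\<lambda>t. B * cmod (g t))" using g by simp
    show "AE t in lebesgue. norm (f t * g t) \<le> norm (B * cmod (g t))"
      using order_trans[OF norm_ge_zero B] B by (intro AE_I2) (auto simp: norm_mult abs_mult intro!: mult_right_mono)
  qed measurable
qed

lemma sampling_map_eq: "sampling_map \<alpha> \<psi> f k = (LINT t|lebesgue. f t * cnj (\<psi> (t - of_int k * \<alpha>)))"
  by (simp add: sampling_map_def pairing_def translate_def)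

lemma sampling_integrable:
  assumes "\<psi> \<in> L1" "f \<in> borel_measurable borel" "bounded (range f)"
  shows "integrable lebesgue (\<lambda>t. f t * cnj (\<psi> (t - x)))"
  using assms L1_translate[OF assms(1)] by (intro integrable_bounded_mult_L1) auto

lemma sampling_map_diff:
  assumes "\<psi> \<in> L1" "f \<in> borel_measurable borel" "bounded (range f)" "g \<in> borel_measurable borel" "bounded (range g)"
  shows "sampling_map \<alpha> \<psi> (\<lambda>t. f t - g t) k = sampling_map \<alpha> \<psi> f k - sampling_map \<alpha> \<psi> g k"
  unfolding sampling_map_eq
  using Bochner_Integration.integral_diff[OF sampling_integrable[OF assms(1-3)] sampling_integrable[OF assms(1,4,5)]]
  by (simp add: left_diff_distrib)

lemma sampling_map_bound:
  assumes \<psi>: "\<psi> \<in> L1" and f: "f \<in> borel_measurable borel" and B: "\<And>t. cmod (f t) \<le> B"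
  shows "cmod (sampling_map \<alpha> \<psi> f k) \<le> B * (LINT t|lebesgue. cmod (\<psi> t))"
proof -
  have bdd: "bounded (range f)" unfolding bounded_iff using B by auto
  have "cmod (sampling_map \<alpha> \<psi> f k) \<le> (LINT t|lebesgue. cmod (f t * cnj (\<psi> (t - of_int k * \<alpha>))))"
    unfolding sampling_map_eq by (rule integral_norm_bound)
  also have "\<dots> \<le> (LINT t|lebesgue. B * cmod (\<psi> (t - of_int k * \<alpha>)))"
    using sampling_integrable[OF \<psi> f bdd] L1_translate(1)[OF \<psi>] B
    by (intro integral_mono integrable_norm) (auto simp: norm_mult intro!: mult_right_mono)
  also have "\<dots> = B * (LINT t|lebesgue. cmod (\<psi> t))" using L1_translate(2)[OF \<psi>] by simp
  finally show ?thesis .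
qed

lemma sampling_map_shift:
  "sampling_map \<alpha> \<psi> (\<lambda>t. f (t + of_int n * \<alpha>)) k = sampling_map \<alpha> \<psi> f (k + n)"
  unfolding sampling_map_eq
  using lebesgue_integral_real_affine[of 1 "\<lambda>t. f t * cnj (\<psi> (t - of_int (k + n) * \<alpha>))" "of_int n * \<alpha>"]
  by (simp add: algebra_simps)

text \<open>If \<open>k \<alpha>\<close> is an almost period of \<open>f\<close>, then \<open>k\<close> is one of the samples, with the error multiplied by the
  \<open>L1\<close> norm of \<open>\<psi>\<close>.  Such almost periods are relatively dense because the multiples of \<open>\<alpha>\<close> are.\<close>

lemma sampling_map_in_AP_Z:
  assumes \<psi>: "\<psi> \<in> L1" and f: "f \<in> AP_R" and \<alpha>: "\<alpha> > 0"
  shows "sampling_map \<alpha> \<psi> f \<in> AP_Z"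
  unfolding AP_Z_iff_relatively_dense
proof (intro allI impI)
  fix \<epsilon> :: real assume \<epsilon>: "\<epsilon> > 0"
  define I where "I = (LINT t|lebesgue. cmod (\<psi> t))"
  have I: "I \<ge> 0" by (simp add: I_def)
  define \<delta> where "\<delta> = \<epsilon> / (I + 1)"
  have \<delta>: "\<delta> > 0" "\<delta> * I \<le> \<epsilon>" using \<epsilon> I by (auto simp: \<delta>_def field_simps)
  have f': "bohr f" "continuous_on UNIV f" "f \<in> borel_measurable borel" "bounded (range f)"
    using f AP_R_bohr_regular[OF f] by (auto simp: AP_R_iff_bohr bohr_regular_def)
  let ?Q = "range (\<lambda>k::int. of_int k * \<alpha>)"
  have "relatively_dense {q - q' |q q'. q \<in> ?Q \<and> q' \<in> ?Q \<and> q - q' \<in> almost_periods f \<delta>}"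
    by (intro bohr_common_almost_periods f' relatively_dense_multiples \<alpha> \<delta>)
  then obtain L where L: "L > 0"
    "\<And>a. \<exists>\<tau>\<in>{q - q' |q q'. q \<in> ?Q \<and> q' \<in> ?Q \<and> q - q' \<in> almost_periods f \<delta>}. a < \<tau> \<and> \<tau> < a + L"
    unfolding relatively_dense_def by blast
  have S: "cmod (sampling_map \<alpha> \<psi> f (n + p) - sampling_map \<alpha> \<psi> f n) \<le> \<epsilon>"
    if p: "of_int p * \<alpha> \<in> almost_periods f \<delta>" for n p
  proof -
    have m: "(\<lambda>t. f (t + of_int p * \<alpha>)) \<in> borel_measurable borel" using f'(3) by measurable
    have b: "bounded (range (\<lambda>t. f (t + of_int p * \<alpha>)))" using f'(4) by (rule bounded_subset) auto
    have "sampling_map \<alpha> \<psi> f (n + p) - sampling_map \<alpha> \<psi> f n = sampling_map \<alpha> \<psi> (\<lambda>t. f (t + of_int p * \<alpha>) - f t) n"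
      using sampling_map_diff[OF \<psi> m b f'(3,4)] by (simp add: sampling_map_shift)
    also have "cmod \<dots> \<le> \<delta> * I"
      unfolding I_def using p m f'(3)
      by (intro sampling_map_bound \<psi> borel_measurable_diff) (auto simp: almost_periods_def)
    finally show ?thesis using \<delta> by simp
  qed
  show "relatively_dense {real_of_int p |p. \<forall>n. cmod (sampling_map \<alpha> \<psi> f (n + p) - sampling_map \<alpha> \<psi> f n) \<le> \<epsilon>}"
    unfolding relatively_dense_def
  proof (intro exI[of _ "L / \<alpha>"] conjI allI)
    fix a
    obtain k l :: int where kl: "of_int k * \<alpha> - of_int l * \<alpha> \<in> almost_periods f \<delta>"
      "a * \<alpha> < of_int k * \<alpha> - of_int l * \<alpha>" "of_int k * \<alpha> - of_int l * \<alpha> < a * \<alpha> + L"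
      using L(2)[of "a * \<alpha>"] by blast
    have "of_int (k - l) * \<alpha> = of_int k * \<alpha> - of_int l * \<alpha>" by (simp add: left_diff_distrib)
    with kl have kl': "of_int (k - l) * \<alpha> \<in> almost_periods f \<delta>"
      "a * \<alpha> < of_int (k - l) * \<alpha>" "of_int (k - l) * \<alpha> < a * \<alpha> + L" by simp_all
    have "real_of_int (k - l) \<in> {real_of_int p |p. \<forall>n. cmod (sampling_map \<alpha> \<psi> f (n + p) - sampling_map \<alpha> \<psi> f n) \<le> \<epsilon>}"
      using S[OF kl'(1)] by blast
    moreover have "a < of_int (k - l)" "of_int (k - l) < a + L / \<alpha>"
      using kl'(2,3) \<alpha> by (simp_all only: mult_less_cancel_right_pos pos_less_divide_eq less_diff_eq) (simp add: field_simps)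
    ultimately show "\<exists>\<tau>\<in>{real_of_int p |p. \<forall>n. cmod (sampling_map \<alpha> \<psi> f (n + p) - sampling_map \<alpha> \<psi> f n) \<le> \<epsilon>}.
        a < \<tau> \<and> \<tau> < a + L / \<alpha>" by blast
  qed (use L \<alpha> in simp)
qed

lemma sampling_map_exponentials:
  fixes w :: "'i \<Rightarrow> real"
  assumes \<psi>: "\<psi> \<in> L1" and fin: "finite A"
  shows "sampling_map \<alpha> \<psi> (\<lambda>t. \<Sum>i\<in>A. c i * cis (w i * t)) k
       = (\<Sum>i\<in>A. c i * cnj (fourier \<psi> (w i)) * cis (w i * (of_int k * \<alpha>)))"
proof -
  have bdd: "bounded (range (\<lambda>t. c i * cis (w i * t)))" for i
    unfolding bounded_iff by (rule exI[of _ "cmod (c i)"]) (auto simp: norm_mult)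
  have meas: "(\<lambda>t. c i * cis (w i * t)) \<in> borel_measurable borel" for i
    by (intro borel_measurable_continuous_onI continuous_intros)
  have one: "(LINT t|lebesgue. c i * cis (w i * t) * cnj (\<psi> (t - of_int k * \<alpha>)))
      = c i * cnj (fourier \<psi> (w i)) * cis (w i * (of_int k * \<alpha>))" for i
  proof -
    have "(LINT t|lebesgue. c i * cis (w i * t) * cnj (\<psi> (t - of_int k * \<alpha>)))
        = (LINT t|lebesgue. c i * cis (w i * (of_int k * \<alpha> + t)) * cnj (\<psi> t))"
      using lebesgue_integral_real_affine[of 1 "\<lambda>t. c i * cis (w i * t) * cnj (\<psi> (t - of_int k * \<alpha>))" "of_int k * \<alpha>"]
      by simp
    also have "\<dots> = (LINT t|lebesgue. c i * cis (w i * (of_int k * \<alpha>)) * cnj (\<psi> t * exp (- (\<i> * of_real (w i) * of_real t))))"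
    proof (intro Bochner_Integration.integral_cong refl)
      fix t
      have "exp (- (\<i> * of_real (w i) * of_real t)) = cis (- (w i * t))" by (simp add: cis_conv_exp mult.assoc)
      then show "c i * cis (w i * (of_int k * \<alpha> + t)) * cnj (\<psi> t)
          = c i * cis (w i * (of_int k * \<alpha>)) * cnj (\<psi> t * exp (- (\<i> * of_real (w i) * of_real t)))"
        by (simp add: distrib_left cis_cnj flip: cis_mult)
    qed
    also have "\<dots> = c i * cis (w i * (of_int k * \<alpha>)) * cnj (fourier \<psi> (w i))"
      by (simp only: integral_mult_right_zero Bochner_Integration.integral_cnj fourier_def)
    finally show ?thesis by (simp add: mult_ac)
  qed
  show ?thesis
    unfolding sampling_map_eq sum_distrib_right
    using sampling_integrable[OF \<psi> meas bdd] by (subst Bochner_Integration.integral_sum) (auto simp: one)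
qed

section \<open>Trigonometric polynomials of a fixed period\<close>

text \<open>Polynomials in \<open>cis (2 \<pi> t / P)\<close> and its inverse.  The inductive form makes closure under products a
  short induction; the coefficients are recovered in \<open>trig_poly_sum_form\<close>.\<close>

inductive trig_poly :: "real \<Rightarrow> (real \<Rightarrow> complex) \<Rightarrow> bool" for P where
  monomial: "trig_poly P (\<lambda>t. a * cis (2 * pi * of_int j / P * t))"
| add: "trig_poly P f \<Longrightarrow> trig_poly P g \<Longrightarrow> trig_poly P (\<lambda>t. f t + g t)"

lemma trig_poly_const: "trig_poly P (\<lambda>t. a)"
  using trig_poly.monomial[of P a 0] by simp

lemma trig_poly_mult_monomial:
  "trig_poly P f \<Longrightarrow> trig_poly P (\<lambda>t. a * cis (2 * pi * of_int j / P * t) * f t)"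
proof (induction rule: trig_poly.induct)
  case (monomial b i)
  have "a * cis (2 * pi * of_int j / P * t) * (b * cis (2 * pi * of_int i / P * t))
      = a * b * cis (2 * pi * of_int (j + i) / P * t)" for t
    by (simp add: distrib_left distrib_right add_divide_distrib flip: cis_mult)
  then show ?case by (simp only: trig_poly.monomial)
next
  case (add f g)
  then show ?case using trig_poly.add by (simp add: distrib_left)
qed

lemma trig_poly_mult: "trig_poly P f \<Longrightarrow> trig_poly P g \<Longrightarrow> trig_poly P (\<lambda>t. f t * g t)"
proof (induction rule: trig_poly.induct)
  case (monomial a j)
  then show ?case by (rule trig_poly_mult_monomial)
next
  case (add f1 f2)
  then show ?case using trig_poly.add by (simp add: distrib_right)
qed

lemma trig_poly_sum_form:
  assumes "trig_poly P h"
  shows "\<exists>J c. finite J \<and> (\<forall>t. h t = (\<Sum>j\<in>J. c j * cis (2 * pi * of_int j / P * t)))"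
  using assms
proof (induction rule: trig_poly.induct)
  case (monomial a j)
  show ?case by (rule exI[of _ "{j}"], rule exI[of _ "\<lambda>_. a"]) simp
next
  case (add f g)
  obtain J c where J: "finite J" "\<And>t. f t = (\<Sum>j\<in>J. c j * cis (2 * pi * of_int j / P * t))" using add.IH(1) by blast
  obtain K d where K: "finite K" "\<And>t. g t = (\<Sum>j\<in>K. d j * cis (2 * pi * of_int j / P * t))" using add.IH(2) by blast
  define c' where "c' j = (if j \<in> J then c j else 0)" for j
  define d' where "d' j = (if j \<in> K then d j else 0)" for j
  have "f t = (\<Sum>j\<in>J \<union> K. c' j * cis (2 * pi * of_int j / P * t))" for t
    unfolding J(2) using J(1) K(1) by (intro sum.mono_neutral_cong_left) (auto simp: c'_def)
  moreover have "g t = (\<Sum>j\<in>J \<union> K. d' j * cis (2 * pi * of_int j / P * t))" for t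
    unfolding K(2) using J(1) K(1) by (intro sum.mono_neutral_cong_left) (auto simp: d'_def)
  ultimately have "f t + g t = (\<Sum>j\<in>J \<union> K. (c' j + d' j) * cis (2 * pi * of_int j / P * t))" for t
    by (simp add: distrib_right sum.distrib)
  then show ?case using J(1) K(1) by (intro exI[of _ "J \<union> K"] exI[of _ "\<lambda>j. c' j + d' j"]) auto
qed

text \<open>On the unit circle the real and imaginary parts of \<open>z\<close> are combinations of \<open>z\<close> and \<open>cnj z = 1 / z\<close>.\<close>

lemma trig_poly_real_polynomial_on_circle:
  assumes "real_polynomial_function r"
  shows "trig_poly P (\<lambda>t. complex_of_real (r (cis (2 * pi / P * t))))"
  using assms
proof (induction rule: real_polynomial_function.induct)
  case (linear r)
  interpret bounded_linear r by fact
  have r: "r z = Re z * r 1 + Im z * r \<i>" for z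
  proof -
    have "z = Re z *\<^sub>R 1 + Im z *\<^sub>R \<i>" by (simp add: complex_eq_iff)
    then have "r z = r (Re z *\<^sub>R 1 + Im z *\<^sub>R \<i>)" by simp
    then show ?thesis by (simp only: add scaleR real_scaleR_def)
  qed
  have "complex_of_real (r (cis x)) = (r 1 - \<i> * r \<i>) / 2 * cis x + (r 1 + \<i> * r \<i>) / 2 * cis (- x)" for x
    by (subst r) (simp add: complex_eq_iff field_simps)
  then have "complex_of_real (r (cis (2 * pi / P * t)))
      = (r 1 - \<i> * r \<i>) / 2 * cis (2 * pi * of_int 1 / P * t) + (r 1 + \<i> * r \<i>) / 2 * cis (2 * pi * of_int (-1) / P * t)" for t
    by simp
  then show ?case using trig_poly.add[OF trig_poly.monomial trig_poly.monomial] by presburger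
next
  case (const c)
  then show ?case by (rule trig_poly_const)
next
  case (add f g)
  then show ?case using trig_poly.add by simp
next
  case (mult f g)
  then show ?case using trig_poly_mult by simp
qed

text \<open>A continuous function on \<open>{0..P}\<close> with equal end values is a continuous function on the
  circle, where Stone--Weierstrass applies.\<close>

lemma trig_poly_approximation:
  fixes \<phi> :: "real \<Rightarrow> complex"
  assumes P: "P > 0" and cont: "continuous_on {0..P} \<phi>" and ends: "\<phi> 0 = \<phi> P" and e: "e > 0"
  obtains h where "trig_poly P h" "\<And>t. t \<in> {0..P} \<Longrightarrow> cmod (\<phi> t - h t) < e"
proof -
  define p where "p s = \<phi> (P * s)" for s
  have "continuous_on {0..1} p"
    unfolding p_def using P by (intro continuous_on_compose2[OF cont] continuous_intros) (auto simp: mult_le_cancel_left1)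
  then have "homotopic_loops UNIV p p"
    using ends by (simp add: homotopic_loops_refl path_def pathfinish_def pathstart_def p_def)
  from homotopic_with_imp_continuous[OF homotopic_loops_imp_homotopic_circlemaps[OF this]]
  have q: "continuous_on (sphere 0 1) (p \<circ> (\<lambda>z. Arg2pi z / (2 * pi)))" by simp
  obtain g where g: "polynomial_function g"
    "\<And>z. z \<in> sphere 0 1 \<Longrightarrow> cmod ((p \<circ> (\<lambda>z. Arg2pi z / (2 * pi))) z - g z) < e"
    using Stone_Weierstrass_polynomial_function[OF _ q e] by auto
  define h where "h t = complex_of_real (Re (g (cis (2 * pi / P * t)))) + \<i> * complex_of_real (Im (g (cis (2 * pi / P * t))))" for t
  have "real_polynomial_function (Re \<circ> g)" "real_polynomial_function (Im \<circ> g)"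
    using g(1) bounded_linear_Re bounded_linear_Im unfolding polynomial_function_def by blast+
  then have "trig_poly P h"
    unfolding h_def
    by (intro trig_poly.add trig_poly_mult trig_poly_const)
       (auto dest: trig_poly_real_polynomial_on_circle[where P = P])
  moreover have "cmod (\<phi> t - h t) < e" if t: "t \<in> {0..P}" for t
  proof -
    have "p (Arg2pi (cis (2 * pi / P * t)) / (2 * pi)) = \<phi> t"
    proof (cases "t = P")
      case True
      moreover have "Arg2pi 1 = 0" by (intro Arg2pi_unique[of 1]) auto
      ultimately show ?thesis using P ends by (simp add: p_def)
    next
      case False
      then have "Arg2pi (cis (2 * pi / P * t)) = 2 * pi / P * t"
        using t P by (intro Arg2pi_unique[of 1]) (auto simp: cis_conv_exp field_simps)
      then show ?thesis using P by (simp add: p_def)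
    qed
    moreover have "h t = g (cis (2 * pi / P * t))" by (simp add: h_def complex_eq_iff)
    ultimately show ?thesis using g(2)[of "cis (2 * pi / P * t)"] by simp
  qed
  ultimately show thesis using that by blast
qed

lemma trig_poly_periodic:
  assumes "trig_poly P h" and P: "P > 0"
  shows "h (t + of_int n * P) = h t"
  using assms(1)
proof (induction rule: trig_poly.induct)
  case (monomial a j)
  have "2 * pi * of_int j / P * (t + of_int n * P) = 2 * pi * of_int j / P * t + 2 * pi * of_int (j * n)"
    using P by (simp add: field_simps)
  then have "cis (2 * pi * of_int j / P * (t + of_int n * P)) = cis (2 * pi * of_int j / P * t) * cis (2 * pi * of_int (j * n))"
    by (simp only: cis_mult)
  then show ?case by (simp del: of_int_mult)
qed simp

lemma trig_poly_continuous: "trig_poly P h \<Longrightarrow> continuous_on S h"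
proof (induction rule: trig_poly.induct)
  case (monomial a j)
  show ?case by (intro continuous_on_mult continuous_on_cis continuous_on_const continuous_on_id)
qed (rule continuous_on_add)

section \<open>The upper bound\<close>

text \<open>Bounding the finite partial sums keeps all computations in the reals; some such \<open>C\<close> exists exactly
  when the supremum of the infinite sums is finite (\<open>SUP_infsum_ennreal_finite_iff\<close>).\<close>

definition bessel_bound :: "real \<Rightarrow> (real \<Rightarrow> complex) \<Rightarrow> real \<Rightarrow> bool" where
  "bessel_bound \<alpha> \<psi> C \<longleftrightarrow> (\<forall>\<omega> F. finite F \<longrightarrow>
     (\<Sum>k\<in>F. (cmod (fourier \<psi> (\<omega> + 2 * pi * (of_int k / \<alpha>))))\<^sup>2) \<le> C)"

lemma cmod_sum_mult_square_le:
  "(cmod (\<Sum>i\<in>A. c i * d i))\<^sup>2 \<le> (\<Sum>i\<in>A. (cmod (c i))\<^sup>2) * (\<Sum>i\<in>A. (cmod (d i))\<^sup>2)"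
proof -
  have "cmod (\<Sum>i\<in>A. c i * d i) \<le> (\<Sum>i\<in>A. cmod (c i) * cmod (d i))"
    by (rule order_trans[OF norm_sum]) (simp add: norm_mult)
  then have "(cmod (\<Sum>i\<in>A. c i * d i))\<^sup>2 \<le> (\<Sum>i\<in>A. cmod (c i) * cmod (d i))\<^sup>2"
    by (intro power_mono) auto
  also have "\<dots> \<le> (\<Sum>i\<in>A. (cmod (c i))\<^sup>2) * (\<Sum>i\<in>A. (cmod (d i))\<^sup>2)"
    by (rule Cauchy_Schwarz_ineq_sum)
  finally show ?thesis .
qed

text \<open>The samples of a polynomial of period \<open>N \<alpha>\<close> have period \<open>N\<close>, and the frequencies \<open>2 \<pi> j / (N \<alpha>)\<close> with
  the same residue of \<open>j\<close> modulo \<open>N\<close> are aliased to one character of \<open>\<int> / N\<close>.  Such a class lies in one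
  coset of \<open>(2 \<pi> / \<alpha>) \<int>\<close>, so Cauchy--Schwarz on each class costs a factor \<open>C\<close>; Parseval on \<open>\<int> / N\<close> and on
  the period does the rest.\<close>

lemma sampling_trig_poly:
  assumes \<psi>: "\<psi> \<in> L1" and \<alpha>: "\<alpha> > 0" and C: "bessel_bound \<alpha> \<psi> C" and N: "N > (0::nat)"
    and h: "trig_poly (real N * \<alpha>) h"
  shows "(\<Sum>k<N. (cmod (sampling_map \<alpha> \<psi> h (int k)))\<^sup>2)
      \<le> C / \<alpha> * integral {0..real N * \<alpha>} (\<lambda>t. (cmod (h t))\<^sup>2)"
proof -
  define P where "P = real N * \<alpha>"
  have P: "P > 0" using N \<alpha> by (simp add: P_def)
  obtain J c where J: "finite J" "\<And>t. h t = (\<Sum>j\<in>J. c j * cis (2 * pi * of_int j / P * t))"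
    using trig_poly_sum_form[OF h] unfolding P_def by blast
  define d where "d j = cnj (fourier \<psi> (2 * pi * of_int j / P))" for j
  define cls where "cls r = {j\<in>J. j mod int N = r}" for r
  define b where "b r = (\<Sum>j\<in>cls r. c j * d j)" for r
  have split: "real_of_int j = of_int (j mod int N) + real N * of_int (j div int N)" for j
  proof -
    have "j = j mod int N + int N * (j div int N)" by simp
    then have "real_of_int j = of_int (j mod int N + int N * (j div int N))" by simp
    then show ?thesis by (simp only: of_int_add of_int_mult of_int_of_nat_eq)
  qed
  have maps: "(\<lambda>j. j mod int N) ` J \<subseteq> {0..<int N}" using N by auto
  have S: "sampling_map \<alpha> \<psi> h (int k) = (\<Sum>r\<in>{0..<int N}. b r * cis (2 * pi * of_int r * real k / real N))" for k
  proof -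
    have "h = (\<lambda>t. \<Sum>j\<in>J. c j * cis (2 * pi * of_int j / P * t))" using J(2) by blast
    then have "sampling_map \<alpha> \<psi> h (int k) = (\<Sum>j\<in>J. c j * d j * cis (2 * pi * of_int j / P * (of_int (int k) * \<alpha>)))"
      unfolding d_def by (simp only: sampling_map_exponentials[OF \<psi> J(1)])
    also have "\<dots> = (\<Sum>j\<in>J. c j * d j * cis (2 * pi * of_int (j mod int N) * real k / real N))"
    proof (intro sum.cong refl)
      fix j
      have "2 * pi * of_int j / P * (of_int (int k) * \<alpha>)
          = 2 * pi * of_int (j mod int N) * real k / real N + 2 * pi * of_int (j div int N * int k)"
        using N \<alpha> by (subst split) (simp add: P_def add_divide_distrib distrib_left distrib_right)
      then have "cis (2 * pi * of_int j / P * (of_int (int k) * \<alpha>)) = cis (2 * pi * of_int (j mod int N) * real k / real N)"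
        by (simp only: cis_mult[symmetric]) (simp del: of_int_mult)
      then show "c j * d j * cis (2 * pi * of_int j / P * (of_int (int k) * \<alpha>))
          = c j * d j * cis (2 * pi * of_int (j mod int N) * real k / real N)" by simp
    qed
    also have "\<dots> = (\<Sum>r\<in>{0..<int N}. \<Sum>j\<in>cls r. c j * d j * cis (2 * pi * of_int (j mod int N) * real k / real N))"
      unfolding cls_def using J(1) maps by (intro sum.group[symmetric]) auto
    also have "\<dots> = (\<Sum>r\<in>{0..<int N}. b r * cis (2 * pi * of_int r * real k / real N))"
      unfolding b_def sum_distrib_right by (intro sum.cong refl) (auto simp: cls_def)
    finally show ?thesis .
  qed
  have b: "(cmod (b r))\<^sup>2 \<le> C * (\<Sum>j\<in>cls r. (cmod (c j))\<^sup>2)" for r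
  proof -
    have "(\<Sum>j\<in>cls r. (cmod (d j))\<^sup>2)
        = (\<Sum>m\<in>(\<lambda>j. j div int N) ` cls r. (cmod (fourier \<psi> (2 * pi * of_int r / P + 2 * pi * (of_int m / \<alpha>))))\<^sup>2)"
    proof (subst sum.reindex)
      show "inj_on (\<lambda>j. j div int N) (cls r)"
      proof (rule inj_onI)
        fix i j assume "i \<in> cls r" "j \<in> cls r" "i div int N = j div int N"
        then have "real_of_int i = real_of_int j" by (subst (1 2) split) (simp add: cls_def)
        then show "i = j" by simp
      qed
      show "(\<Sum>j\<in>cls r. (cmod (d j))\<^sup>2) = sum ((\<lambda>m. (cmod (fourier \<psi> (2 * pi * of_int r / P + 2 * pi * (of_int m / \<alpha>))))\<^sup>2)
          \<circ> (\<lambda>j. j div int N)) (cls r)"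
      proof (intro sum.cong refl)
        fix j assume "j \<in> cls r"
        then have "real_of_int j = of_int r + real N * of_int (j div int N)"
          using split[of j] by (simp add: cls_def)
        then have "2 * pi * of_int j / P = 2 * pi * of_int r / P + 2 * pi * (of_int (j div int N) / \<alpha>)"
          using N \<alpha> by (simp add: P_def field_simps)
        then show "(cmod (d j))\<^sup>2 = ((\<lambda>m. (cmod (fourier \<psi> (2 * pi * of_int r / P + 2 * pi * (of_int m / \<alpha>))))\<^sup>2)
          \<circ> (\<lambda>j. j div int N)) j" by (simp add: d_def)
      qed
    qed
    also have "\<dots> \<le> C" using C J(1) unfolding bessel_bound_def cls_def by auto
    finally have "(\<Sum>j\<in>cls r. (cmod (c j))\<^sup>2) * (\<Sum>j\<in>cls r. (cmod (d j))\<^sup>2) \<le> (\<Sum>j\<in>cls r. (cmod (c j))\<^sup>2) * C"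
      by (intro mult_left_mono sum_nonneg) auto
    then show ?thesis
      unfolding b_def using cmod_sum_mult_square_le[of c d "cls r"] by (simp add: mult.commute)
  qed
  have "integral {0..P} (\<lambda>t. (cmod (h t))\<^sup>2) = P * (\<Sum>j\<in>J. (cmod (c j))\<^sup>2)"
  proof -
    have "((\<lambda>t. (cmod (h t))\<^sup>2) has_integral P * (\<Sum>j\<in>J. (cmod (c j))\<^sup>2)) {0..0+P}"
      unfolding J(2)
    proof (rule parseval_exponentials[OF J(1) _ P])
      show "inj_on (\<lambda>j. 2 * pi * real_of_int j / P) J" using P by (auto simp: inj_on_def)
      fix i j
      have "(2 * pi * real_of_int i / P - 2 * pi * real_of_int j / P) * P = 2 * pi * of_int (i - j)"
        using P by (simp add: field_simps)
      then show "\<exists>m::int. (2 * pi * real_of_int i / P - 2 * pi * real_of_int j / P) * P = 2 * pi * of_int m" by blast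
    qed
    then show ?thesis by (simp add: integral_unique)
  qed
  then have norm_h: "(\<Sum>j\<in>J. (cmod (c j))\<^sup>2) = integral {0..P} (\<lambda>t. (cmod (h t))\<^sup>2) / P" using P by simp
  have "(\<Sum>k<N. (cmod (sampling_map \<alpha> \<psi> h (int k)))\<^sup>2) = real N * (\<Sum>r\<in>{0..<int N}. (cmod (b r))\<^sup>2)"
    unfolding S by (rule parseval_dft[OF N])
  also have "\<dots> \<le> real N * (\<Sum>r\<in>{0..<int N}. C * (\<Sum>j\<in>cls r. (cmod (c j))\<^sup>2))"
    by (intro mult_left_mono sum_mono b) auto
  also have "\<dots> = real N * (C * (\<Sum>j\<in>J. (cmod (c j))\<^sup>2))"
    unfolding cls_def sum_distrib_left[symmetric] by (subst sum.group[OF J(1) _ maps]) auto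
  also have "\<dots> = C / \<alpha> * integral {0..P} (\<lambda>t. (cmod (h t))\<^sup>2)"
    unfolding norm_h using N \<alpha> by (simp add: P_def)
  finally show ?thesis unfolding P_def .
qed

lemma lebesgue_shift:
  fixes g :: "real \<Rightarrow> real"
  assumes "integrable lebesgue g"
  shows "integrable lebesgue (\<lambda>t. g (t - x))" "(LINT t|lebesgue. g (t - x)) = (LINT t|lebesgue. g t)"
  using lebesgue_integrable_real_affine[of g 1 "-x"] lebesgue_integral_real_affine[of 1 g "-x"] assms by simp_all

definition tail :: "(real \<Rightarrow> complex) \<Rightarrow> real \<Rightarrow> real" where
  "tail \<psi> R = (LINT t|lebesgue. indicator {t. \<bar>t\<bar> \<ge> R} t * cmod (\<psi> t))"

lemma integrable_tail:
  assumes "\<psi> \<in> L1"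
  shows "integrable lebesgue (\<lambda>t. indicator {t. \<bar>t\<bar> \<ge> R} t * cmod (\<psi> t))"
proof (rule Bochner_Integration.integrable_bound)
  have [measurable]: "\<psi> \<in> borel_measurable lebesgue" using assms by (simp add: L1_def)
  have [measurable]: "{t::real. \<bar>t\<bar> \<ge> R} \<in> sets lebesgue" by (intro sets_completionI_sets) measurable
  show "integrable lebesgue (\<lambda>t. cmod (\<psi> t))" using assms by (simp add: L1_def)
  show "(\<lambda>t. indicator {t. \<bar>t\<bar> \<ge> R} t * cmod (\<psi> t)) \<in> borel_measurable lebesgue" by measurable
qed (auto simp: indicator_def)

lemma tail_tendsto_0:
  assumes \<psi>: "\<psi> \<in> L1" and \<alpha>: "\<alpha> > 0"
  shows "(\<lambda>n. tail \<psi> (real n * \<alpha>)) \<longlonglongrightarrow> 0"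
proof -
  have "(\<lambda>n. LINT t|lebesgue. indicator {t. \<bar>t\<bar> \<ge> real n * \<alpha>} t * cmod (\<psi> t)) \<longlonglongrightarrow> (LINT t|(lebesgue :: real measure). (0::real))"
  proof (rule Bochner_Integration.integral_dominated_convergence)
    show "integrable lebesgue (\<lambda>t. cmod (\<psi> t))" using \<psi> by (simp add: L1_def)
    show "(\<lambda>t. indicator {t. \<bar>t\<bar> \<ge> real n * \<alpha>} t * cmod (\<psi> t)) \<in> borel_measurable lebesgue" for n
      using integrable_tail[OF \<psi>] by auto
    show "AE t in lebesgue. (\<lambda>n. indicator {t. \<bar>t\<bar> \<ge> real n * \<alpha>} t * cmod (\<psi> t)) \<longlonglongrightarrow> 0"
    proof (rule AE_I2)
      fix t :: real
      have "\<forall>\<^sub>F n in sequentially. real n > \<bar>t\<bar> / \<alpha>"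
        using filterlim_real_sequentially by (rule filterlim_at_top_dense[THEN iffD1, rule_format])
      then have "\<forall>\<^sub>F n in sequentially. indicator {t. \<bar>t\<bar> \<ge> real n * \<alpha>} t * cmod (\<psi> t) = 0"
        by eventually_elim (use \<alpha> in \<open>auto simp: indicator_def field_simps\<close>)
      then show "(\<lambda>n. indicator {t. \<bar>t\<bar> \<ge> real n * \<alpha>} t * cmod (\<psi> t)) \<longlonglongrightarrow> 0"
        by (rule tendsto_eventually)
    qed
  qed (auto simp: indicator_def)
  then show ?thesis by (simp add: tail_def)
qed

text \<open>Multiplied by a cutoff that ramps to \<open>0\<close> over a length \<open>\<alpha>\<close> at each end, \<open>f\<close> becomes a function \<open>\<phi>\<close> on
  \<open>{0..N \<alpha>}\<close> with equal end values, hence a uniform limit of trigonometric polynomials \<open>h\<close> of that period.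
  The difference \<open>f - h\<close> is small on the middle part and bounded by about \<open>2 B\<close> elsewhere; a sample with
  index in \<open>{R+1..<N-R}\<close> sees the outer part only through values of \<open>\<psi>\<close> at distance at least \<open>R \<alpha>\<close>.\<close>

lemma sampling_window:
  assumes \<psi>: "\<psi> \<in> L1" and \<alpha>: "\<alpha> > 0" and C: "bessel_bound \<alpha> \<psi> C"
    and f: "continuous_on UNIV f" and B: "\<And>t. cmod (f t) \<le> B" and N: "N > 2 * R" and s: "s > 0"
  shows "(\<Sum>k=R+1..<N-R. (cmod (sampling_map \<alpha> \<psi> f (int k)))\<^sup>2)
      \<le> (1 + s)\<^sup>2 * (C / \<alpha>) * integral {0..real N * \<alpha>} (\<lambda>t. (cmod (f t))\<^sup>2)
        + (1 + 1 / s) * real N * (2 * B * tail \<psi> (real R * \<alpha>))\<^sup>2"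
proof -
  define P where "P = real N * \<alpha>"
  define I where "I = (LINT t|lebesgue. cmod (\<psi> t))"
  define A where "A = integral {0..P} (\<lambda>t. (cmod (f t))\<^sup>2)"
  define \<tau> where "\<tau> = tail \<psi> (real R * \<alpha>)"
  define cut where "cut t = max 0 (min 1 (min (t / \<alpha>) ((P - t) / \<alpha>)))" for t
  define \<phi> where "\<phi> t = of_real (cut t) * f t" for t
  have P: "P > 0" using N \<alpha> by (simp add: P_def)
  have B0: "B \<ge> 0" using order_trans[OF norm_ge_zero B] .
  have C0: "C \<ge> 0" using C unfolding bessel_bound_def by (metis finite.emptyI sum.empty)
  have I0: "I \<ge> 0" by (simp add: I_def)
  have cut: "0 \<le> cut t" "cut t \<le> 1" for t by (auto simp: cut_def)
  have cut1: "cut t = 1" if "\<alpha> \<le> t" "t \<le> P - \<alpha>" for t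
    using that \<alpha> by (simp add: cut_def min_def field_simps)
  have \<phi>_le: "cmod (\<phi> t) \<le> cmod (f t)" for t
    using cut[of t] by (simp add: \<phi>_def norm_mult mult_left_le_one_le)
  have cont_\<phi>: "continuous_on S \<phi>" for S
    unfolding \<phi>_def cut_def
    using \<alpha> by (intro continuous_intros continuous_on_subset[OF f]) auto
  have ends: "\<phi> 0 = \<phi> P" using \<alpha> P by (simp add: \<phi>_def cut_def)
  have f_meas: "f \<in> borel_measurable borel" using f by (rule borel_measurable_continuous_onI)
  have f_bdd: "bounded (range f)" unfolding bounded_iff using B by auto
  have N0: "N > 0" using N by simp
  have bound: "(\<Sum>k=R+1..<N-R. (cmod (sampling_map \<alpha> \<psi> f (int k)))\<^sup>2)
      \<le> (1 + s) * (C / \<alpha> * ((1 + s) * A + (1 + 1 / s) * (\<eta>\<^sup>2 * P))) + (1 + 1 / s) * (real N * (\<eta> * I + 2 * B * \<tau>)\<^sup>2)"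
    if \<eta>: "\<eta> > 0" for \<eta>
  proof -
    obtain h where h: "trig_poly P h" "\<And>t. t \<in> {0..P} \<Longrightarrow> cmod (\<phi> t - h t) < \<eta>"
      using trig_poly_approximation[OF P cont_\<phi> ends \<eta>] by blast
    \<comment> \<open>The approximation holds on one period, but periodicity bounds \<open>h\<close> on the whole line.\<close>
    have h_bound: "cmod (h t) \<le> B + \<eta>" for t
    proof -
      define u where "u = t + of_int (- \<lfloor>t / P\<rfloor>) * P"
      have fr: "0 \<le> t / P - of_int \<lfloor>t / P\<rfloor>" "t / P - of_int \<lfloor>t / P\<rfloor> \<le> 1" by linarith+
      have "u = (t / P - of_int \<lfloor>t / P\<rfloor>) * P" using P by (simp add: u_def left_diff_distrib)
      then have u: "u \<in> {0..P}"
        using mult_nonneg_nonneg[OF fr(1), of P] mult_right_mono[OF fr(2), of P] P by simp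
      have "h t = h u" unfolding u_def by (rule trig_poly_periodic[OF h(1) P, symmetric])
      moreover have "cmod (h u) \<le> B + \<eta>"
      proof -
        have "cmod (h u - \<phi> u) < \<eta>" using h(2)[OF u] by (simp only: norm_minus_commute)
        then show ?thesis using norm_triangle_sub[of "h u" "\<phi> u"] \<phi>_le[of u] B[of u] by linarith
      qed
      ultimately show ?thesis by simp
    qed
    have h_meas: "h \<in> borel_measurable borel"
      using trig_poly_continuous[OF h(1)] by (rule borel_measurable_continuous_onI)
    have h_bdd: "bounded (range h)" unfolding bounded_iff using h_bound by auto
    have near: "cmod (sampling_map \<alpha> \<psi> f (int k) - sampling_map \<alpha> \<psi> h (int k)) \<le> \<eta> * I + 2 * B * \<tau>"
      if k: "k \<in> {R+1..<N-R}" for k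
    proof -
      let ?x = "real k * \<alpha>"
      have pt: "cmod ((f t - h t) * cnj (\<psi> (t - ?x)))
          \<le> \<eta> * cmod (\<psi> (t - ?x)) + 2 * B * (indicator {t. \<bar>t\<bar> \<ge> real R * \<alpha>} (t - ?x) * cmod (\<psi> (t - ?x)))" for t
      proof -
        have "cmod (f t - h t) \<le> \<eta> + 2 * B * indicator {t. \<bar>t\<bar> \<ge> real R * \<alpha>} (t - ?x)"
        proof (cases "\<alpha> \<le> t \<and> t \<le> P - \<alpha>")
          case True
          then have "\<phi> t = f t" "t \<in> {0..P}" using cut1 \<alpha> by (auto simp: \<phi>_def)
          then have "cmod (f t - h t) < \<eta>" using h(2)[of t] by simp
          moreover have "0 \<le> 2 * B * indicat_real {t. \<bar>t\<bar> \<ge> real R * \<alpha>} (t - ?x)" using B0 by simp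
          ultimately show ?thesis by linarith
        next
          case False
          \<comment> \<open>The ramps have length \<open>\<alpha>\<close>, whence the shift by one in the admissible indices.\<close>
          have "real (R + 1) * \<alpha> \<le> real k * \<alpha>" "real (k + R + 1) * \<alpha> \<le> real N * \<alpha>"
          proof -
            have "R + 1 \<le> k" "k + R + 1 \<le> N" using k by auto
            then show "real (R + 1) * \<alpha> \<le> real k * \<alpha>" "real (k + R + 1) * \<alpha> \<le> real N * \<alpha>"
              using \<alpha> by (intro mult_right_mono; simp)+
          qed
          then have "\<alpha> \<le> ?x - real R * \<alpha>" "?x + real R * \<alpha> \<le> P - \<alpha>"
            by (simp_all add: P_def distrib_right)
          then have "\<bar>t - ?x\<bar> \<ge> real R * \<alpha>" using False by linarith
          moreover have "cmod (f t - h t) \<le> 2 * B + \<eta>"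
            using norm_triangle_ineq4[of "f t" "h t"] B[of t] h_bound[of t] by linarith
          ultimately show ?thesis by simp
        qed
        from mult_right_mono[OF this norm_ge_zero, of "\<psi> (t - ?x)"] show ?thesis
          by (simp only: norm_mult complex_mod_cnj distrib_right mult.assoc)
      qed
      have i1: "integrable lebesgue (\<lambda>t. cmod (\<psi> (t - ?x)))"
        by (rule integrable_norm[OF L1_translate(1)[OF \<psi>]])
      have i2: "integrable lebesgue (\<lambda>t. indicator {t. \<bar>t\<bar> \<ge> real R * \<alpha>} (t - ?x) * cmod (\<psi> (t - ?x)))"
        by (rule lebesgue_shift(1)[OF integrable_tail[OF \<psi>]])
      have e2: "(LINT t|lebesgue. indicator {t. \<bar>t\<bar> \<ge> real R * \<alpha>} (t - ?x) * cmod (\<psi> (t - ?x))) = \<tau>"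
        unfolding \<tau>_def tail_def by (rule lebesgue_shift(2)[OF integrable_tail[OF \<psi>]])
      define D where "D t = (f t - h t) * cnj (\<psi> (t - ?x))" for t
      define M where "M t = \<eta> * cmod (\<psi> (t - ?x))
          + 2 * B * (indicator {t. \<bar>t\<bar> \<ge> real R * \<alpha>} (t - ?x) * cmod (\<psi> (t - ?x)))" for t
      have "sampling_map \<alpha> \<psi> f (int k) - sampling_map \<alpha> \<psi> h (int k) = sampling_map \<alpha> \<psi> (\<lambda>t. f t - h t) (int k)"
        by (rule sampling_map_diff[OF \<psi> f_meas f_bdd h_meas h_bdd, symmetric])
      then have eq: "sampling_map \<alpha> \<psi> f (int k) - sampling_map \<alpha> \<psi> h (int k) = (LINT t|lebesgue. D t)"
        by (simp only: sampling_map_eq of_int_of_nat_eq D_def)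
      have "cmod (LINT t|lebesgue. D t) \<le> (LINT t|lebesgue. M t)"
      proof (rule Bochner_Integration.integral_norm_bound_integral)
        show "integrable lebesgue D"
          unfolding D_def
          by (rule sampling_integrable[OF \<psi> borel_measurable_diff[OF f_meas h_meas] bounded_minus_comp[OF f_bdd h_bdd]])
        show "integrable lebesgue M"
          unfolding M_def
          by (rule Bochner_Integration.integrable_add[OF integrable_mult_right[OF i1] integrable_mult_right[OF i2]])
        show "cmod (D t) \<le> M t" for t unfolding D_def M_def by (rule pt)
      qed
      moreover have "(LINT t|lebesgue. M t) = \<eta> * I + 2 * B * \<tau>"
        unfolding M_def Bochner_Integration.integral_add[OF integrable_mult_right[OF i1] integrable_mult_right[OF i2]]
        by (simp only: integral_mult_right_zero e2 L1_translate(2)[OF \<psi>] I_def)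
      ultimately show ?thesis unfolding eq by (rule ord_le_eq_trans)
    qed
    have 1: "(cmod (sampling_map \<alpha> \<psi> f (int k)))\<^sup>2 \<le> (1 + s) * (cmod (sampling_map \<alpha> \<psi> h (int k)))\<^sup>2
        + (1 + 1 / s) * (\<eta> * I + 2 * B * \<tau>)\<^sup>2" if k: "k \<in> {R+1..<N-R}" for k
    proof -
      have "(cmod (sampling_map \<alpha> \<psi> f (int k)))\<^sup>2 \<le> (1 + s) * (cmod (sampling_map \<alpha> \<psi> h (int k)))\<^sup>2
        + (1 + 1 / s) * (cmod (sampling_map \<alpha> \<psi> f (int k) - sampling_map \<alpha> \<psi> h (int k)))\<^sup>2"
        using norm_add_square_le[OF s, of "sampling_map \<alpha> \<psi> h (int k)"
            "sampling_map \<alpha> \<psi> f (int k) - sampling_map \<alpha> \<psi> h (int k)"] by simp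
      also have "\<dots> \<le> (1 + s) * (cmod (sampling_map \<alpha> \<psi> h (int k)))\<^sup>2 + (1 + 1 / s) * (\<eta> * I + 2 * B * \<tau>)\<^sup>2"
        using near[OF k] s by (intro add_left_mono mult_left_mono power_mono) auto
      finally show ?thesis .
    qed
    have "(\<Sum>k=R+1..<N-R. (cmod (sampling_map \<alpha> \<psi> f (int k)))\<^sup>2)
        \<le> (\<Sum>k=R+1..<N-R. (1 + s) * (cmod (sampling_map \<alpha> \<psi> h (int k)))\<^sup>2 + (1 + 1 / s) * (\<eta> * I + 2 * B * \<tau>)\<^sup>2)"
      by (intro sum_mono 1)
    also have "\<dots> \<le> (\<Sum>k<N. (1 + s) * (cmod (sampling_map \<alpha> \<psi> h (int k)))\<^sup>2 + (1 + 1 / s) * (\<eta> * I + 2 * B * \<tau>)\<^sup>2)"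
      using s by (intro sum_mono2) auto
    also have "\<dots> = (1 + s) * (\<Sum>k<N. (cmod (sampling_map \<alpha> \<psi> h (int k)))\<^sup>2) + (1 + 1 / s) * (real N * (\<eta> * I + 2 * B * \<tau>)\<^sup>2)"
      by (simp add: sum.distrib sum_distrib_left mult.left_commute)
    finally have 2: "(\<Sum>k=R+1..<N-R. (cmod (sampling_map \<alpha> \<psi> f (int k)))\<^sup>2)
        \<le> (1 + s) * (\<Sum>k<N. (cmod (sampling_map \<alpha> \<psi> h (int k)))\<^sup>2) + (1 + 1 / s) * (real N * (\<eta> * I + 2 * B * \<tau>)\<^sup>2)" .
    have 3: "(\<Sum>k<N. (cmod (sampling_map \<alpha> \<psi> h (int k)))\<^sup>2) \<le> C / \<alpha> * integral {0..P} (\<lambda>t. (cmod (h t))\<^sup>2)"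
      using sampling_trig_poly[OF \<psi> \<alpha> C N0] h(1) unfolding P_def .
    have "integral {0..P} (\<lambda>t. (cmod (h t))\<^sup>2) \<le> integral {0..P} (\<lambda>t. (1 + s) * (cmod (f t))\<^sup>2 + (1 + 1 / s) * \<eta>\<^sup>2)"
    proof (rule integral_le)
      show "(\<lambda>t. (cmod (h t))\<^sup>2) integrable_on {0..P}"
        using trig_poly_continuous[OF h(1)] by (intro integrable_continuous_interval continuous_intros)
      show "(\<lambda>t. (1 + s) * (cmod (f t))\<^sup>2 + (1 + 1 / s) * \<eta>\<^sup>2) integrable_on {0..P}"
        by (intro integrable_continuous_interval continuous_intros continuous_on_subset[OF f]) auto
      fix t assume t: "t \<in> {0..P}"
      have "(cmod (h t))\<^sup>2 \<le> (1 + s) * (cmod (\<phi> t))\<^sup>2 + (1 + 1 / s) * (cmod (h t - \<phi> t))\<^sup>2"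
        using norm_add_square_le[OF s, of "\<phi> t" "h t - \<phi> t"] by simp
      also have "\<dots> \<le> (1 + s) * (cmod (f t))\<^sup>2 + (1 + 1 / s) * \<eta>\<^sup>2"
        using h(2)[OF t] \<phi>_le[of t] s
        by (intro add_mono mult_left_mono power_mono) (auto simp: norm_minus_commute)
      finally show "(cmod (h t))\<^sup>2 \<le> (1 + s) * (cmod (f t))\<^sup>2 + (1 + 1 / s) * \<eta>\<^sup>2" .
    qed
    also have "integral {0..P} (\<lambda>t. (1 + s) * (cmod (f t))\<^sup>2 + (1 + 1 / s) * \<eta>\<^sup>2) = (1 + s) * A + (1 + 1 / s) * (\<eta>\<^sup>2 * P)"
    proof -
      have "(\<lambda>t. (cmod (f t))\<^sup>2) integrable_on {0..P}"
        by (intro integrable_continuous_interval continuous_intros continuous_on_subset[OF f]) auto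
      then show ?thesis using P
        by (subst integral_add) (auto simp: A_def intro: integrable_on_mult_right)
    qed
    finally have "C / \<alpha> * integral {0..P} (\<lambda>t. (cmod (h t))\<^sup>2) \<le> C / \<alpha> * ((1 + s) * A + (1 + 1 / s) * (\<eta>\<^sup>2 * P))"
      using C0 \<alpha> by (intro mult_left_mono) auto
    then have "(1 + s) * (\<Sum>k<N. (cmod (sampling_map \<alpha> \<psi> h (int k)))\<^sup>2)
        \<le> (1 + s) * (C / \<alpha> * ((1 + s) * A + (1 + 1 / s) * (\<eta>\<^sup>2 * P)))"
      using 3 s by (intro mult_left_mono) auto
    then show ?thesis using 2 by linarith
  qed
  \<comment> \<open>The left-hand side does not depend on the accuracy \<open>\<eta>\<close> of the approximation.\<close>
  define G where "G \<eta> = (1 + s) * (C / \<alpha> * ((1 + s) * A + (1 + 1 / s) * (\<eta>\<^sup>2 * P)))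
      + (1 + 1 / s) * (real N * (\<eta> * I + 2 * B * \<tau>)\<^sup>2)" for \<eta>
  have "isCont G 0" unfolding G_def by (intro continuous_intros)
  then have lim: "(G \<longlongrightarrow> G 0) (at_right 0)" by (simp add: continuous_at_imp_continuous_at_within flip: continuous_within)
  have "(\<Sum>k=R+1..<N-R. (cmod (sampling_map \<alpha> \<psi> f (int k)))\<^sup>2) \<le> G 0"
  proof (rule tendsto_lowerbound[OF lim])
    show "\<forall>\<^sub>F \<eta> in at_right 0. (\<Sum>k=R+1..<N-R. (cmod (sampling_map \<alpha> \<psi> f (int k)))\<^sup>2) \<le> G \<eta>"
      using eventually_at_right_less[of 0]
    proof eventually_elim
      case (elim \<eta>)
      then show ?case unfolding G_def by (rule bound)
    qed
  qed simp
  also have "G 0 = (1 + s)\<^sup>2 * (C / \<alpha>) * A + (1 + 1 / s) * real N * (2 * B * \<tau>)\<^sup>2"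
    by (simp add: G_def power2_eq_square)
  finally show ?thesis unfolding A_def P_def \<tau>_def .
qed

text \<open>For a fixed margin \<open>R\<close>, windows of radius \<open>(p + R + 1) \<alpha>\<close> compare the samples with index in \<open>{-p..p}\<close> to
  the integral of \<open>\<bar>f\<bar>\<^sup>2\<close>.  The limits are taken in the order \<open>p\<close> to infinity, where the margin disappears
  in the averages, then \<open>R\<close> to infinity, which removes the tail of \<open>\<psi>\<close>, and finally \<open>s\<close> to \<open>0\<close>.\<close>

lemma AP_Z_norm_sampling_le:
  assumes \<psi>: "\<psi> \<in> L1" and \<alpha>: "\<alpha> > 0" and C: "bessel_bound \<alpha> \<psi> C" and f: "f \<in> AP_R"
  shows "(AP_Z_norm (sampling_map \<alpha> \<psi> f))\<^sup>2 \<le> C * (AP_R_norm f)\<^sup>2"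
proof -
  obtain B where B: "\<And>t. cmod (f t) \<le> B" using AP_R_bounded[OF f] unfolding bounded_iff by auto
  have cont: "continuous_on UNIV f" using f by (simp add: AP_R_iff_bohr)
  define Z where "Z = (AP_Z_norm (sampling_map \<alpha> \<psi> f))\<^sup>2"
  define M where "M = (AP_R_norm f)\<^sup>2"
  have window: "(\<Sum>n = - int p..int p. (cmod (sampling_map \<alpha> \<psi> f n))\<^sup>2)
      \<le> (1 + s)\<^sup>2 * (C / \<alpha>) * integral {-(real (p + R + 1) * \<alpha>)..real (p + R + 1) * \<alpha>} (\<lambda>t. (cmod (f t))\<^sup>2)
        + (1 + 1 / s) * real (2 * (p + R + 1)) * (2 * B * tail \<psi> (real R * \<alpha>))\<^sup>2" if s: "s > 0" for s p R
  proof -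
    define m where "m = p + R + 1"
    define g where "g t = f (t + of_int (- int m) * \<alpha>)" for t
    have "continuous_on UNIV g"
      unfolding g_def by (intro continuous_on_compose2[OF cont] continuous_intros) auto
    moreover have "cmod (g t) \<le> B" for t unfolding g_def by (rule B)
    ultimately have "(\<Sum>k=R+1..<2 * m - R. (cmod (sampling_map \<alpha> \<psi> g (int k)))\<^sup>2)
      \<le> (1 + s)\<^sup>2 * (C / \<alpha>) * integral {0..real (2 * m) * \<alpha>} (\<lambda>t. (cmod (g t))\<^sup>2)
        + (1 + 1 / s) * real (2 * m) * (2 * B * tail \<psi> (real R * \<alpha>))\<^sup>2"
      by (intro sampling_window \<psi> \<alpha> C s) (simp_all add: m_def)
    moreover have "(\<Sum>k=R+1..<2 * m - R. (cmod (sampling_map \<alpha> \<psi> g (int k)))\<^sup>2)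
        = (\<Sum>n = - int p..int p. (cmod (sampling_map \<alpha> \<psi> f n))\<^sup>2)"
      unfolding g_def sampling_map_shift
      by (rule sum.reindex_bij_witness[of _ "\<lambda>n. nat (n + int m)" "\<lambda>k. int k - int m"]) (auto simp: m_def algebra_simps)
    moreover have "integral {0..real (2 * m) * \<alpha>} (\<lambda>t. (cmod (g t))\<^sup>2)
        = integral {-(real m * \<alpha>)..real m * \<alpha>} (\<lambda>t. (cmod (f t))\<^sup>2)"
      using integral_shift_real_ivl[of "-(real m * \<alpha>)" "-(real m * \<alpha>)" "real m * \<alpha>" "\<lambda>t. (cmod (f t))\<^sup>2"]
      by (simp add: g_def algebra_simps)
    ultimately show ?thesis by (simp only: m_def)
  qed
  have step: "Z \<le> (1 + s)\<^sup>2 * C * M + (1 + 1 / s) * (2 * B * tail \<psi> (real R * \<alpha>))\<^sup>2" if s: "s > 0" for s R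
  proof (rule tendsto_le)
    show "(\<lambda>p. 1 / (2 * real p) * (\<Sum>n = - int p..int p. (cmod (sampling_map \<alpha> \<psi> f n))\<^sup>2)) \<longlonglongrightarrow> Z"
      unfolding Z_def by (rule AP_Z_means(2)[OF sampling_map_in_AP_Z[OF \<psi> f \<alpha>]])
    define ratio where "ratio p = real (p + R + 1) / real p" for p
    define avg where "avg p = 1 / (2 * (real (p + R + 1) * \<alpha>)) *
        integral {-(real (p + R + 1) * \<alpha>)..real (p + R + 1) * \<alpha>} (\<lambda>t. (cmod (f t))\<^sup>2)" for p
    have ratio: "ratio \<longlonglongrightarrow> 1" unfolding ratio_def by real_asymp
    have "filterlim (\<lambda>p. real (p + R + 1) * \<alpha>) at_top sequentially" using \<alpha> by real_asymp
    from filterlim_compose[OF AP_R_square_mean[OF f, unfolded has_mean_def] this]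
    have avg: "avg \<longlonglongrightarrow> M" by (simp only: avg_def[abs_def] M_def)
    have "(\<lambda>p. ratio p * ((1 + s)\<^sup>2 * C * avg p + (1 + 1 / s) * (2 * B * tail \<psi> (real R * \<alpha>))\<^sup>2))
        \<longlonglongrightarrow> 1 * ((1 + s)\<^sup>2 * C * M + (1 + 1 / s) * (2 * B * tail \<psi> (real R * \<alpha>))\<^sup>2)"
      by (intro tendsto_intros ratio avg)
    then show "(\<lambda>p. ratio p * ((1 + s)\<^sup>2 * C * avg p + (1 + 1 / s) * (2 * B * tail \<psi> (real R * \<alpha>))\<^sup>2))
        \<longlonglongrightarrow> (1 + s)\<^sup>2 * C * M + (1 + 1 / s) * (2 * B * tail \<psi> (real R * \<alpha>))\<^sup>2" by simp
    show "\<forall>\<^sub>F p in sequentially. 1 / (2 * real p) * (\<Sum>n = - int p..int p. (cmod (sampling_map \<alpha> \<psi> f n))\<^sup>2)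
        \<le> ratio p * ((1 + s)\<^sup>2 * C * avg p + (1 + 1 / s) * (2 * B * tail \<psi> (real R * \<alpha>))\<^sup>2)"
      using eventually_gt_at_top[of 0]
    proof eventually_elim
      case (elim p)
      define m where "m = real (p + R + 1)"
      define J where "J = integral {-(m * \<alpha>)..m * \<alpha>} (\<lambda>t. (cmod (f t))\<^sup>2)"
      define E where "E = (2 * B * tail \<psi> (real R * \<alpha>))\<^sup>2"
      have m: "m > 0" by (simp add: m_def)
      have "1 / (2 * real p) * (\<Sum>n = - int p..int p. (cmod (sampling_map \<alpha> \<psi> f n))\<^sup>2)
          \<le> 1 / (2 * real p) * ((1 + s)\<^sup>2 * (C / \<alpha>) * J + (1 + 1 / s) * (2 * m) * E)"
        using window[OF s, of p R] by (intro mult_left_mono) (simp_all add: m_def J_def E_def)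
      also have "\<dots> = m / real p * ((1 + s)\<^sup>2 * C * (1 / (2 * (m * \<alpha>)) * J) + (1 + 1 / s) * E)"
      proof -
        have "1 / (2 * real p) * ((1 + s)\<^sup>2 * (C / \<alpha>) * J) = m / real p * ((1 + s)\<^sup>2 * C * (1 / (2 * (m * \<alpha>)) * J))"
          using m by simp
        then show ?thesis unfolding distrib_left by simp
      qed
      finally show ?case unfolding ratio_def avg_def m_def J_def E_def .
    qed
  qed simp
  have "Z \<le> (1 + s)\<^sup>2 * C * M" if s: "s > 0" for s
  proof -
    have "(\<lambda>R. (1 + s)\<^sup>2 * C * M + (1 + 1 / s) * (2 * B * tail \<psi> (real R * \<alpha>))\<^sup>2)
        \<longlonglongrightarrow> (1 + s)\<^sup>2 * C * M + (1 + 1 / s) * (2 * B * 0)\<^sup>2"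
      by (intro tendsto_intros tail_tendsto_0 \<psi> \<alpha>)
    then have "Z \<le> (1 + s)\<^sup>2 * C * M + (1 + 1 / s) * (2 * B * 0)\<^sup>2"
      by (rule tendsto_lowerbound) (use step[OF s] in auto)
    then show ?thesis by simp
  qed
  note le = this
  define G where "G s = (1 + s)\<^sup>2 * C * M" for s
  have "isCont G 0" unfolding G_def by (intro continuous_intros)
  then have lim: "(G \<longlongrightarrow> G 0) (at_right 0)" by (simp add: continuous_at_imp_continuous_at_within flip: continuous_within)
  have "Z \<le> G 0"
  proof (rule tendsto_lowerbound[OF lim])
    show "\<forall>\<^sub>F s in at_right 0. Z \<le> G s"
      using eventually_at_right_less[of 0]
    proof eventually_elim
      case (elim s)
      then show ?case unfolding G_def by (rule le)
    qed
  qed simp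
  then show ?thesis by (simp add: Z_def M_def G_def)
qed

section \<open>The lower bound\<close>

text \<open>The interval \<open>{-(n P)..n P}\<close> has the length of \<open>2 n\<close> periods of \<open>\<bar>f\<bar>\<^sup>2\<close>, so the average over it is already the
  limit.\<close>

lemma AP_R_norm_exponentials:
  fixes w :: "'i \<Rightarrow> real"
  assumes fin: "finite A" and inj: "inj_on w A" and P: "P > 0"
    and w: "\<And>x y. x \<in> A \<Longrightarrow> y \<in> A \<Longrightarrow> \<exists>m::int. (w x - w y) * P = 2 * pi * of_int m"
  shows "(AP_R_norm (\<lambda>t. \<Sum>x\<in>A. c x * cis (w x * t)))\<^sup>2 = (\<Sum>x\<in>A. (cmod (c x))\<^sup>2)"
proof -
  define f where "f t = (\<Sum>x\<in>A. c x * cis (w x * t))" for t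
  define q where "q = (\<Sum>x\<in>A. (cmod (c x))\<^sup>2)"
  have f: "f \<in> AP_R" unfolding f_def using fin by (intro AP_R_sum AP_R_cmult AP_R_cis)
  have "filterlim (\<lambda>n. real n * P) at_top sequentially" using P by real_asymp
  from filterlim_compose[OF AP_R_square_mean[OF f, unfolded has_mean_def] this]
  have lim: "(\<lambda>n. 1 / (2 * (real n * P)) * integral {-(real n * P)..real n * P} (\<lambda>t. (cmod (f t))\<^sup>2)) \<longlonglongrightarrow> (AP_R_norm f)\<^sup>2" .
  have "1 / (2 * (real n * P)) * integral {-(real n * P)..real n * P} (\<lambda>t. (cmod (f t))\<^sup>2) = q" if n: "n > 0" for n
  proof -
    have "((\<lambda>t. (cmod (f t))\<^sup>2) has_integral (2 * real n * P) * q) {-(real n * P)..-(real n * P) + 2 * real n * P}"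
      unfolding f_def q_def
    proof (rule parseval_exponentials[OF fin inj])
      fix x y assume "x \<in> A" "y \<in> A"
      then obtain m :: int where "(w x - w y) * P = 2 * pi * of_int m" using w by blast
      moreover have "(w x - w y) * (2 * real n * P) = 2 * real n * ((w x - w y) * P)" by simp
      ultimately have "(w x - w y) * (2 * real n * P) = 2 * pi * of_int (2 * int n * m)" by simp
      then show "\<exists>m::int. (w x - w y) * (2 * real n * P) = 2 * pi * of_int m" by blast
    qed (use n P in simp)
    moreover have "-(real n * P) + 2 * real n * P = real n * P" by simp
    ultimately have "integral {-(real n * P)..real n * P} (\<lambda>t. (cmod (f t))\<^sup>2) = (2 * real n * P) * q"
      by (simp only: integral_unique)
    then show ?thesis using n P by simp
  qed
  then have "\<forall>\<^sub>F n in sequentially. 1 / (2 * (real n * P)) * integral {-(real n * P)..real n * P} (\<lambda>t. (cmod (f t))\<^sup>2) = q"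
    by (intro eventually_mono[OF eventually_gt_at_top[of 0]])
  then have "(\<lambda>n. 1 / (2 * (real n * P)) * integral {-(real n * P)..real n * P} (\<lambda>t. (cmod (f t))\<^sup>2)) \<longlonglongrightarrow> q"
    by (rule tendsto_eventually)
  then show ?thesis using LIMSEQ_unique[OF lim] unfolding f_def q_def by blast
qed

text \<open>Test functions: with \<open>\<psi>\<close>'s own Fourier coefficients along one coset of \<open>(2 * pi / \<alpha>) * \<int>\<close>,
  the samples are a character times the sum of squares \<open>A\<close>, while the norm is only \<open>sqrt A\<close>.\<close>

lemma bessel_bound_if_bounded:
  assumes \<psi>: "\<psi> \<in> L1" and \<alpha>: "\<alpha> > 0" and \<delta>: "\<delta> > 0"
    and bdd: "\<And>f. f \<in> AP_R \<Longrightarrow> AP_R_norm f < \<delta> \<Longrightarrow> AP_Z_norm (sampling_map \<alpha> \<psi> f) < 1"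
  shows "bessel_bound \<alpha> \<psi> (4 / \<delta>\<^sup>2)"
  unfolding bessel_bound_def
proof (intro allI impI)
  fix \<omega> :: real and F :: "int set" assume F: "finite F"
  define w where "w k = \<omega> + 2 * pi * (of_int k / \<alpha>)" for k :: int
  define A where "A = (\<Sum>k\<in>F. (cmod (fourier \<psi> (w k)))\<^sup>2)"
  have "A \<le> 4 / \<delta>\<^sup>2"
  proof (cases "A > 0")
    case True
    \<comment> \<open>The factor scales the norm of the test function to \<open>\<delta> / 2\<close>.\<close>
    define c where "c = \<delta> / (2 * sqrt A)"
    have c: "c > 0" using True \<delta> by (simp add: c_def)
    define f where "f t = (\<Sum>k\<in>F. of_real c * fourier \<psi> (w k) * cis (w k * t))" for t
    have f: "f \<in> AP_R" unfolding f_def using F by (intro AP_R_sum AP_R_cmult AP_R_cis)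
    have inj: "inj_on w F" using \<alpha> by (auto simp: inj_on_def w_def)
    have diff: "\<exists>m::int. (w k - w l) * \<alpha> = 2 * pi * of_int m" for k l
      by (rule exI[of _ "k - l"]) (use \<alpha> in \<open>simp add: w_def field_simps\<close>)
    have "(AP_R_norm f)\<^sup>2 = (\<Sum>k\<in>F. (cmod (of_real c * fourier \<psi> (w k)))\<^sup>2)"
      unfolding f_def by (rule AP_R_norm_exponentials[OF F inj \<alpha> diff])
    also have "\<dots> = c\<^sup>2 * A" by (simp add: A_def norm_mult power_mult_distrib sum_distrib_left)
    also have "c\<^sup>2 = (\<delta> / 2)\<^sup>2 / A" using True by (simp add: c_def power_divide power_mult_distrib)
    also have "(\<delta> / 2)\<^sup>2 / A * A = (\<delta> / 2)\<^sup>2" using True by simp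
    finally have "AP_R_norm f = \<delta> / 2"
      by (rule power2_eq_imp_eq) (use \<delta> AP_R_norm_nonneg in simp_all)
    then have less: "AP_Z_norm (sampling_map \<alpha> \<psi> f) < 1" using \<delta> by (intro bdd f) simp
    have S: "sampling_map \<alpha> \<psi> f n = of_real (c * A) * cis (\<omega> * (of_int n * \<alpha>))" for n
    proof -
      have "cis (w k * (of_int n * \<alpha>)) = cis (\<omega> * (of_int n * \<alpha>))" for k
      proof -
        have "w k * (of_int n * \<alpha>) = \<omega> * (of_int n * \<alpha>) + 2 * pi * of_int (k * n)"
          using \<alpha> by (simp add: w_def field_simps)
        then show ?thesis by (simp only: cis_mult[symmetric]) (simp del: of_int_mult)
      qed
      then have "sampling_map \<alpha> \<psi> f n
          = (\<Sum>k\<in>F. of_real c * fourier \<psi> (w k) * cnj (fourier \<psi> (w k)) * cis (\<omega> * (of_int n * \<alpha>)))"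
        unfolding f_def by (simp only: sampling_map_exponentials[OF \<psi> F])
      also have "\<dots> = of_real c * (\<Sum>k\<in>F. fourier \<psi> (w k) * cnj (fourier \<psi> (w k))) * cis (\<omega> * (of_int n * \<alpha>))"
        by (simp add: sum_distrib_left sum_distrib_right mult_ac)
      also have "(\<Sum>k\<in>F. fourier \<psi> (w k) * cnj (fourier \<psi> (w k))) = of_real A"
        unfolding A_def of_real_sum by (simp only: complex_norm_square)
      finally show ?thesis by simp
    qed
    have "(AP_Z_norm (sampling_map \<alpha> \<psi> f))\<^sup>2 = (c * A)\<^sup>2"
    proof (rule LIMSEQ_unique[OF AP_Z_means(2)[OF sampling_map_in_AP_Z[OF \<psi> f \<alpha>]]])
      have "(cmod (sampling_map \<alpha> \<psi> f n))\<^sup>2 = (c * A)\<^sup>2" for n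
        by (simp add: S norm_mult power_mult_distrib)
      then have eq: "1 / (2 * real p) * (\<Sum>n = - int p..int p. (cmod (sampling_map \<alpha> \<psi> f n))\<^sup>2)
          = real (2 * p + 1) / (2 * real p) * (c * A)\<^sup>2" for p by simp
      have "(\<lambda>p. real (2 * p + 1) / (2 * real p)) \<longlonglongrightarrow> 1" by real_asymp
      from tendsto_mult_right[OF this, of "(c * A)\<^sup>2"]
      show "(\<lambda>p. 1 / (2 * real p) * (\<Sum>n = - int p..int p. (cmod (sampling_map \<alpha> \<psi> f n))\<^sup>2)) \<longlonglongrightarrow> (c * A)\<^sup>2"
        unfolding eq by simp
    qed
    then have "AP_Z_norm (sampling_map \<alpha> \<psi> f) = c * A"
      by (rule power2_eq_imp_eq) (use c True AP_Z_norm_nonneg in simp_all)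
    also have "c * A = \<delta> / 2 * (A / sqrt A)" by (simp add: c_def)
    also have "A / sqrt A = sqrt A" using True by (simp add: real_div_sqrt)
    finally have "sqrt A * \<delta> \<le> 2" using less by (simp add: mult.commute)
    then have "sqrt A \<le> 2 / \<delta>" using \<delta> by (simp add: pos_le_divide_eq)
    then have "(sqrt A)\<^sup>2 \<le> (2 / \<delta>)\<^sup>2" using True by (intro power_mono) auto
    then show ?thesis using True by (simp add: power_divide)
  next
    case False
    moreover have "0 \<le> 4 / \<delta>\<^sup>2" by simp
    ultimately show ?thesis by linarith
  qed
  then show "(\<Sum>k\<in>F. (cmod (fourier \<psi> (\<omega> + 2 * pi * (of_int k / \<alpha>))))\<^sup>2) \<le> 4 / \<delta>\<^sup>2"
    by (simp add: A_def w_def)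
qed

theorem continuous_map_sampling_iff:
  assumes \<psi>: "\<psi> \<in> L1" and \<alpha>: "\<alpha> > 0"
  shows "continuous_map AP_R_topology AP_Z_topology (sampling_map \<alpha> \<psi>) \<longleftrightarrow> (\<exists>C. bessel_bound \<alpha> \<psi> C)"
proof -
  interpret R: Metric_space AP_R "\<lambda>f g. AP_R_norm (\<lambda>t. f t - g t)" by (rule Metric_space_AP_R)
  let ?S = "sampling_map \<alpha> \<psi>"
  have cont_iff: "continuous_map AP_R_topology AP_Z_topology ?S \<longleftrightarrow>
      ?S ` AP_R \<subseteq> AP_Z \<and> (\<forall>f\<in>AP_R. \<forall>\<epsilon>>0. \<exists>\<delta>>0. \<forall>g. g \<in> AP_R \<and> AP_R_norm (\<lambda>t. f t - g t) < \<delta> \<longrightarrow>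
        AP_Z_norm (\<lambda>n. ?S f n - ?S g n) < \<epsilon>)"
    unfolding AP_R_topology_def AP_Z_topology_def by (rule R.metric_continuous_map[OF Metric_space_AP_Z])
  have diff: "(\<lambda>n. ?S f n - ?S g n) = ?S (\<lambda>t. f t - g t)" if "f \<in> AP_R" "g \<in> AP_R" for f g
    using sampling_map_diff[OF \<psi>] AP_R_bohr_regular that by (fastforce simp: bohr_regular_def)
  show ?thesis
  proof
    assume "continuous_map AP_R_topology AP_Z_topology ?S"
    then obtain \<delta> where \<delta>: "\<delta> > 0" "\<And>g. g \<in> AP_R \<Longrightarrow> AP_R_norm (\<lambda>t. 0 - g t) < \<delta> \<Longrightarrow>
        AP_Z_norm (\<lambda>n. ?S (\<lambda>t. 0) n - ?S g n) < 1"
      unfolding cont_iff using AP_R_const[of 0] zero_less_one by meson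
    have "AP_Z_norm (?S f) < 1" if f: "f \<in> AP_R" "AP_R_norm f < \<delta>" for f
    proof -
      have g: "(\<lambda>t. 0 - f t) \<in> AP_R" using AP_R_diff[OF AP_R_const[of 0] f(1)] .
      have "AP_Z_norm (\<lambda>n. ?S (\<lambda>t. 0) n - ?S (\<lambda>t. 0 - f t) n) < 1" using f(2) by (intro \<delta>(2) g) simp
      then show ?thesis unfolding diff[OF AP_R_const g] by simp
    qed
    then show "\<exists>C. bessel_bound \<alpha> \<psi> C" using bessel_bound_if_bounded[OF \<psi> \<alpha> \<delta>(1)] by blast
  next
    assume "\<exists>C. bessel_bound \<alpha> \<psi> C"
    then obtain C where C: "bessel_bound \<alpha> \<psi> C" by blast
    have C0: "C \<ge> 0" using C unfolding bessel_bound_def by (metis finite.emptyI sum.empty)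
    show "continuous_map AP_R_topology AP_Z_topology ?S"
      unfolding cont_iff
    proof (intro conjI ballI allI impI)
      show "?S ` AP_R \<subseteq> AP_Z" using sampling_map_in_AP_Z[OF \<psi> _ \<alpha>] by blast
      fix f and \<epsilon> :: real assume f: "f \<in> AP_R" and \<epsilon>: "\<epsilon> > 0"
      define \<delta> where "\<delta> = \<epsilon> / (sqrt C + 1)"
      have sC: "sqrt C + 1 > 0" using C0 by (intro add_nonneg_pos) auto
      have \<delta>0: "\<delta> > 0" unfolding \<delta>_def using \<epsilon> sC by (rule divide_pos_pos)
      have "(sqrt C + 1) * \<delta> = \<epsilon>" using sC by (simp add: \<delta>_def)
      then have \<delta>: "\<delta> > 0" "sqrt C * \<delta> < \<epsilon>" using \<delta>0 by (simp_all add: distrib_right)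
      have "AP_Z_norm (\<lambda>n. ?S f n - ?S g n) < \<epsilon>" if g: "g \<in> AP_R" "AP_R_norm (\<lambda>t. f t - g t) < \<delta>" for g
      proof -
        have "(AP_Z_norm (?S (\<lambda>t. f t - g t)))\<^sup>2 \<le> (sqrt C * AP_R_norm (\<lambda>t. f t - g t))\<^sup>2"
          using AP_Z_norm_sampling_le[OF \<psi> \<alpha> C AP_R_diff[OF f g(1)]] C0 by (simp add: power_mult_distrib)
        then have "AP_Z_norm (?S (\<lambda>t. f t - g t)) \<le> sqrt C * AP_R_norm (\<lambda>t. f t - g t)"
          by (rule power2_le_imp_le) (use C0 AP_R_norm_nonneg in simp)
        also have "\<dots> \<le> sqrt C * \<delta>" using g(2) C0 by (intro mult_left_mono) auto
        finally show ?thesis using \<delta>(2) by (simp add: diff[OF f g(1)])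
      qed
      then show "\<exists>\<delta>>0. \<forall>g. g \<in> AP_R \<and> AP_R_norm (\<lambda>t. f t - g t) < \<delta> \<longrightarrow> AP_Z_norm (\<lambda>n. ?S f n - ?S g n) < \<epsilon>"
        using \<delta>(1) by blast
    qed
  qed
qed

lemma SUP_infsum_ennreal_finite_iff:
  fixes g :: "'a \<Rightarrow> 'b \<Rightarrow> real"
  assumes nonneg: "\<And>x k. g x k \<ge> 0"
  shows "(SUP x. \<Sum>\<^sub>\<infinity>k. ennreal (g x k)) < \<infinity> \<longleftrightarrow> (\<exists>C. \<forall>x F. finite F \<longrightarrow> (\<Sum>k\<in>F. g x k) \<le> C)"
proof -
  have "(\<Sum>\<^sub>\<infinity>k. ennreal (g x k)) = (SUP F\<in>{F. finite F}. ennreal (\<Sum>k\<in>F. g x k))" for x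
    by (simp add: nonneg_infsum_complete sum_ennreal nonneg)
  then have le: "(SUP x. \<Sum>\<^sub>\<infinity>k. ennreal (g x k)) \<le> y \<longleftrightarrow> (\<forall>x F. finite F \<longrightarrow> ennreal (\<Sum>k\<in>F. g x k) \<le> y)" for y
    by (simp add: SUP_le_iff)
  show ?thesis
  proof
    assume "(SUP x. \<Sum>\<^sub>\<infinity>k. ennreal (g x k)) < \<infinity>"
    then obtain C where C: "C \<ge> 0" "(SUP x. \<Sum>\<^sub>\<infinity>k. ennreal (g x k)) = ennreal C"
      by (metis ennreal_cases infinity_ennreal_def less_irrefl)
    then have "\<forall>x F. finite F \<longrightarrow> ennreal (\<Sum>k\<in>F. g x k) \<le> ennreal C" using le by (metis order_refl)
    then show "\<exists>C. \<forall>x F. finite F \<longrightarrow> (\<Sum>k\<in>F. g x k) \<le> C" using C(1) by (auto simp: ennreal_le_iff)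
  next
    assume "\<exists>C. \<forall>x F. finite F \<longrightarrow> (\<Sum>k\<in>F. g x k) \<le> C"
    then obtain C where "\<forall>x F. finite F \<longrightarrow> (\<Sum>k\<in>F. g x k) \<le> C" by blast
    then have "(SUP x. \<Sum>\<^sub>\<infinity>k. ennreal (g x k)) \<le> ennreal C" unfolding le by (auto intro: ennreal_leI)
    also have "\<dots> < \<infinity>" by simp
    finally show "(SUP x. \<Sum>\<^sub>\<infinity>k. ennreal (g x k)) < \<infinity>" .
  qed
qed

section \<open>The Wiener space\<close>

lemma AE_lebesgue_shift:
  assumes "AE x in lebesgue. P (x::real)"
  shows "AE x in lebesgue. P (x + c)"
proof -
  obtain N where N: "N \<in> null_sets lebesgue" "{x. \<not> P x} \<subseteq> N"
    using assms unfolding eventually_ae_filter by auto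
  have "negligible ((+) (-c) ` N)"
    using N(1) by (intro negligible_translation) (simp add: negligible_iff_null_sets)
  moreover have "{x. \<not> P (x + c)} \<subseteq> (+) (-c) ` N"
  proof
    fix x assume "x \<in> {x. \<not> P (x + c)}"
    then have "x + c \<in> N" using N(2) by auto
    then show "x \<in> (+) (-c) ` N" by (intro image_eqI[of _ _ "x + c"]) auto
  qed
  ultimately show ?thesis
    unfolding eventually_ae_filter by (intro bexI[of _ "(+) (-c) ` N"]) (simp_all add: negligible_iff_null_sets)
qed

text \<open>The interval \<open>{k..k+1}\<close> corresponds to the summand with index \<open>-k\<close> of the Wiener norm.\<close>

lemma Wiener_amalgam_bounds:
  assumes "\<phi> \<in> Wiener"
  obtains v :: "int \<Rightarrow> real" and K :: real
  where "K > 0" "\<And>k. v k \<ge> 0" "\<And>F. finite F \<Longrightarrow> (\<Sum>k\<in>F. v k) \<le> K"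
    "\<And>k. AE x in lebesgue. x \<in> {of_int k..of_int k + 1} \<longrightarrow> cmod (\<phi> x) \<le> v k"
proof -
  define e where "e k = esssup (lebesgue_on {0..1}) (\<lambda>x. ennreal (cmod (\<phi> (x - of_int k))))" for k :: int
  have fin: "(\<Sum>\<^sub>\<infinity>k. e k) < \<infinity>" using assms by (simp add: Wiener_def wiener_norm_def e_def)
  have le: "(\<Sum>k\<in>F. e k) \<le> (\<Sum>\<^sub>\<infinity>k. e k)" if "finite F" for F
    using that by (subst nonneg_infsum_complete) (auto intro!: SUP_upper)
  have e_fin: "e k < \<infinity>" for k
  proof -
    have "e k \<le> (\<Sum>\<^sub>\<infinity>k. e k)" using le[of "{k}"] by simp
    then show ?thesis using fin by (rule le_less_trans)
  qed
  define w where "w k = enn2real (e k)" for k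
  have w: "e k = ennreal (w k)" "w k \<ge> 0" for k using e_fin[of k] by (simp_all add: w_def)
  define K where "K = enn2real (\<Sum>\<^sub>\<infinity>k. e k) + 1"
  show thesis
  proof (rule that[of K "\<lambda>k. w (-k)"])
    show "K > 0" by (simp add: K_def add_nonneg_pos)
    show "w (-k) \<ge> 0" for k by (rule w)
    show "(\<Sum>k\<in>F. w (-k)) \<le> K" if F: "finite F" for F
    proof -
      have "(\<Sum>k\<in>F. w (-k)) = (\<Sum>k\<in>uminus ` F. w k)" by (subst sum.reindex) auto
      also have "ennreal \<dots> = (\<Sum>k\<in>uminus ` F. e k)"
        unfolding w(1) by (rule sum_ennreal[symmetric]) (rule w(2))
      also have "\<dots> \<le> (\<Sum>\<^sub>\<infinity>k. e k)" using F by (intro le) simp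
      also have "\<dots> = ennreal (enn2real (\<Sum>\<^sub>\<infinity>k. e k))" using fin by simp
      finally have "(\<Sum>k\<in>F. w (-k)) \<le> enn2real (\<Sum>\<^sub>\<infinity>k. e k)" by (simp add: ennreal_le_iff)
      then show ?thesis by (simp add: K_def)
    qed
    show "AE x in lebesgue. x \<in> {of_int k..of_int k + 1} \<longrightarrow> cmod (\<phi> x) \<le> w (-k)" for k
    proof -
      have "AE x in lebesgue_on {0..1}. ennreal (cmod (\<phi> (x - of_int (-k)))) \<le> e (-k)"
        unfolding e_def by (rule esssup_AE)
      then have "AE x in lebesgue. x \<in> {0..1} \<longrightarrow> cmod (\<phi> (x - of_int (-k))) \<le> w (-k)"
        by (subst (asm) AE_restrict_space_iff) (auto simp: w ennreal_le_iff)
      from AE_lebesgue_shift[OF this, of "- of_int k"] show ?thesis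
        by (rule eventually_mono) auto
    qed
  qed
qed

text \<open>The form in which the summability of local suprema is used: the bounds \<open>v k\<close> on the unit intervals
  add up, while \<open>c\<close> is uniform.\<close>

lemma nn_integral_le_unit_intervals:
  fixes g :: "real \<Rightarrow> ennreal" and v :: "int \<Rightarrow> real"
  assumes g: "g \<in> borel_measurable lebesgue" and c: "c \<ge> 0"
    and v: "\<And>k. v k \<ge> 0" "\<And>F. finite F \<Longrightarrow> (\<Sum>k\<in>F. v k) \<le> K"
    and le: "\<And>k. (\<integral>\<^sup>+x. g x * indicator {of_int k..<of_int k + 1} x \<partial>lebesgue) \<le> ennreal (v k * c)"
  shows "(\<integral>\<^sup>+x. g x \<partial>lebesgue) \<le> ennreal (K * c)"
proof -
  define W where "W n = {- real n..<real n}" for n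
  have Ico: "{a..<b} \<in> sets lebesgue" for a b :: real by (intro sets_completionI_sets) auto
  have split: "(indicator (W n) x :: ennreal) = (\<Sum>k\<in>{- int n..<int n}. indicator {of_int k..<of_int k + 1} x)" for n x
  proof -
    have "x \<in> {of_int k..<of_int k + 1} \<longleftrightarrow> k = \<lfloor>x\<rfloor>" for k
      using floor_eq_iff[of x k] by auto
    then have "(indicator {of_int k..<of_int k + 1} x :: ennreal) = (if k = \<lfloor>x\<rfloor> then 1 else 0)" for k
      by (simp only: indicator_def if_distrib) simp
    then have "(\<Sum>k\<in>{- int n..<int n}. indicator {of_int k..<of_int k + 1} x) = (if \<lfloor>x\<rfloor> \<in> {- int n..<int n} then 1 else 0 :: ennreal)"
      by simp
    moreover have "\<lfloor>x\<rfloor> \<in> {- int n..<int n} \<longleftrightarrow> x \<in> W n"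
      by (simp add: W_def le_floor_iff floor_less_iff)
    ultimately show ?thesis by (simp add: indicator_def)
  qed
  have Wle: "(\<integral>\<^sup>+x. g x * indicator (W n) x \<partial>lebesgue) \<le> ennreal (K * c)" for n
  proof -
    have "(\<integral>\<^sup>+x. g x * indicator (W n) x \<partial>lebesgue)
        = (\<Sum>k\<in>{- int n..<int n}. \<integral>\<^sup>+x. g x * indicator {of_int k..<of_int k + 1} x \<partial>lebesgue)"
      unfolding split sum_distrib_left
      by (intro nn_integral_sum borel_measurable_times_ennreal g borel_measurable_indicator Ico)
    also have "\<dots> \<le> (\<Sum>k\<in>{- int n..<int n}. ennreal (v k * c))" by (intro sum_mono le)
    also have "\<dots> = ennreal ((\<Sum>k\<in>{- int n..<int n}. v k) * c)"
      unfolding sum_distrib_right using v(1) c by (intro sum_ennreal mult_nonneg_nonneg)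
    also have "\<dots> \<le> ennreal (K * c)" using v(2) c by (intro ennreal_leI mult_right_mono) auto
    finally show ?thesis .
  qed
  have "(SUP n. g x * indicator (W n) x) = g x" for x
  proof (rule antisym)
    show "(SUP n. g x * indicator (W n) x) \<le> g x" by (intro SUP_least) (auto simp: indicator_def)
    obtain n where "real n > \<bar>x\<bar>" using reals_Archimedean2 by blast
    then have "x \<in> W n" by (auto simp: W_def)
    then show "g x \<le> (SUP n. g x * indicator (W n) x)" by (intro SUP_upper2[of n]) auto
  qed
  then have "(\<integral>\<^sup>+x. g x \<partial>lebesgue) = (\<integral>\<^sup>+x. (SUP n. g x * indicator (W n) x) \<partial>lebesgue)" by simp
  also have "\<dots> = (SUP n. \<integral>\<^sup>+x. g x * indicator (W n) x \<partial>lebesgue)"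
  proof (rule nn_integral_monotone_convergence_SUP)
    show "incseq (\<lambda>n x. g x * indicator (W n) x)"
    proof (intro monoI le_funI)
      fix m n :: nat and x assume "m \<le> n"
      then have "W m \<subseteq> W n" by (auto simp: W_def)
      then show "g x * indicator (W m) x \<le> g x * indicator (W n) x"
        by (intro mult_left_mono) (auto simp: indicator_def)
    qed
    show "(\<lambda>x. g x * indicator (W n) x) \<in> borel_measurable lebesgue" for n
      unfolding W_def by (intro borel_measurable_times_ennreal g borel_measurable_indicator Ico)
  qed
  also have "\<dots> \<le> ennreal (K * c)" by (intro SUP_least Wle)
  finally show ?thesis .
qed

lemma Wiener_subset_L1:
  assumes "\<phi> \<in> Wiener"
  shows "\<phi> \<in> L1"
proof -
  obtain v K where v: "K > 0" "\<And>k. v k \<ge> 0" "\<And>F. finite F \<Longrightarrow> (\<Sum>k\<in>F. v k) \<le> K"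
    "\<And>k. AE x in lebesgue. x \<in> {of_int k..of_int k + 1} \<longrightarrow> cmod (\<phi> x) \<le> v k"
    by (rule Wiener_amalgam_bounds[OF assms]) (rule that)
  have [measurable]: "\<phi> \<in> borel_measurable lebesgue" using assms by (simp add: Wiener_def Linf_def)
  have "(\<integral>\<^sup>+x. ennreal (cmod (\<phi> x)) \<partial>lebesgue) \<le> ennreal (K * 1)"
  proof (rule nn_integral_le_unit_intervals[OF _ _ v(2,3)])
    fix k
    have "(\<integral>\<^sup>+x. ennreal (cmod (\<phi> x)) * indicator {of_int k..<of_int k + 1} x \<partial>lebesgue)
        \<le> (\<integral>\<^sup>+x. ennreal (v k) * indicator {real_of_int k..<of_int k + 1} x \<partial>lebesgue)"
    proof (rule nn_integral_mono_AE)
      show "AE x in lebesgue. ennreal (cmod (\<phi> x)) * indicator {of_int k..<of_int k + 1} x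
          \<le> ennreal (v k) * indicator {real_of_int k..<of_int k + 1} x"
        using v(4)[of k]
      proof eventually_elim
        case (elim x)
        show ?case
        proof (cases "x \<in> {of_int k..<real_of_int k + 1}")
          case True
          then show ?thesis using elim by (simp add: ennreal_leI)
        qed simp
      qed
    qed
    also have "\<dots> = ennreal (v k) * emeasure lebesgue {real_of_int k..<of_int k + 1}"
      by (intro nn_integral_cmult_indicator sets_completionI_sets) auto
    also have "emeasure lebesgue {real_of_int k..<of_int k + 1} = 1"
      by (simp add: emeasure_completion)
    also have "ennreal (v k) * 1 = ennreal (v k * 1)" by simp
    finally show "(\<integral>\<^sup>+x. ennreal (cmod (\<phi> x)) * indicator {of_int k..<of_int k + 1} x \<partial>lebesgue) \<le> ennreal (v k * 1)" .
  qed simp_all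
  also have "\<dots> < \<infinity>" by simp
  finally have "integrable lebesgue \<phi>" by (intro integrableI_bounded) simp_all
  then show ?thesis by (simp add: L1_def)
qed

text \<open>Pair \<open>\<psi>\<close> with the same test function \<open>f\<close> that gives the lower bound: its samples at \<open>0\<close> equal
  the sum of squares \<open>A\<close>, while over every unit interval the integral of \<open>\<bar>f\<bar>\<^sup>2\<close> is at most that over
  finitely many periods, a multiple of \<open>A\<close>.\<close>

theorem bessel_bound_Wiener:
  assumes W: "\<psi> \<in> Wiener" and \<alpha>: "\<alpha> > 0"
  shows "\<exists>C. bessel_bound \<alpha> \<psi> C"
proof -
  obtain v K where v: "K > 0" "\<And>k. v k \<ge> 0" "\<And>F. finite F \<Longrightarrow> (\<Sum>k\<in>F. v k) \<le> K"
    "\<And>k. AE x in lebesgue. x \<in> {of_int k..of_int k + 1} \<longrightarrow> cmod (\<psi> x) \<le> v k"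
    by (rule Wiener_amalgam_bounds[OF W]) (rule that)
  have \<psi>: "\<psi> \<in> L1" by (rule Wiener_subset_L1[OF W])
  have [measurable]: "\<psi> \<in> borel_measurable lebesgue" using \<psi> by (auto simp: L1_def)
  \<comment> \<open>This many periods of length \<open>\<alpha>\<close> cover a unit interval.\<close>
  define n where "n = nat \<lceil>1 / \<alpha>\<rceil>"
  have "1 / \<alpha> \<le> real n" unfolding n_def by linarith
  then have n1: "1 \<le> real n * \<alpha>" using \<alpha> by (simp add: field_simps)
  have "bessel_bound \<alpha> \<psi> (K\<^sup>2 * (real n * \<alpha>))"
    unfolding bessel_bound_def
  proof (intro allI impI)
    fix \<omega> :: real and F :: "int set" assume F: "finite F"
    define w where "w k = \<omega> + 2 * pi * (of_int k / \<alpha>)" for k :: int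
    define A where "A = (\<Sum>k\<in>F. (cmod (fourier \<psi> (w k)))\<^sup>2)"
    define f where "f t = (\<Sum>k\<in>F. fourier \<psi> (w k) * cis (w k * t))" for t
    \<comment> \<open>The linear bound \<open>2 \<bar>f\<bar> \<le> s \<bar>f\<bar>\<^sup>2 + 1 / s\<close> replaces Cauchy--Schwarz; with this \<open>s\<close> the quadratic
      part contributes exactly \<open>A / 2\<close> to the final estimate of \<open>A\<close>.\<close>
    define s where "s = 1 / (K * (real n * \<alpha>))"
    define c where "c = (s * (real n * \<alpha> * A) + 1 / s) / 2"
    define h where "h t = (s * (cmod (f t))\<^sup>2 + 1 / s) / 2" for t
    have s: "s > 0" using v(1) n1 by (simp add: s_def)
    have A0: "A \<ge> 0" by (simp add: A_def sum_nonneg)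
    have c0: "c \<ge> 0" unfolding c_def using s A0 n1 by simp
    have cont: "continuous_on S f" for S unfolding f_def by (intro continuous_intros)
    have f_meas: "f \<in> borel_measurable borel" using cont by (rule borel_measurable_continuous_onI)
    have f_bdd: "bounded (range f)"
      unfolding f_def bounded_iff
      by (intro exI[of _ "\<Sum>k\<in>F. cmod (fourier \<psi> (w k))"] ballI, elim rangeE)
         (auto intro!: order_trans[OF norm_sum] simp: norm_mult)
    have inj: "inj_on w F" using \<alpha> by (auto simp: inj_on_def w_def)
    have f_le: "cmod (f t) \<le> h t" for t
    proof -
      have "0 \<le> (s * cmod (f t) - 1)\<^sup>2 / s" using s by simp
      also have "\<dots> = s * (cmod (f t))\<^sup>2 - 2 * cmod (f t) + 1 / s"
        using s by (simp add: power2_diff power_mult_distrib add_divide_distrib diff_divide_distrib)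
          (simp add: power2_eq_square)
      finally show ?thesis by (simp add: h_def)
    qed
    have h_int: "integral {a..a+1} h \<le> c" for a
    proof -
      have P: "((\<lambda>t. (cmod (f t))\<^sup>2) has_integral (real n * \<alpha>) * A) {a..a + real n * \<alpha>}"
        unfolding f_def A_def
      proof (rule parseval_exponentials[OF F inj])
        fix k l
        have "(w k - w l) * (real n * \<alpha>) = 2 * pi * of_int ((k - l) * int n)"
          using \<alpha> by (simp add: w_def field_simps)
        then show "\<exists>m::int. (w k - w l) * (real n * \<alpha>) = 2 * pi * of_int m" by (rule exI[of _ "(k - l) * int n"])
      qed (use n1 in simp)
      have i: "(\<lambda>t. (cmod (f t))\<^sup>2) integrable_on {a..b}" for b
        by (intro integrable_continuous_interval continuous_intros cont)
      have "integral {a..a+1} (\<lambda>t. (cmod (f t))\<^sup>2) \<le> integral {a..a + real n * \<alpha>} (\<lambda>t. (cmod (f t))\<^sup>2)"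
        using n1 by (intro integral_subset_le i) auto
      also have "\<dots> = real n * \<alpha> * A" using P by (rule integral_unique)
      finally have "s * integral {a..a+1} (\<lambda>t. (cmod (f t))\<^sup>2) \<le> s * (real n * \<alpha> * A)"
        using s by (intro mult_left_mono) auto
      moreover have "integral {a..a+1} h = (s * integral {a..a+1} (\<lambda>t. (cmod (f t))\<^sup>2) + 1 / s) / 2"
      proof (rule integral_unique)
        have f2: "((\<lambda>t. (cmod (f t))\<^sup>2) has_integral integral {a..a+1} (\<lambda>t. (cmod (f t))\<^sup>2)) {a..a+1}"
          using i by (rule integrable_integral)
        have s1: "((\<lambda>t. 1 / s) has_integral 1 / s) {a..a+1}"
          using has_integral_const_real[of "1 / s" a "a + 1"] by simp
        show "(h has_integral (s * integral {a..a+1} (\<lambda>t. (cmod (f t))\<^sup>2) + 1 / s) / 2) {a..a+1}"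
          unfolding h_def by (rule has_integral_divide[OF has_integral_add[OF has_integral_mult_right[OF f2] s1]])
      qed
      ultimately show ?thesis by (simp add: c_def)
    qed
    have int: "integrable lebesgue (\<lambda>t. f t * cnj (\<psi> t))"
      using sampling_integrable[OF \<psi> f_meas f_bdd, of 0] by simp
    have [measurable]: "f \<in> borel_measurable lebesgue" using f_meas by (auto intro: measurable_completion)
    have nn: "(\<integral>\<^sup>+t. ennreal (cmod (f t * cnj (\<psi> t))) \<partial>lebesgue) \<le> ennreal (K * c)"
    proof (rule nn_integral_le_unit_intervals[OF _ _ v(2,3)])
      fix k :: int
      have "(\<integral>\<^sup>+t. ennreal (cmod (f t * cnj (\<psi> t))) * indicator {of_int k..<of_int k + 1} t \<partial>lebesgue)
          \<le> (\<integral>\<^sup>+t. ennreal (v k * h t) * indicator {of_int k..of_int k + 1} t \<partial>lebesgue)"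
      proof (rule nn_integral_mono_AE, rule eventually_mono[OF v(4)[of k]])
        fix t assume t: "t \<in> {real_of_int k..of_int k + 1} \<longrightarrow> cmod (\<psi> t) \<le> v k"
        show "ennreal (cmod (f t * cnj (\<psi> t))) * indicator {of_int k..<of_int k + 1} t
            \<le> ennreal (v k * h t) * indicator {of_int k..of_int k + 1} t"
        proof (cases "t \<in> {of_int k..<of_int k + 1}")
          case True
          then have "cmod (\<psi> t) * cmod (f t) \<le> v k * h t"
            using t v(2)[of k] f_le[of t] by (intro mult_mono) auto
          then show ?thesis using True by (auto simp: norm_mult mult.commute intro: ennreal_leI)
        qed simp
      qed
      also have "\<dots> = ennreal (v k * integral {of_int k..of_int k + 1} h)"
        unfolding nn_integral_completion
      proof (rule nn_integral_has_integral_lebesgue')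
        show "0 \<le> v k * h t" for t using v(2)[of k] f_le[of t] order_trans[OF norm_ge_zero f_le] by simp
        show "((\<lambda>t. v k * h t) has_integral v k * integral {of_int k..of_int k + 1} h) {real_of_int k..of_int k + 1}"
          unfolding h_def
          by (intro has_integral_mult_right integrable_integral integrable_continuous_interval continuous_intros cont)
             (use s in auto)
      qed
      also have "\<dots> \<le> ennreal (v k * c)" using v(2) h_int by (intro ennreal_leI mult_left_mono) auto
      finally show "(\<integral>\<^sup>+t. ennreal (cmod (f t * cnj (\<psi> t))) * indicator {of_int k..<of_int k + 1} t \<partial>lebesgue)
          \<le> ennreal (v k * c)" .
      have "(\<lambda>t. f t * cnj (\<psi> t)) \<in> borel_measurable lebesgue" using int by (rule borel_measurable_integrable)
      then show "(\<lambda>t. ennreal (cmod (f t * cnj (\<psi> t)))) \<in> borel_measurable lebesgue" by measurable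
    qed (rule c0)
    have "complex_of_real A = sampling_map \<alpha> \<psi> f 0"
      unfolding f_def sampling_map_exponentials[OF \<psi> F] A_def of_real_sum by (simp add: complex_norm_square del: of_real_power)
    also have "\<dots> = (LINT t|lebesgue. f t * cnj (\<psi> t))" by (simp add: sampling_map_eq)
    finally have eq: "complex_of_real A = (LINT t|lebesgue. f t * cnj (\<psi> t))" .
    have "ennreal (cmod (complex_of_real A)) \<le> ennreal (K * c)"
      unfolding eq using integral_norm_bound_ennreal[OF int] nn by (rule order_trans)
    then have "A \<le> K * c" using A0 v(1) c0 by (simp add: ennreal_le_iff)
    also have "K * c = A / 2 + K\<^sup>2 * (real n * \<alpha>) / 2"
    proof -
      define q where "q = real n * \<alpha>"
      have "q > 0" using n1 unfolding q_def by linarith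
      then have "K * (1 / (K * q) * (q * A)) = A" "K * (1 / (1 / (K * q))) = K\<^sup>2 * q"
        using v(1) by (simp_all add: power2_eq_square)
      then have "K * (s * (real n * \<alpha> * A)) = A" "K * (1 / s) = K\<^sup>2 * (real n * \<alpha>)"
        unfolding s_def q_def by blast+
      then show ?thesis unfolding c_def times_divide_eq_right distrib_left by (simp add: add_divide_distrib)
    qed
    finally have "A \<le> K\<^sup>2 * (real n * \<alpha>)" by simp
    then show "(\<Sum>k\<in>F. (cmod (fourier \<psi> (\<omega> + 2 * pi * (of_int k / \<alpha>))))\<^sup>2) \<le> K\<^sup>2 * (real n * \<alpha>)"
      by (simp add: A_def w_def)
  qed
  then show ?thesis by blast
qed

section \<open>Fourier transforms of the Wiener space\<close>

lemma integral_gaussian_character: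
  assumes \<epsilon>: "\<epsilon> > 0"
  shows "integrable lborel (\<lambda>t. cis (- (y * t)) * of_real (exp (- ((\<epsilon> * t)\<^sup>2) / 2)))"
    and "(CLINT t|lborel. cis (- (y * t)) * of_real (exp (- ((\<epsilon> * t)\<^sup>2) / 2)))
        = of_real (2 * pi * normal_density 0 \<epsilon> y)"
proof -
  define g where "g u = std_normal_density u *\<^sub>R cis (- (y / \<epsilon>) * u)" for u
  have c: "(\<lambda>u. cis (- (y / \<epsilon>) * u)) \<in> borel_measurable borel"
    by (intro borel_measurable_continuous_onI continuous_on_cis continuous_on_mult continuous_on_const continuous_on_id)
  have g_int: "integrable lborel g"
  proof (rule Bochner_Integration.integrable_bound)
    show "integrable lborel std_normal_density" by simp
    show "g \<in> borel_measurable lborel" unfolding g_def using c by measurable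
    show "AE u in lborel. norm (g u) \<le> norm (std_normal_density u)"
      by (simp add: g_def)
  qed
  have g_val: "(CLINT u|lborel. g u) = of_real (exp (- ((y / \<epsilon>)\<^sup>2) / 2))"
  proof -
    have "char std_normal_distribution (- (y / \<epsilon>)) = (CLINT u|lborel. g u)"
      unfolding char_def g_def
      using c by (subst integral_density) (simp_all add: cis_conv_exp normal_density_nonneg)
    then show ?thesis by (simp add: char_std_normal_distribution)
  qed
  have eq: "cis (- (y * t)) * of_real (exp (- ((\<epsilon> * t)\<^sup>2) / 2)) = sqrt (2 * pi) *\<^sub>R g (0 + \<epsilon> * t)" for t
    using \<epsilon> by (simp add: g_def normal_density_def scaleR_conv_of_real)
  show "integrable lborel (\<lambda>t. cis (- (y * t)) * of_real (exp (- ((\<epsilon> * t)\<^sup>2) / 2)))"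
    unfolding eq by (intro integrable_scaleR_right lborel_integrable_real_affine g_int) (use \<epsilon> in simp)
  have "(CLINT u|lborel. g u) = \<epsilon> *\<^sub>R (CLINT t|lborel. g (0 + \<epsilon> * t))"
    using lborel_integral_real_affine[of \<epsilon> g 0] \<epsilon> by simp
  then have "(CLINT t|lborel. g (0 + \<epsilon> * t)) = (1 / \<epsilon>) *\<^sub>R (CLINT u|lborel. g u)"
    using \<epsilon> by simp
  then have "(CLINT t|lborel. cis (- (y * t)) * of_real (exp (- ((\<epsilon> * t)\<^sup>2) / 2)))
      = sqrt (2 * pi) *\<^sub>R (1 / \<epsilon>) *\<^sub>R of_real (exp (- ((y / \<epsilon>)\<^sup>2) / 2))"
    unfolding eq integral_scaleR_right g_val by simp
  also have "\<dots> = of_real (sqrt (2 * pi) * (1 / \<epsilon>) * exp (- ((y / \<epsilon>)\<^sup>2) / 2))"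
    by (simp add: scaleR_conv_of_real)
  also have "sqrt (2 * pi) * (1 / \<epsilon>) * exp (- ((y / \<epsilon>)\<^sup>2) / 2) = 2 * pi * normal_density 0 \<epsilon> y"
  proof -
    define q where "q = sqrt (2 * pi)"
    have q: "q > 0" "2 * pi = q * q" by (simp_all add: q_def)
    have "sqrt (2 * pi * \<epsilon>\<^sup>2) = q * \<epsilon>" using \<epsilon> by (simp add: q_def real_sqrt_mult)
    moreover have "- ((y / \<epsilon>)\<^sup>2) / 2 = - (y - 0)\<^sup>2 / (2 * \<epsilon>\<^sup>2)" by (simp add: power_divide mult.commute)
    moreover have "q * (1 / \<epsilon>) * E = q * q * (1 / (q * \<epsilon>) * E)" for E using q(1) by simp
    ultimately show ?thesis unfolding normal_density_def q_def[symmetric] by (simp only: q(2))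
  qed
  finally show "(CLINT t|lborel. cis (- (y * t)) * of_real (exp (- ((\<epsilon> * t)\<^sup>2) / 2)))
        = of_real (2 * pi * normal_density 0 \<epsilon> y)" .
qed

text \<open>Fubini is applied on the Borel product, hence to a Borel function in the class of \<open>\<phi>\<close>.\<close>

lemma L1_borel_representative:
  assumes "\<phi> \<in> L1"
  obtains g where "integrable lborel g" "AE x in lebesgue. \<phi> x = g x"
proof -
  have m: "\<phi> \<in> borel_measurable lebesgue" using assms by (auto simp: L1_def)
  have mr: "(\<lambda>x. Re (\<phi> x)) \<in> borel_measurable lebesgue" and mi: "(\<lambda>x. Im (\<phi> x)) \<in> borel_measurable lebesgue"
    using m by measurable
  obtain r where r: "r \<in> borel_measurable lborel" "AE x in lborel. Re (\<phi> x) = r x"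
    by (rule bexE[OF completion_ex_borel_measurable_real[OF mr]]) (rule that)
  obtain i where i: "i \<in> borel_measurable lborel" "AE x in lborel. Im (\<phi> x) = i x"
    by (rule bexE[OF completion_ex_borel_measurable_real[OF mi]]) (rule that)
  define g where "g x = Complex (r x) (i x)" for x
  have g: "g \<in> borel_measurable lborel"
    unfolding g_def Complex_eq using r(1) i(1) by (intro borel_measurable_add borel_measurable_times borel_measurable_of_real) auto
  have "AE x in lborel. \<phi> x = g x"
    using r(2) i(2) by eventually_elim (simp add: g_def complex_eq_iff)
  then have ae: "AE x in lebesgue. \<phi> x = g x" by (rule AE_completion)
  have "integrable lebesgue g"
    using assms integrable_cong_AE[OF m measurable_completion[OF g] ae] by (simp add: L1_def)
  then have "integrable lborel g" using integrable_completion[OF g] by blast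
  then show thesis using ae by (rule that)
qed

lemma fourier_cong_AE:
  assumes "AE x in lebesgue. \<phi> x = g x" "\<phi> \<in> borel_measurable lebesgue" "g \<in> borel_measurable lborel"
  shows "fourier \<phi> \<omega> = (CLINT x|lborel. g x * cis (- (\<omega> * x)))"
proof -
  have e: "exp (- (\<i> * of_real \<omega> * of_real t)) = cis (- (\<omega> * t))" for t
    by (simp add: cis_conv_exp mult.assoc)
  have c: "(\<lambda>t. cis (- (\<omega> * t))) \<in> borel_measurable borel"
    by (intro borel_measurable_continuous_onI continuous_intros)
  have gm: "(\<lambda>x. g x * cis (- (\<omega> * x))) \<in> borel_measurable lborel"
    using assms(3) c by (intro borel_measurable_times) auto
  have "fourier \<phi> \<omega> = (LINT x|lebesgue. g x * cis (- (\<omega> * x)))"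
    unfolding fourier_def e
  proof (rule integral_cong_AE)
    show "(\<lambda>x. \<phi> x * cis (- (\<omega> * x))) \<in> borel_measurable lebesgue"
      using assms(2) c by (intro borel_measurable_times) (auto intro: measurable_completion)
    show "(\<lambda>x. g x * cis (- (\<omega> * x))) \<in> borel_measurable lebesgue"
      using gm by (rule measurable_completion)
    show "AE x in lebesgue. \<phi> x * cis (- (\<omega> * x)) = g x * cis (- (\<omega> * x))"
      using assms(1) by eventually_elim simp
  qed
  also have "\<dots> = (CLINT x|lborel. g x * cis (- (\<omega> * x)))" by (rule integral_completion[OF gm])
  finally show ?thesis .
qed

text \<open>Fubini and the transform of the Gaussian turn the Gaussian means of the inverse transform into
  averages of \<open>\<phi>\<close> against an approximate identity concentrated at \<open>-\<omega>\<close>.\<close>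

lemma gaussian_mean_of_transform:
  assumes \<phi>: "integrable lborel \<phi>" and \<epsilon>: "\<epsilon> > 0"
  shows "(CLINT t|lborel. (CLINT x|lborel. \<phi> x * cis (- (t * x))) * (cis (- (\<omega> * t)) * of_real (exp (- ((\<epsilon> * t)\<^sup>2) / 2))))
       = (CLINT x|lborel. \<phi> x * of_real (2 * pi * normal_density 0 \<epsilon> (x + \<omega>)))"
proof -
  define G where "G t = exp (- ((\<epsilon> * t)\<^sup>2) / 2)" for t
  define k where "k x t = \<phi> x * (cis (- ((x + \<omega>) * t)) * complex_of_real (G t))" for x t
  have [measurable]: "\<phi> \<in> borel_measurable borel" using \<phi> by auto
  have cis_meas[measurable]: "cis \<in> borel_measurable borel"
    by (intro borel_measurable_continuous_onI continuous_intros)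
  have G_meas[measurable]: "G \<in> borel_measurable borel"
    unfolding G_def by measurable
  have G_int: "integrable lborel G"
  proof -
    have "integrable lborel (\<lambda>t. norm (cis (- (0 * t)) * complex_of_real (exp (- ((\<epsilon> * t)\<^sup>2) / 2))))"
      by (rule integrable_norm[OF integral_gaussian_character(1)[OF \<epsilon>]])
    then show ?thesis by (simp add: G_def[abs_def])
  qed
  have k_meas: "case_prod k \<in> borel_measurable (lborel \<Otimes>\<^sub>M lborel)"
    unfolding k_def by measurable
  have norm_k: "norm (k x t) = cmod (\<phi> x) * G t" for x t by (simp add: k_def G_def norm_mult)
  have k_int: "integrable (lborel \<Otimes>\<^sub>M lborel) (case_prod k)"
  proof (rule lborel_pair.Fubini_integrable)
    show "case_prod k \<in> borel_measurable (lborel \<Otimes>\<^sub>M lborel)" by (rule k_meas)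
    show "integrable lborel (\<lambda>x. LINT t|lborel. norm (case_prod k (x, t)))"
      using \<phi> by (simp add: norm_k)
    show "AE x in lborel. integrable lborel (\<lambda>t. case_prod k (x, t))"
    proof (rule AE_I2)
      fix x
      show "integrable lborel (\<lambda>t. case_prod k (x, t))"
        unfolding k_def G_def prod.case
        by (intro integrable_mult_right integral_gaussian_character(1) \<epsilon>)
    qed
  qed
  have "(CLINT t|lborel. (CLINT x|lborel. \<phi> x * cis (- (t * x))) * (cis (- (\<omega> * t)) * of_real (G t)))
      = (CLINT t|lborel. CLINT x|lborel. k x t)"
  proof (intro Bochner_Integration.integral_cong refl)
    fix t
    have "(CLINT x|lborel. k x t) = (CLINT x|lborel. (\<phi> x * cis (- (t * x))) * (cis (- (\<omega> * t)) * of_real (G t)))"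
    proof (intro Bochner_Integration.integral_cong refl)
      fix x
      have "cis (- ((x + \<omega>) * t)) = cis (- (t * x)) * cis (- (\<omega> * t))"
        by (simp add: cis_mult algebra_simps)
      then show "k x t = (\<phi> x * cis (- (t * x))) * (cis (- (\<omega> * t)) * of_real (G t))" by (simp add: k_def)
    qed
    then show "(CLINT x|lborel. \<phi> x * cis (- (t * x))) * (cis (- (\<omega> * t)) * of_real (G t)) = (CLINT x|lborel. k x t)"
      by simp
  qed
  also have "\<dots> = (CLINT x|lborel. CLINT t|lborel. k x t)"
    by (rule lborel_pair.Fubini_integral[OF k_int])
  also have "\<dots> = (CLINT x|lborel. \<phi> x * of_real (2 * pi * normal_density 0 \<epsilon> (x + \<omega>)))"
    unfolding k_def G_def using integral_gaussian_character(2)[OF \<epsilon>] by simp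
  finally show ?thesis unfolding G_def .
qed

lemma normal_density_le_at_1:
  assumes "\<epsilon> > 0" "\<bar>y\<bar> \<ge> 1"
  shows "normal_density 0 \<epsilon> y \<le> normal_density 0 \<epsilon> 1"
proof -
  have "1 \<le> \<bar>y\<bar>\<^sup>2" using assms(2) by (rule one_le_power)
  then have "1 \<le> y\<^sup>2" by (simp only: power2_abs)
  then show ?thesis
    using assms(1) unfolding normal_density_def by (intro mult_left_mono) (auto simp: divide_right_mono)
qed

text \<open>As \<open>\<epsilon>\<close> tends to \<open>0\<close>, the Gaussian means tend to \<open>fourier \<psi> \<omega>\<close> since \<open>\<psi>\<close> is integrable.  On the other
  side \<open>2 \<pi>\<close> times a probability density concentrated at \<open>-\<omega>\<close> is integrated against \<open>\<phi>\<close>; the part at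
  distance at least \<open>1\<close> from \<open>-\<omega>\<close> vanishes in the limit since \<open>\<phi>\<close> is integrable and the density tends to
  \<open>0\<close> uniformly there.  Bounding the limit at each \<open>\<omega>\<close> replaces Fourier inversion almost everywhere.\<close>

lemma fourier_transform_bound:
  assumes \<psi>: "\<psi> \<in> L1" and \<phi>: "\<phi> \<in> L1" and ae: "AE t in lebesgue. \<psi> t = fourier \<phi> t"
    and V: "V \<ge> 0" "AE x in lebesgue. \<bar>x + \<omega>\<bar> < 1 \<longrightarrow> cmod (\<phi> x) \<le> V"
  shows "cmod (fourier \<psi> \<omega>) \<le> 2 * pi * V"
proof -
  obtain g where g: "integrable lborel g" "AE x in lebesgue. \<phi> x = g x"
    by (rule L1_borel_representative[OF \<phi>]) (rule that)
  have gm[measurable]: "g \<in> borel_measurable borel" using g(1) by auto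
  have \<phi>m: "\<phi> \<in> borel_measurable lebesgue" using \<phi> by (auto simp: L1_def)
  have \<psi>m: "\<psi> \<in> borel_measurable lebesgue" using \<psi> by (auto simp: L1_def)
  have cis_meas[measurable]: "cis \<in> borel_measurable borel"
    by (intro borel_measurable_continuous_onI continuous_intros)
  define H where "H t = (CLINT x|lborel. g x * cis (- (t * x)))" for t
  have H: "fourier \<phi> t = H t" for t
    unfolding H_def by (rule fourier_cong_AE[OF g(2) \<phi>m]) simp
  have Hm[measurable]: "H \<in> borel_measurable borel" unfolding H_def by measurable
  have ae': "AE t in lebesgue. \<psi> t = H t" using ae by (simp add: H)
  define I where "I = (LINT x|lborel. cmod (g x))"
  define \<epsilon> where "\<epsilon> n = 1 / real (Suc n)" for n
  have \<epsilon>: "\<epsilon> n > 0" for n by (simp add: \<epsilon>_def)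
  define J where "J n = (CLINT t|lborel. H t * (cis (- (\<omega> * t)) * of_real (exp (- ((\<epsilon> n * t)\<^sup>2) / 2))))" for n
  have H_int: "integrable lborel H"
  proof -
    have "integrable lebesgue H"
    proof -
      have "H \<in> borel_measurable lebesgue" by (rule measurable_completion) simp
      then show ?thesis using \<psi> integrable_cong_AE[OF \<psi>m _ ae'] unfolding L1_def by blast
    qed
    then show ?thesis by (simp add: integrable_completion)
  qed
  have "J \<longlonglongrightarrow> (CLINT t|lborel. H t * cis (- (\<omega> * t)))"
    unfolding J_def
  proof (rule Bochner_Integration.integral_dominated_convergence)
    show "integrable lborel (\<lambda>t. cmod (H t))" using H_int by (rule integrable_norm)
    show "AE t in lborel. (\<lambda>n. H t * (cis (- (\<omega> * t)) * of_real (exp (- ((\<epsilon> n * t)\<^sup>2) / 2)))) \<longlonglongrightarrow> H t * cis (- (\<omega> * t))"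
    proof (rule AE_I2)
      fix t
      have "\<epsilon> \<longlonglongrightarrow> 0" unfolding \<epsilon>_def by real_asymp
      then have "(\<lambda>n. H t * (cis (- (\<omega> * t)) * of_real (exp (- ((\<epsilon> n * t)\<^sup>2) / 2))))
          \<longlonglongrightarrow> H t * (cis (- (\<omega> * t)) * of_real (exp (- ((0 * t)\<^sup>2) / 2)))"
        by (intro tendsto_mult tendsto_const tendsto_of_real tendsto_exp tendsto_divide tendsto_minus tendsto_power) auto
      then show "(\<lambda>n. H t * (cis (- (\<omega> * t)) * of_real (exp (- ((\<epsilon> n * t)\<^sup>2) / 2)))) \<longlonglongrightarrow> H t * cis (- (\<omega> * t))" by simp
    qed
    show "AE t in lborel. norm (H t * (cis (- (\<omega> * t)) * of_real (exp (- ((\<epsilon> n * t)\<^sup>2) / 2)))) \<le> cmod (H t)" for n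
    proof (rule AE_I2)
      fix t
      have "cmod (H t) * exp (- ((\<epsilon> n * t)\<^sup>2) / 2) \<le> cmod (H t) * 1" by (intro mult_left_mono) auto
      then show "norm (H t * (cis (- (\<omega> * t)) * of_real (exp (- ((\<epsilon> n * t)\<^sup>2) / 2)))) \<le> cmod (H t)"
        by (simp add: norm_mult)
    qed
  qed measurable
  also have "(CLINT t|lborel. H t * cis (- (\<omega> * t))) = fourier \<psi> \<omega>"
    by (rule fourier_cong_AE[OF ae' \<psi>m, symmetric]) simp
  finally have lim: "(\<lambda>n. cmod (J n)) \<longlonglongrightarrow> cmod (fourier \<psi> \<omega>)" by (rule tendsto_norm)
  have ae_g: "AE x in lborel. \<bar>x + \<omega>\<bar> < 1 \<longrightarrow> cmod (g x) \<le> V"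
  proof -
    have "AE x in lebesgue. \<bar>x + \<omega>\<bar> < 1 \<longrightarrow> cmod (g x) \<le> V" using V(2) g(2) by eventually_elim simp
    then show ?thesis by (simp add: AE_completion_iff)
  qed
  have J_le: "cmod (J n) \<le> 2 * pi * (V + I * normal_density 0 (\<epsilon> n) 1)" for n
  proof -
    define N where "N x = normal_density 0 (\<epsilon> n) (x + \<omega>)" for x
    have N0: "N x \<ge> 0" for x by (simp add: N_def normal_density_nonneg)
    have N_eq: "N = normal_density (- \<omega>) (\<epsilon> n)" by (auto simp: N_def normal_density_def)
    have N_int: "integrable lborel N" "(LINT x|lborel. N x) = 1"
      unfolding N_eq using \<epsilon> by simp_all
    have [measurable]: "N \<in> borel_measurable borel" unfolding N_eq by measurable
    have bound_int: "integrable lborel (\<lambda>x. 2 * pi * (V * N x + cmod (g x) * normal_density 0 (\<epsilon> n) 1))"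
      using N_int(1) g(1) by (intro integrable_mult_right Bochner_Integration.integrable_add integrable_mult_left integrable_norm)
    have pt: "AE x in lborel. cmod (g x * of_real (2 * pi * N x)) \<le> 2 * pi * (V * N x + cmod (g x) * normal_density 0 (\<epsilon> n) 1)"
      using ae_g
    proof eventually_elim
      case (elim x)
      have nd: "normal_density 0 (\<epsilon> n) 1 \<ge> 0" by (simp add: normal_density_nonneg)
      have "cmod (g x) * N x \<le> V * N x + cmod (g x) * normal_density 0 (\<epsilon> n) 1"
      proof (cases "\<bar>x + \<omega>\<bar> < 1")
        case True
        then have "cmod (g x) * N x \<le> V * N x" using elim N0 by (intro mult_right_mono) auto
        moreover have "0 \<le> cmod (g x) * normal_density 0 (\<epsilon> n) 1" using nd by simp
        ultimately show ?thesis by linarith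
      next
        case False
        then have "N x \<le> normal_density 0 (\<epsilon> n) 1"
          unfolding N_def by (intro normal_density_le_at_1 \<epsilon>) simp
        then have "cmod (g x) * N x \<le> cmod (g x) * normal_density 0 (\<epsilon> n) 1" by (intro mult_left_mono) auto
        moreover have "0 \<le> V * N x" using V N0 by simp
        ultimately show ?thesis by linarith
      qed
      then have "2 * pi * (cmod (g x) * N x) \<le> 2 * pi * (V * N x + cmod (g x) * normal_density 0 (\<epsilon> n) 1)"
        by (intro mult_left_mono) auto
      moreover have "cmod (g x * of_real (2 * pi * N x)) = 2 * pi * (cmod (g x) * N x)"
        using N0[of x] by (simp add: norm_mult)
      ultimately show ?case by simp
    qed
    have f_int: "integrable lborel (\<lambda>x. g x * of_real (2 * pi * N x))"
    proof (rule Bochner_Integration.integrable_bound[OF bound_int])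
      show "(\<lambda>x. g x * complex_of_real (2 * pi * N x)) \<in> borel_measurable lborel" by measurable
      show "AE x in lborel. norm (g x * of_real (2 * pi * N x))
          \<le> norm (2 * pi * (V * N x + cmod (g x) * normal_density 0 (\<epsilon> n) 1))"
        using pt
      proof eventually_elim
        case (elim x)
        show ?case by (rule order_trans[OF elim]) (simp only: real_norm_def abs_ge_self)
      qed
    qed
    have "J n = (CLINT x|lborel. g x * of_real (2 * pi * N x))"
      unfolding J_def H_def N_def by (rule gaussian_mean_of_transform[OF g(1) \<epsilon>])
    also have "cmod \<dots> \<le> (LINT x|lborel. cmod (g x * of_real (2 * pi * N x)))"
      by (rule integral_norm_bound)
    also have "\<dots> \<le> (LINT x|lborel. 2 * pi * (V * N x + cmod (g x) * normal_density 0 (\<epsilon> n) 1))"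
      by (rule integral_mono_AE[OF integrable_norm[OF f_int] bound_int pt])
    also have "\<dots> = 2 * pi * (V * 1 + I * normal_density 0 (\<epsilon> n) 1)"
      using N_int g(1) by (simp add: I_def)
    finally show ?thesis by simp
  qed
  have "(\<lambda>n. normal_density 0 (\<epsilon> n) 1) \<longlonglongrightarrow> 0"
    unfolding normal_density_def \<epsilon>_def by real_asymp
  then have "(\<lambda>n. 2 * pi * (V + I * normal_density 0 (\<epsilon> n) 1)) \<longlonglongrightarrow> 2 * pi * (V + I * 0)"
    by (intro tendsto_intros)
  then have "cmod (fourier \<psi> \<omega>) \<le> 2 * pi * (V + I * 0)"
    by (rule LIMSEQ_le[OF lim]) (use J_le in blast)
  then show ?thesis by simp
qed

lemma card_int_clustered:
  fixes S :: "int set"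
  assumes "finite S" "\<And>k l. k \<in> S \<Longrightarrow> l \<in> S \<Longrightarrow> k - l < int n"
  shows "card S \<le> n"
proof (cases "S = {}")
  case False
  then have "S \<subseteq> {Min S..<Min S + int n}"
    using assms Min_in[OF assms(1) False] by (fastforce simp: Min_le)
  then have "card S \<le> card {Min S..<Min S + int n}" by (intro card_mono) auto
  then show ?thesis by simp
qed simp

text \<open>The value at \<open>\<omega>\<close> is controlled by the three unit intervals that cover the neighbourhood of radius
  \<open>1\<close> of \<open>-\<omega>\<close>.  The points \<open>-(\<omega> + 2 \<pi> k / \<alpha>)\<close> have spacing \<open>2 \<pi> / \<alpha>\<close>, so at most \<open>n\<close> of them share an integer
  part, and even the sum of the values, not only of their squares, is bounded uniformly in \<open>\<omega>\<close>.\<close>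

theorem bessel_bound_Wiener_hat:
  assumes \<psi>: "\<psi> \<in> L1" and W: "\<psi> \<in> Wiener_hat" and \<alpha>: "\<alpha> > 0"
  shows "\<exists>C. bessel_bound \<alpha> \<psi> C"
proof -
  obtain \<phi> where \<phi>: "\<phi> \<in> Wiener" "AE t in lebesgue. \<psi> t = fourier \<phi> t"
    using W by (auto simp: Wiener_hat_def)
  obtain v K where v: "K > 0" "\<And>k. v k \<ge> 0" "\<And>F. finite F \<Longrightarrow> (\<Sum>k\<in>F. v k) \<le> K"
    "\<And>k. AE x in lebesgue. x \<in> {of_int k..of_int k + 1} \<longrightarrow> cmod (\<phi> x) \<le> v k"
    by (rule Wiener_amalgam_bounds[OF \<phi>(1)]) (rule that)
  define u where "u m = v (m - 1) + v m + v (m + 1)" for m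
  have u0: "u m \<ge> 0" for m by (simp add: u_def v(2))
  have u_sum: "(\<Sum>m\<in>F. u m) \<le> 3 * K" if F: "finite F" for F
  proof -
    have "(\<Sum>m\<in>F. v (m + c)) \<le> K" for c
    proof -
      have "(\<Sum>m\<in>F. v (m + c)) = (\<Sum>m\<in>(\<lambda>m. m + c) ` F. v m)" by (subst sum.reindex) (auto simp: inj_on_def)
      also have "\<dots> \<le> K" using F by (intro v(3)) simp
      finally show ?thesis .
    qed
    from this[of "-1"] this[of 0] this[of 1] show ?thesis by (simp add: u_def sum.distrib)
  qed
  have pointwise: "cmod (fourier \<psi> \<omega>) \<le> 2 * pi * u \<lfloor>- \<omega>\<rfloor>" for \<omega>
  proof (rule fourier_transform_bound[OF \<psi> Wiener_subset_L1[OF \<phi>(1)] \<phi>(2) u0])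
    let ?m = "\<lfloor>- \<omega>\<rfloor>"
    show "AE x in lebesgue. \<bar>x + \<omega>\<bar> < 1 \<longrightarrow> cmod (\<phi> x) \<le> u ?m"
      using v(4)[of "?m - 1"] v(4)[of ?m] v(4)[of "?m + 1"]
    proof eventually_elim
      case (elim x)
      show ?case
      proof
        assume "\<bar>x + \<omega>\<bar> < 1"
        then have "of_int ?m - 1 \<le> x" "x \<le> of_int ?m + 2" by linarith+
        then consider "x \<in> {of_int (?m - 1)..of_int (?m - 1) + 1}" | "x \<in> {of_int ?m..of_int ?m + 1}"
          | "x \<in> {of_int (?m + 1)..of_int (?m + 1) + 1}"
          by fastforce
        then show "cmod (\<phi> x) \<le> u ?m"
          using elim v(2)[of "?m - 1"] v(2)[of ?m] v(2)[of "?m + 1"] unfolding u_def by cases auto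
      qed
    qed
  qed
  define n where "n = nat \<lceil>\<alpha> / (2 * pi)\<rceil>"
  have n: "\<alpha> / (2 * pi) \<le> real n" unfolding n_def by linarith
  have "bessel_bound \<alpha> \<psi> ((2 * pi * (real n * (3 * K)))\<^sup>2)"
    unfolding bessel_bound_def
  proof (intro allI impI)
    fix \<omega> :: real and F :: "int set" assume F: "finite F"
    define a where "a k = cmod (fourier \<psi> (\<omega> + 2 * pi * (of_int k / \<alpha>)))" for k :: int
    define cell where "cell k = \<lfloor>- (\<omega> + 2 * pi * (of_int k / \<alpha>))\<rfloor>" for k :: int
    have fibre: "card {k\<in>F. cell k = m} \<le> n" for m
    proof (rule card_int_clustered)
      fix k l assume "k \<in> {k\<in>F. cell k = m}" "l \<in> {k\<in>F. cell k = m}"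
      then have "cell k = cell l" by simp
      then have "2 * pi * (of_int k / \<alpha>) - 2 * pi * (of_int l / \<alpha>) < 1"
        unfolding cell_def by linarith
      then have "2 * pi * (real_of_int k - of_int l) < \<alpha>" using \<alpha> by (simp add: field_simps)
      then have "real_of_int k - of_int l < \<alpha> / (2 * pi)" by (simp add: pos_less_divide_eq mult.commute)
      then show "k - l < int n" using n by linarith
    qed (use F in simp)
    have "(\<Sum>k\<in>F. (a k)\<^sup>2) \<le> (\<Sum>k\<in>F. a k)\<^sup>2"
    proof -
      have "(\<Sum>k\<in>F. (a k)\<^sup>2) \<le> (\<Sum>k\<in>F. a k * (\<Sum>l\<in>F. a l))"
        unfolding power2_eq_square using F by (intro sum_mono mult_left_mono member_le_sum) (auto simp: a_def)
      then show ?thesis by (simp add: power2_eq_square sum_distrib_right)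
    qed
    also have "\<dots> \<le> (2 * pi * (real n * (3 * K)))\<^sup>2"
    proof (rule power_mono)
      have "(\<Sum>k\<in>F. a k) \<le> (\<Sum>k\<in>F. 2 * pi * u (cell k))"
        unfolding a_def cell_def by (intro sum_mono pointwise)
      also have "\<dots> = 2 * pi * (\<Sum>m\<in>cell ` F. \<Sum>k\<in>{k\<in>F. cell k = m}. u (cell k))"
        unfolding sum_distrib_left[symmetric] using F by (subst sum.image_gen[OF F, of _ cell]) simp
      also have "(\<Sum>m\<in>cell ` F. \<Sum>k\<in>{k\<in>F. cell k = m}. u (cell k)) = (\<Sum>m\<in>cell ` F. real (card {k\<in>F. cell k = m}) * u m)"
        by (intro sum.cong refl) simp
      also have "2 * pi * \<dots> \<le> 2 * pi * (\<Sum>m\<in>cell ` F. real n * u m)"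
        using fibre u0 by (intro mult_left_mono sum_mono mult_right_mono) auto
      also have "\<dots> = 2 * pi * (real n * (\<Sum>m\<in>cell ` F. u m))" by (simp add: sum_distrib_left)
      also have "\<dots> \<le> 2 * pi * (real n * (3 * K))"
        using F by (intro mult_left_mono u_sum) auto
      finally show "(\<Sum>k\<in>F. a k) \<le> 2 * pi * (real n * (3 * K))" .
      show "0 \<le> (\<Sum>k\<in>F. a k)" by (simp add: a_def sum_nonneg)
    qed
    finally show "(\<Sum>k\<in>F. (cmod (fourier \<psi> (\<omega> + 2 * pi * (of_int k / \<alpha>))))\<^sup>2) \<le> (2 * pi * (real n * (3 * K)))\<^sup>2"
      unfolding a_def .
  qed
  then show ?thesis by blast
qed

theorem proposition9:
  fixes \<alpha> :: real and \<psi> :: "real \<Rightarrow> complex"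
  assumes "\<alpha> > 0"
  shows "(\<psi> \<in> L1 \<longrightarrow>
            (continuous_map AP_R_topology AP_Z_topology (sampling_map \<alpha> \<psi>) \<longleftrightarrow>
             (SUP \<omega>::real. \<Sum>\<^sub>\<infinity>k::int.
                ennreal ((cmod (fourier \<psi> (\<omega> + 2 * pi * (of_int k / \<alpha>))))\<^sup>2)) < \<infinity>))
       \<and> (\<psi> \<in> Wiener \<or> \<psi> \<in> L1 \<inter> Wiener_hat \<longrightarrow>
            (SUP \<omega>::real. \<Sum>\<^sub>\<infinity>k::int.
                ennreal ((cmod (fourier \<psi> (\<omega> + 2 * pi * (of_int k / \<alpha>))))\<^sup>2)) < \<infinity> \<and>
            continuous_map AP_R_topology AP_Z_topology (sampling_map \<alpha> \<psi>))"
proof (intro conjI impI)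
  let ?sup = "SUP \<omega>::real. \<Sum>\<^sub>\<infinity>k::int.
      ennreal ((cmod (fourier \<psi> (\<omega> + 2 * pi * (of_int k / \<alpha>))))\<^sup>2)"
  have sup_iff: "?sup < \<infinity> \<longleftrightarrow> (\<exists>C. bessel_bound \<alpha> \<psi> C)"
    unfolding bessel_bound_def by (rule SUP_infsum_ennreal_finite_iff) simp
  { assume "\<psi> \<in> L1"
    then show "continuous_map AP_R_topology AP_Z_topology (sampling_map \<alpha> \<psi>) \<longleftrightarrow> ?sup < \<infinity>"
      unfolding sup_iff by (rule continuous_map_sampling_iff) (rule assms) }
  { assume "\<psi> \<in> Wiener \<or> \<psi> \<in> L1 \<inter> Wiener_hat"
    then have L1: "\<psi> \<in> L1" and C: "\<exists>C. bessel_bound \<alpha> \<psi> C"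
      using Wiener_subset_L1 bessel_bound_Wiener bessel_bound_Wiener_hat assms by auto
    show "?sup < \<infinity>" unfolding sup_iff by (rule C)
    show "continuous_map AP_R_topology AP_Z_topology (sampling_map \<alpha> \<psi>)"
      unfolding continuous_map_sampling_iff[OF L1 assms] by (rule C) }
qed

end
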